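(* Let $(M,(\Lambda,E),\omega)$ be a twisted Jacobi manifold. Then the bracket $\{f,g\}=\Lambda(df,dg)+\langle f\,dg-g\,df,E\rangle$ on $C^\infty(M,\mathbb{R})$ induces a transitive twisted Jacobi structure on each characteristic leaf of $M$. That is, for each characteristic leaf $S$, the rule $\{\tilde f,\tilde g\}_S(x)=\{f,g\}(x)$, for $\tilde f,\tilde g\in C^\infty(S,\mathbb{R})$ and $x\in S$, where $f,g$ are smooth functions on a neighbourhood of $x$ in $M$ that extend the restrictions of $\tilde f,\tilde g$ to a neighbourhood of $x$ in $S$ (for the leaf topology), gives a well-defined bracket on $C^\infty(S,\mathbb{R})$, and there are a bivector field $\Lambda_S$, a vector field $E_S$ and a $2$-form $\omega_S$ on $S$ such that $(S,(\Lambda_S,E_S),\omega_S)$ is a transitive twisted Jacobi manifold and $\{\tilde f,\tilde g\}_S=\Lambda_S(d\tilde f,d\tilde g)+\langle \tilde f\,d\tilde g-\tilde g\,d\tilde f,E_S\rangle$ for all $\tilde f,\tilde g\in C^\infty(S,\mathbb{R})$.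
   Context: Everything is smooth. Conventions: for a bivector field $\Lambda$ on $M$, $\Lambda^{\#}:T^*M\to TM$ is defined by $\langle\beta,\Lambda^{\#}(\alpha)\rangle=\Lambda(\alpha,\beta)$. For a $k$-form $\eta$, $\Lambda^{\#}(\eta)$ is the $k$-vector field $\Lambda^{\#}(\eta)(\alpha_1,\dots,\alpha_k)=(-1)^k\eta(\Lambda^{\#}(\alpha_1),\dots,\Lambda^{\#}(\alpha_k))$, and for a vector field $X$, $(\Lambda^{\#}\otimes 1)(\eta)(X)$ is the $(k-1)$-vector field $(\Lambda^{\#}\otimes 1)(\eta)(X)(\alpha_1,\dots,\alpha_{k-1})=(-1)^k\eta(\Lambda^{\#}(\alpha_1),\dots,\Lambda^{\#}(\alpha_{k-1}),X)$. $[\cdot,\cdot]$ is the Schouten bracket of multivector fields, with $[X,P]=\mathcal{L}_XP$ for a vector field $X$ and $[X_1\wedge X_2,Y_1\wedge Y_2]=\sum_{i,j}(-1)^{i+j}[X_i,Y_j]\wedge X_{3-i}\wedge Y_{3-j}$. Twisted Jacobi manifold: a manifold $M$ with a bivector field $\Lambda$, a vector field $E$ and a $2$-form $\omega$ such that $$[\Lambda,\Lambda]+2E\wedge\Lambda=2\Lambda^{\#}(d\omega)+2(\Lambda^{\#}(\omega))\wedge E,$$ $$[E,\Lambda]=(\Lambda^{\#}\otimes 1)(d\omega)(E)-\big((\Lambda^{\#}\otimes 1)(\omega)(E)\big)\wedge E.$$ The characteristic distribution of $(M,(\Lambda,E),\omega)$ is, at each $p\in M$, the subspace $\{\Lambda^{\#}(\alpha)+tE_p:\alpha\in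 T_p^*M,\ t\in\mathbb{R}\}$ of $T_pM$. It is the image of the anchor of a Lie algebroid structure on $T^*M\times\mathbb{R}$, hence is completely integrable and determines a (possibly singular) foliation of $M$ by immersed submanifolds, called the characteristic leaves. The twisted Jacobi manifold is transitive if at every point the characteristic leaf through that point has dimension $\dim M$. *)

theory Defs
  imports "HOL-Analysis.Analysis"
begin

section \<open>Smooth maps on open subsets of a linear model space\<close>

text \<open>The model space of a manifold is a linear subspace \<open>V\<close> of a Euclidean space \<open>'e\<close>.
  Thus manifolds of every dimension from 0 to \<open>DIM('e)\<close>, in particular a manifold and
  its leaves, live in one type.\<close>

primrec iter_dderiv :: "'e::euclidean_space list \<Rightarrow> ('e \<Rightarrow> 'b::real_normed_vector) \<Rightarrow> 'e \<Rightarrow> 'b" where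
  "iter_dderiv [] f = f"
| "iter_dderiv (v # vs) f =
     (\<lambda>x. vector_derivative (\<lambda>t. iter_dderiv vs f (x + t *\<^sub>R v)) (at 0))"

definition smooth_in :: "'e::euclidean_space set \<Rightarrow> 'e set \<Rightarrow> ('e \<Rightarrow> 'b::real_normed_vector) \<Rightarrow> bool" where
  "smooth_in V W f \<longleftrightarrow> openin (top_of_set V) W \<and>
     (\<forall>vs. set vs \<subseteq> V \<longrightarrow>
        continuous_on W (iter_dderiv vs f) \<and>
        (\<forall>v\<in>V. \<forall>x\<in>W. (\<lambda>t. iter_dderiv vs f (x + t *\<^sub>R v)) differentiable (at (0::real))))"

section \<open>Manifolds\<close>

text \<open>The underlying set of a manifold is the carrier \<open>topspace (topo M)\<close>, so that an immersed
  submanifold is a subset of \<open>'a\<close> with its own topology and atlas.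
  A chart is a pair of its domain and a map that matters on that domain only.\<close>

record ('a, 'e) manifold =
  topo :: "'a topology"
  model :: "'e set"
  atlas :: "('a set \<times> ('a \<Rightarrow> 'e)) set"

abbreviation pts :: "('a, 'e) manifold \<Rightarrow> 'a set" where
  "pts M \<equiv> topspace (topo M)"

definition mdim :: "('a, 'e::euclidean_space) manifold \<Rightarrow> nat" where
  "mdim M = dim (model M)"

definition is_chart :: "('a, 'e::euclidean_space) manifold \<Rightarrow> 'a set \<Rightarrow> ('a \<Rightarrow> 'e) \<Rightarrow> bool" where
  "is_chart M U \<phi> \<longleftrightarrow> openin (topo M) U \<and> openin (top_of_set (model M)) (\<phi> ` U) \<and>
     homeomorphic_map (subtopology (topo M) U) (top_of_set (\<phi> ` U)) \<phi>"

definition smooth_manifold :: "('a, 'e::euclidean_space) manifold \<Rightarrow> bool" where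
  "smooth_manifold M \<longleftrightarrow>
     subspace (model M) \<and> Hausdorff_space (topo M) \<and> second_countable (topo M) \<and>
     (\<forall>(U, \<phi>)\<in>atlas M. is_chart M U \<phi>) \<and>
     (\<forall>p\<in>pts M. \<exists>(U, \<phi>)\<in>atlas M. p \<in> U) \<and>
     (\<forall>(U, \<phi>)\<in>atlas M. \<forall>(U', \<phi>')\<in>atlas M.
        smooth_in (model M) (\<phi> ` (U \<inter> U')) (\<phi>' \<circ> inv_into U \<phi>))"

definition smooth_fun_on :: "('a, 'e::euclidean_space) manifold \<Rightarrow> 'a set \<Rightarrow> ('a \<Rightarrow> real) \<Rightarrow> bool" where
  "smooth_fun_on M W f \<longleftrightarrow> openin (topo M) W \<and>
     (\<forall>(U, \<phi>)\<in>atlas M. smooth_in (model M) (\<phi> ` (U \<inter> W)) (f \<circ> inv_into U \<phi>))"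

text \<open>Functions are total on \<open>'a\<close>; a member of \<open>smooth_funs M\<close> is arbitrary outside \<open>M\<close>.\<close>

definition smooth_funs :: "('a, 'e::euclidean_space) manifold \<Rightarrow> ('a \<Rightarrow> real) set" where
  "smooth_funs M = {f. smooth_fun_on M (pts M) f}"

definition smooth_near :: "('a, 'e::euclidean_space) manifold \<Rightarrow> 'a \<Rightarrow> ('a \<Rightarrow> real) \<Rightarrow> bool" where
  "smooth_near M p f \<longleftrightarrow> (\<exists>W. p \<in> W \<and> smooth_fun_on M W f)"

definition smooth_map :: "('a, 'e::euclidean_space) manifold \<Rightarrow> ('b, 'd::euclidean_space) manifold \<Rightarrow> ('a \<Rightarrow> 'b) \<Rightarrow> bool" where
  "smooth_map N M F \<longleftrightarrow> continuous_map (topo N) (topo M) F \<and>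
     (\<forall>(U, \<phi>)\<in>atlas N. \<forall>(U', \<psi>)\<in>atlas M.
        smooth_in (model N) (\<phi> ` {x \<in> U. F x \<in> U'}) (\<psi> \<circ> F \<circ> inv_into U \<phi>))"

section \<open>Tangent and cotangent spaces\<close>

text \<open>Tangent vectors at \<open>p\<close> are the derivations of germs of smooth functions at \<open>p\<close>.  As HOL
  functions are total, tangent vectors and covectors are required to vanish outside their proper
  domains, which makes equality of vectors coincide with HOL equality.\<close>

type_synonym 'a tvec = "('a \<Rightarrow> real) \<Rightarrow> real"
type_synonym 'a covec = "'a tvec \<Rightarrow> real"

definition tangent :: "('a, 'e::euclidean_space) manifold \<Rightarrow> 'a \<Rightarrow> 'a tvec set" where
  "tangent M p = {v.
     (\<forall>f g. smooth_near M p f \<longrightarrow> smooth_near M p g \<longrightarrow>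
        (\<forall>a b. v (\<lambda>x. a * f x + b * g x) = a * v f + b * v g) \<and>
        v (\<lambda>x. f x * g x) = v f * g p + f p * v g \<and>
        ((\<exists>W. openin (topo M) W \<and> p \<in> W \<and> (\<forall>x\<in>W. f x = g x)) \<longrightarrow> v f = v g)) \<and>
     (\<forall>f. \<not> smooth_near M p f \<longrightarrow> v f = 0)}"

definition cotangent :: "('a, 'e::euclidean_space) manifold \<Rightarrow> 'a \<Rightarrow> 'a covec set" where
  "cotangent M p = {\<alpha>.
     (\<forall>u\<in>tangent M p. \<forall>v\<in>tangent M p. \<forall>a b.
        \<alpha> (\<lambda>f. a * u f + b * v f) = a * \<alpha> u + b * \<alpha> v) \<and>
     (\<forall>v. v \<notin> tangent M p \<longrightarrow> \<alpha> v = 0)}"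

definition differential :: "('a, 'e::euclidean_space) manifold \<Rightarrow> 'a \<Rightarrow> ('a \<Rightarrow> real) \<Rightarrow> 'a covec" where
  "differential M p f = (\<lambda>v. if v \<in> tangent M p then v f else 0)"

definition tangent_map :: "('b, 'd::euclidean_space) manifold \<Rightarrow> ('a \<Rightarrow> 'b) \<Rightarrow> 'a \<Rightarrow> 'a tvec \<Rightarrow> 'b tvec" where
  "tangent_map M F p v = (\<lambda>f. if smooth_near M (F p) f then v (f \<circ> F) else 0)"

definition immersed_submanifold :: "('a, 'e::euclidean_space) manifold \<Rightarrow> ('a, 'e) manifold \<Rightarrow> bool" where
  "immersed_submanifold M S \<longleftrightarrow> smooth_manifold S \<and> pts S \<subseteq> pts M \<and> smooth_map S M id \<and>
     (\<forall>p\<in>pts S. inj_on (tangent_map M id p) (tangent S p))"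

section \<open>Multivectors and forms\<close>

text \<open>A \<open>k\<close>-vector at \<open>p\<close> is an alternating multilinear function of \<open>k\<close> covectors at \<open>p\<close>, a
  \<open>k\<close>-form one of \<open>k\<close> tangent vectors; arguments are passed as a list of length \<open>k\<close>, and values
  on other lists are irrelevant.\<close>

type_synonym 'a kvec = "'a covec list \<Rightarrow> real"
type_synonym 'a kform = "'a tvec list \<Rightarrow> real"

definition alternating_on :: "nat \<Rightarrow> ('b \<Rightarrow> real) set \<Rightarrow> (('b \<Rightarrow> real) list \<Rightarrow> real) \<Rightarrow> bool" where
  "alternating_on k T \<eta> \<longleftrightarrow>
     (\<forall>xs. length xs = k \<longrightarrow> set xs \<subseteq> T \<longrightarrow>
        (\<forall>i<k. \<forall>y\<in>T. \<forall>z\<in>T. \<forall>a b.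
           \<eta> (xs[i := (\<lambda>t. a * y t + b * z t)]) = a * \<eta> (xs[i := y]) + b * \<eta> (xs[i := z])) \<and>
        (\<forall>i<k. \<forall>j<k. i \<noteq> j \<longrightarrow> xs ! i = xs ! j \<longrightarrow> \<eta> xs = 0))"

definition vector_field_on :: "('a, 'e::euclidean_space) manifold \<Rightarrow> 'a set \<Rightarrow> ('a \<Rightarrow> 'a tvec) \<Rightarrow> bool" where
  "vector_field_on M W X \<longleftrightarrow> openin (topo M) W \<and> (\<forall>p\<in>W. X p \<in> tangent M p) \<and>
     (\<forall>U f. U \<subseteq> W \<longrightarrow> smooth_fun_on M U f \<longrightarrow> smooth_fun_on M U (\<lambda>p. X p f))"

definition kvector_field :: "('a, 'e::euclidean_space) manifold \<Rightarrow> nat \<Rightarrow> ('a \<Rightarrow> 'a kvec) \<Rightarrow> bool" where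
  "kvector_field M k P \<longleftrightarrow> (\<forall>p\<in>pts M. alternating_on k (cotangent M p) (P p)) \<and>
     (\<forall>U fs. length fs = k \<longrightarrow> openin (topo M) U \<longrightarrow> (\<forall>f\<in>set fs. smooth_fun_on M U f) \<longrightarrow>
        smooth_fun_on M U (\<lambda>p. P p (map (differential M p) fs)))"

definition kform_field :: "('a, 'e::euclidean_space) manifold \<Rightarrow> nat \<Rightarrow> ('a \<Rightarrow> 'a kform) \<Rightarrow> bool" where
  "kform_field M k \<eta> \<longleftrightarrow> (\<forall>p\<in>pts M. alternating_on k (tangent M p) (\<eta> p)) \<and>
     (\<forall>U Xs. length Xs = k \<longrightarrow> openin (topo M) U \<longrightarrow> (\<forall>X\<in>set Xs. vector_field_on M U X) \<longrightarrow>
        smooth_fun_on M U (\<lambda>p. \<eta> p (map (\<lambda>X. X p) Xs)))"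

definition vec_to_kvec :: "'a tvec \<Rightarrow> 'a kvec" where
  "vec_to_kvec v = (\<lambda>\<alpha>s. hd \<alpha>s v)"

text \<open>The wedge product of a \<open>k\<close>- and an \<open>l\<close>-vector, normalised by
  \<open>(X \<and> Y)(\<alpha>, \<beta>) = \<alpha>(X) \<beta>(Y) - \<alpha>(Y) \<beta>(X)\<close>.\<close>

definition wedge :: "nat \<Rightarrow> nat \<Rightarrow> 'a kvec \<Rightarrow> 'a kvec \<Rightarrow> 'a kvec" where
  "wedge k l P Q = (\<lambda>\<alpha>s. (1 / (fact k * fact l)) *
     (\<Sum>\<pi> | \<pi> permutes {..<k + l}. of_int (sign \<pi>) *
        P (map (\<lambda>i. \<alpha>s ! \<pi> i) [0..<k]) * Q (map (\<lambda>i. \<alpha>s ! \<pi> i) [k..<k + l])))"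

primrec wedge_vecs :: "'a tvec list \<Rightarrow> 'a kvec" where
  "wedge_vecs [] = (\<lambda>_. 1)"
| "wedge_vecs (v # vs) = wedge 1 (length vs) (vec_to_kvec v) (wedge_vecs vs)"

section \<open>Lie bracket, Schouten bracket and exterior derivative\<close>

definition lie_bracket :: "('a, 'e::euclidean_space) manifold \<Rightarrow> ('a \<Rightarrow> 'a tvec) \<Rightarrow> ('a \<Rightarrow> 'a tvec) \<Rightarrow> 'a \<Rightarrow> 'a tvec" where
  "lie_bracket M X Y p = (\<lambda>f. if smooth_near M p f
     then X p (\<lambda>q. Y q f) - Y p (\<lambda>q. X q f) else 0)"

text \<open>On \<open>W\<close>, the \<open>k\<close>-vector field \<open>P\<close> is the sum, over the members \<open>[X\<^sub>1, \<dots>, X\<^sub>k]\<close> of the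
  list \<open>Xss\<close>, of the decomposable fields \<open>X\<^sub>1 \<and> \<dots> \<and> X\<^sub>k\<close>.\<close>

definition decomposition_on ::
    "('a, 'e::euclidean_space) manifold \<Rightarrow> nat \<Rightarrow> 'a set \<Rightarrow> ('a \<Rightarrow> 'a tvec) list list \<Rightarrow> ('a \<Rightarrow> 'a kvec) \<Rightarrow> bool" where
  "decomposition_on M k W Xss P \<longleftrightarrow> openin (topo M) W \<and>
     (\<forall>Xs\<in>set Xss. length Xs = k \<and> (\<forall>X\<in>set Xs. vector_field_on M W X)) \<and>
     (\<forall>q\<in>W. \<forall>\<alpha>s. length \<alpha>s = k \<longrightarrow> set \<alpha>s \<subseteq> cotangent M q \<longrightarrow>
        P q \<alpha>s = (\<Sum>Xs\<leftarrow>Xss. wedge_vecs (map (\<lambda>X. X q) Xs) \<alpha>s))"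

text \<open>\<open>[X\<^sub>1 \<and> \<dots> \<and> X\<^sub>k, Y\<^sub>1 \<and> \<dots> \<and> Y\<^sub>l] = \<Sum>\<^sub>i\<^sub>j (-1)^(i+j) [X\<^sub>i, Y\<^sub>j] \<and> X\<^sub>1 \<and> \<dots> \<and> X\<^sub>k \<and> Y\<^sub>1 \<and> \<dots> \<and> Y\<^sub>l\<close>
  with \<open>X\<^sub>i\<close> and \<open>Y\<^sub>j\<close> omitted on the right.\<close>

definition schouten_decomposable ::
    "('a, 'e::euclidean_space) manifold \<Rightarrow> ('a \<Rightarrow> 'a tvec) list \<Rightarrow> ('a \<Rightarrow> 'a tvec) list \<Rightarrow> 'a \<Rightarrow> 'a kvec" where
  "schouten_decomposable M Xs Ys p = (\<lambda>\<alpha>s. \<Sum>i<length Xs. \<Sum>j<length Ys. (-1) ^ (i + j) *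
     wedge_vecs (lie_bracket M (Xs ! i) (Ys ! j) p #
       map (\<lambda>X. X p) (nths Xs (- {i}) @ nths Ys (- {j}))) \<alpha>s)"

text \<open>The Schouten bracket of a \<open>k\<close>- and an \<open>l\<close>-vector field (\<open>k, l \<ge> 1\<close>) extends this formula
  bilinearly to all pairs of fields, each of which is locally a sum of decomposable ones.  For
  \<open>k = 1\<close> the formula reads \<open>[X, Y\<^sub>1 \<and> Y\<^sub>2] = [X, Y\<^sub>1] \<and> Y\<^sub>2 + Y\<^sub>1 \<and> [X, Y\<^sub>2]\<close>,
  so \<open>[X, Q]\<close> is the Lie derivative of \<open>Q\<close>.\<close>

definition schouten ::
    "('a, 'e::euclidean_space) manifold \<Rightarrow> nat \<Rightarrow> nat \<Rightarrow> ('a \<Rightarrow> 'a kvec) \<Rightarrow> ('a \<Rightarrow> 'a kvec) \<Rightarrow> 'a \<Rightarrow> 'a kvec" where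
  "schouten M k l P Q p = (\<lambda>\<alpha>s. THE r. \<forall>W Xss Yss.
     p \<in> W \<longrightarrow> decomposition_on M k W Xss P \<longrightarrow> decomposition_on M l W Yss Q \<longrightarrow>
     r = (\<Sum>Xs\<leftarrow>Xss. \<Sum>Ys\<leftarrow>Yss. schouten_decomposable M Xs Ys p \<alpha>s))"

text \<open>The value of \<open>d\<eta>\<close> on tangent vectors at \<open>p\<close> is given by the invariant formula applied to any
  extension of these to vector fields near \<open>p\<close>.\<close>

definition ext_deriv :: "('a, 'e::euclidean_space) manifold \<Rightarrow> ('a \<Rightarrow> 'a kform) \<Rightarrow> 'a \<Rightarrow> 'a kform" where
  "ext_deriv M \<eta> p = (\<lambda>vs. THE r. \<forall>W Xs.
     p \<in> W \<longrightarrow> (\<forall>X\<in>set Xs. vector_field_on M W X) \<longrightarrow> map (\<lambda>X. X p) Xs = vs \<longrightarrow>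
     r = (\<Sum>i<length Xs. (-1) ^ i *
            (Xs ! i) p (\<lambda>q. \<eta> q (map (\<lambda>X. X q) (nths Xs (- {i}))))) +
         (\<Sum>j<length Xs. \<Sum>i<j. (-1) ^ (i + j) *
            \<eta> p (lie_bracket M (Xs ! i) (Xs ! j) p # map (\<lambda>X. X p) (nths Xs (- {i, j})))))"

section \<open>Twisted Jacobi manifolds\<close>

definition sharp :: "('a, 'e::euclidean_space) manifold \<Rightarrow> ('a \<Rightarrow> 'a kvec) \<Rightarrow> 'a \<Rightarrow> 'a covec \<Rightarrow> 'a tvec" where
  "sharp M \<Lambda> p \<alpha> = (THE v. v \<in> tangent M p \<and> (\<forall>\<beta>\<in>cotangent M p. \<beta> v = \<Lambda> p [\<alpha>, \<beta>]))"

definition sharp_form ::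
    "('a, 'e::euclidean_space) manifold \<Rightarrow> ('a \<Rightarrow> 'a kvec) \<Rightarrow> ('a \<Rightarrow> 'a kform) \<Rightarrow> 'a \<Rightarrow> 'a kvec" where
  "sharp_form M \<Lambda> \<eta> p = (\<lambda>\<alpha>s. (-1) ^ length \<alpha>s * \<eta> p (map (sharp M \<Lambda> p) \<alpha>s))"

text \<open>The multivector field \<open>(\<Lambda>\<^sup># \<otimes> 1)(\<eta>)(X)\<close>; for a \<open>k\<close>-form \<open>\<eta>\<close> it takes \<open>k - 1\<close> covectors.\<close>

definition sharp_form_one ::
    "('a, 'e::euclidean_space) manifold \<Rightarrow> ('a \<Rightarrow> 'a kvec) \<Rightarrow> ('a \<Rightarrow> 'a kform) \<Rightarrow> ('a \<Rightarrow> 'a tvec) \<Rightarrow> 'a \<Rightarrow> 'a kvec" where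
  "sharp_form_one M \<Lambda> \<eta> X p =
     (\<lambda>\<alpha>s. (-1) ^ (length \<alpha>s + 1) * \<eta> p (map (sharp M \<Lambda> p) \<alpha>s @ [X p]))"

definition twisted_jacobi ::
    "('a, 'e::euclidean_space) manifold \<Rightarrow> ('a \<Rightarrow> 'a kvec) \<Rightarrow> ('a \<Rightarrow> 'a tvec) \<Rightarrow> ('a \<Rightarrow> 'a kform) \<Rightarrow> bool" where
  "twisted_jacobi M \<Lambda> E \<omega> \<longleftrightarrow>
     smooth_manifold M \<and> kvector_field M 2 \<Lambda> \<and> vector_field_on M (pts M) E \<and> kform_field M 2 \<omega> \<and>
     (\<forall>p\<in>pts M. \<forall>\<alpha>s. length \<alpha>s = 3 \<longrightarrow> set \<alpha>s \<subseteq> cotangent M p \<longrightarrow>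
        schouten M 2 2 \<Lambda> \<Lambda> p \<alpha>s + 2 * wedge 1 2 (vec_to_kvec (E p)) (\<Lambda> p) \<alpha>s =
        2 * sharp_form M \<Lambda> (ext_deriv M \<omega>) p \<alpha>s +
        2 * wedge 2 1 (sharp_form M \<Lambda> \<omega> p) (vec_to_kvec (E p)) \<alpha>s) \<and>
     (\<forall>p\<in>pts M. \<forall>\<alpha>s. length \<alpha>s = 2 \<longrightarrow> set \<alpha>s \<subseteq> cotangent M p \<longrightarrow>
        schouten M 1 2 (\<lambda>q. vec_to_kvec (E q)) \<Lambda> p \<alpha>s =
        sharp_form_one M \<Lambda> (ext_deriv M \<omega>) E p \<alpha>s -
        wedge 1 1 (sharp_form_one M \<Lambda> \<omega> E p) (vec_to_kvec (E p)) \<alpha>s)"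

definition jacobi_bracket ::
    "('a, 'e::euclidean_space) manifold \<Rightarrow> ('a \<Rightarrow> 'a kvec) \<Rightarrow> ('a \<Rightarrow> 'a tvec) \<Rightarrow> ('a \<Rightarrow> real) \<Rightarrow> ('a \<Rightarrow> real) \<Rightarrow> 'a \<Rightarrow> real" where
  "jacobi_bracket M \<Lambda> E f g p =
     \<Lambda> p [differential M p f, differential M p g] +
     (f p * differential M p g (E p) - g p * differential M p f (E p))"

section \<open>Characteristic leaves\<close>

definition char_distribution ::
    "('a, 'e::euclidean_space) manifold \<Rightarrow> ('a \<Rightarrow> 'a kvec) \<Rightarrow> ('a \<Rightarrow> 'a tvec) \<Rightarrow> 'a \<Rightarrow> 'a tvec set" where
  "char_distribution M \<Lambda> E p = {(\<lambda>f. sharp M \<Lambda> p \<alpha> f + t * E p f) |\<alpha> t. \<alpha> \<in> cotangent M p}"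

definition integral_manifold ::
    "('a, 'e::euclidean_space) manifold \<Rightarrow> ('a \<Rightarrow> 'a kvec) \<Rightarrow> ('a \<Rightarrow> 'a tvec) \<Rightarrow> ('a, 'e) manifold \<Rightarrow> bool" where
  "integral_manifold M \<Lambda> E S \<longleftrightarrow> immersed_submanifold M S \<and>
     pts S \<noteq> {} \<and> connected_space (topo S) \<and>
     (\<forall>p\<in>pts S. tangent_map M id p ` tangent S p = char_distribution M \<Lambda> E p)"

text \<open>A leaf is a maximal connected integral manifold, with its own topology, which may be finer
  than the subspace topology of \<open>M\<close>.\<close>

definition characteristic_leaf ::
    "('a, 'e::euclidean_space) manifold \<Rightarrow> ('a \<Rightarrow> 'a kvec) \<Rightarrow> ('a \<Rightarrow> 'a tvec) \<Rightarrow> ('a, 'e) manifold \<Rightarrow> bool" where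
  "characteristic_leaf M \<Lambda> E S \<longleftrightarrow> integral_manifold M \<Lambda> E S \<and>
     (\<forall>N. integral_manifold M \<Lambda> E N \<longrightarrow> pts S \<subseteq> pts N \<longrightarrow> pts N = pts S)"

text \<open>The leaf through a point exists and is unique (as a set, hence also as an immersed
  submanifold), so the existential quantifier says that \<^emph>\<open>the\<close> leaf through \<open>p\<close> has full dimension.\<close>

definition transitive_jacobi ::
    "('a, 'e::euclidean_space) manifold \<Rightarrow> ('a \<Rightarrow> 'a kvec) \<Rightarrow> ('a \<Rightarrow> 'a tvec) \<Rightarrow> bool" where
  "transitive_jacobi M \<Lambda> E \<longleftrightarrow>
     (\<forall>p\<in>pts M. \<exists>S. characteristic_leaf M \<Lambda> E S \<and> p \<in> pts S \<and> mdim S = mdim M)"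

definition local_extension ::
    "('a, 'e::euclidean_space) manifold \<Rightarrow> ('a, 'e) manifold \<Rightarrow> 'a \<Rightarrow> ('a \<Rightarrow> real) \<Rightarrow> ('a \<Rightarrow> real) \<Rightarrow> bool" where
  "local_extension M S x f' f \<longleftrightarrow> smooth_near M x f \<and>
     (\<exists>W. openin (topo S) W \<and> x \<in> W \<and> (\<forall>y\<in>W. f y = f' y))"

definition leaf_bracket_value ::
    "('a, 'e::euclidean_space) manifold \<Rightarrow> ('a \<Rightarrow> 'a kvec) \<Rightarrow> ('a \<Rightarrow> 'a tvec) \<Rightarrow> ('a, 'e) manifold \<Rightarrow>
     ('a \<Rightarrow> real) \<Rightarrow> ('a \<Rightarrow> real) \<Rightarrow> 'a \<Rightarrow> real \<Rightarrow> bool" where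
  "leaf_bracket_value M \<Lambda> E S f' g' x r \<longleftrightarrow>
     (\<exists>f g. local_extension M S x f' f \<and> local_extension M S x g' g \<and>
        r = jacobi_bracket M \<Lambda> E f g x)"

definition leaf_bracket ::
    "('a, 'e::euclidean_space) manifold \<Rightarrow> ('a \<Rightarrow> 'a kvec) \<Rightarrow> ('a \<Rightarrow> 'a tvec) \<Rightarrow> ('a, 'e) manifold \<Rightarrow>
     ('a \<Rightarrow> real) \<Rightarrow> ('a \<Rightarrow> real) \<Rightarrow> 'a \<Rightarrow> real" where
  "leaf_bracket M \<Lambda> E S f' g' x = (THE r. leaf_bracket_value M \<Lambda> E S f' g' x r)"

end

theory Submission
  imports Defs
begin

text \<open>The leaf \<open>S\<close> is immersed, so by the inverse function theorem every smooth function on \<open>S\<close> extends locally to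
  \<open>M\<close>, and every covector of \<open>S\<close> is the restriction of a covector of \<open>M\<close>.  As \<open>\<Lambda>\<^sup>#\<close> and \<open>E\<close> are tangent to \<open>S\<close>,
  \<open>\<Lambda>\<close> factors through these restrictions; this defines \<open>\<Lambda>\<^sub>S\<close> and \<open>E\<^sub>S\<close>, shows that the bracket of functions on
  \<open>S\<close> does not depend on the extensions, and makes the characteristic distribution of \<open>S\<close> the whole tangent bundle,
  so that \<open>S\<close> is its own leaf.  The form \<open>\<omega>\<^sub>S\<close> is the pullback of \<open>\<omega>\<close>.  To transfer the two structure equations,
  evaluate them on differentials of functions \<open>f, g, h\<close> on \<open>M\<close>: the Schouten brackets become iterated brackets
  \<open>\<Lambda>(d\<Lambda>(df, dg), dh)\<close>, which restrict to \<open>S\<close>, and \<open>d\<omega>\<close> is evaluated by the invariant formula on the fields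
  \<open>\<Lambda>\<^sup>#(df)\<close> and \<open>E\<close>, which are related by the inclusion to the corresponding fields on \<open>S\<close>.\<close>

section \<open>Differential calculus on open subsets of Euclidean spaces\<close>

text \<open>Smoothness is defined by iterated directional derivatives on open subsets of a linear
  subspace, whereas inverting a map needs Frechet derivatives on open subsets of the full space;
  precomposition with a linear projection onto the subspace passes between the two settings. The
  Schouten bracket and the exterior derivative are definite descriptions over all local
  decompositions and over all extensions to vector fields. Each must first be shown to be well
  defined: the former because iterated brackets mention only the multivector fields, the latter
  because the terms differentiating the coefficients of a vector field cancel. Testing on
  differentials suffices since, by Hadamard's lemma, tangent vectors are combinations of coordinate
  derivations, so that every covector is the differential of a germ. All arguments use germs: a leaf
  may accumulate on itself, so a function on it extends to \<open>M\<close> only near each point. In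
  the structure equations the forms are applied only to values of \<open>\<Lambda>\<^sup>#\<close>
  and to \<open>E\<close>, so no other field has to be extended from the leaf.\<close>

text \<open>Only the values of the derivative on fixed vectors are required to be differentiable
  again. In finite dimension this is the usual notion, and it avoids working in spaces of linear
  maps. Derivatives are taken at the full filter \<open>at x\<close>, so \<open>W\<close> is meant
  to be open.\<close>

primrec Ck_on :: "nat \<Rightarrow> 'e::euclidean_space set \<Rightarrow> ('e \<Rightarrow> 'b::real_normed_vector) \<Rightarrow> bool" where
  "Ck_on 0 W f \<longleftrightarrow> continuous_on W f"
| "Ck_on (Suc k) W f \<longleftrightarrow>
     (\<exists>f'. (\<forall>x\<in>W. (f has_derivative f' x) (at x)) \<and> (\<forall>v. Ck_on k W (\<lambda>x. f' x v)))"

declare Ck_on.simps(2) [simp del]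

lemma Ck_on_SucI:
  assumes "\<And>x. x \<in> W \<Longrightarrow> (f has_derivative f' x) (at x)" "\<And>v. Ck_on k W (\<lambda>x. f' x v)"
  shows "Ck_on (Suc k) W f"
  unfolding Ck_on.simps(2) using assms by (intro exI[of _ f'] conjI ballI allI)

lemma Ck_on_SucE:
  assumes "Ck_on (Suc k) W f"
  obtains f' where "\<forall>x\<in>W. (f has_derivative f' x) (at x)" "\<forall>v. Ck_on k W (\<lambda>x. f' x v)"
  using assms unfolding Ck_on.simps(2) by blast

lemma Ck_on_cong_imp:
  assumes "open W" "Ck_on k W f" "\<And>x. x \<in> W \<Longrightarrow> f x = g x"
  shows "Ck_on k W g"
proof (cases k)
  case 0
  then show ?thesis using assms continuous_on_cong by (metis Ck_on.simps(1))
next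
  case (Suc j)
  from assms(2)[unfolded Suc] obtain f' where f': "\<forall>x\<in>W. (f has_derivative f' x) (at x)" "\<forall>v. Ck_on j W (\<lambda>x. f' x v)"
    by (rule Ck_on_SucE)
  have "\<And>x. x \<in> W \<Longrightarrow> (g has_derivative f' x) (at x)"
    using f'(1) assms(1,3) has_derivative_transform_within_open by blast
  then show ?thesis unfolding Suc using f'(2) by (auto intro: Ck_on_SucI)
qed

lemma Ck_on_subset: "Ck_on k W f \<Longrightarrow> W' \<subseteq> W \<Longrightarrow> Ck_on k W' f"
proof (induction k arbitrary: f)
  case 0
  then show ?case using continuous_on_subset by auto
next
  case (Suc k)
  from Suc.prems(1) obtain f' where f': "\<forall>x\<in>W. (f has_derivative f' x) (at x)" "\<forall>v. Ck_on k W (\<lambda>x. f' x v)"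
    by (rule Ck_on_SucE)
  show ?case using Suc f' by (intro Ck_on_SucI[of _ _ f']) auto
qed

lemma Ck_on_imp_continuous_on: "Ck_on k W f \<Longrightarrow> continuous_on W f"
proof (cases k)
  case (Suc j)
  assume "Ck_on k W f"
  then show ?thesis
    using Suc by (auto elim!: Ck_on_SucE intro!: continuous_at_imp_continuous_on dest: has_derivative_continuous)
qed auto

lemma Ck_on_Suc_imp: "Ck_on (Suc k) W f \<Longrightarrow> Ck_on k W f"
proof (induction k arbitrary: f)
  case 0
  show ?case using Ck_on_imp_continuous_on[OF 0] by simp
next
  case (Suc k)
  from Suc.prems obtain f' where "\<forall>x\<in>W. (f has_derivative f' x) (at x)" "\<forall>v. Ck_on (Suc k) W (\<lambda>x. f' x v)"
    by (rule Ck_on_SucE)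
  then show ?case using Suc.IH by (intro Ck_on_SucI[of _ _ f']) auto
qed

lemma Ck_on_const: "Ck_on k W (\<lambda>x. c)"
proof (induction k arbitrary: c)
  case (Suc k)
  show ?case by (rule Ck_on_SucI[of _ _ "\<lambda>_ _. 0"]) (use Suc in auto)
qed simp

lemma Ck_on_add:
  "Ck_on k W f \<Longrightarrow> Ck_on k W g \<Longrightarrow> Ck_on k W (\<lambda>x. f x + g x)"
proof (induction k arbitrary: f g)
  case 0
  then show ?case by (auto intro: continuous_intros)
next
  case (Suc k)
  from Suc.prems(1) obtain f' where "\<forall>x\<in>W. (f has_derivative f' x) (at x)" "\<forall>v. Ck_on k W (\<lambda>x. f' x v)"
    by (rule Ck_on_SucE)
  moreover from Suc.prems(2) obtain g' where "\<forall>x\<in>W. (g has_derivative g' x) (at x)" "\<forall>v. Ck_on k W (\<lambda>x. g' x v)"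
    by (rule Ck_on_SucE)
  ultimately show ?case
    by (intro Ck_on_SucI[of _ _ "\<lambda>x v. f' x v + g' x v"]) (auto intro!: Suc.IH has_derivative_add)
qed

lemma Ck_on_sum:
  "(\<And>i. i \<in> I \<Longrightarrow> Ck_on k W (f i)) \<Longrightarrow> Ck_on k W (\<lambda>x. \<Sum>i\<in>I. f i x)"
  by (induction I rule: infinite_finite_induct) (auto intro!: Ck_on_const Ck_on_add)

lemma Ck_on_bounded_linear:
  assumes L: "bounded_linear L" and "Ck_on k W f"
  shows "Ck_on k W (\<lambda>x. L (f x))"
  using assms(2)
proof (induction k arbitrary: f)
  case 0
  then show ?case by (auto intro: bounded_linear.continuous_on[OF L])
next
  case (Suc k)
  from Suc.prems obtain f' where "\<forall>x\<in>W. (f has_derivative f' x) (at x)" "\<forall>v. Ck_on k W (\<lambda>x. f' x v)"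
    by (rule Ck_on_SucE)
  then show ?case
    by (intro Ck_on_SucI[of _ _ "\<lambda>x v. L (f' x v)"]) (auto intro!: Suc.IH bounded_linear.has_derivative[OF L])
qed

lemma Ck_on_id: "Ck_on k W (\<lambda>x. x)"
proof (cases k)
  case (Suc j)
  show ?thesis unfolding Suc by (rule Ck_on_SucI[of _ _ "\<lambda>_ v. v"]) (use Ck_on_const in auto)
qed auto

lemma Ck_on_linear: "linear L \<Longrightarrow> Ck_on k W (L :: 'e::euclidean_space \<Rightarrow> 'b::real_normed_vector)"
  using Ck_on_bounded_linear[OF _ Ck_on_id] linear_conv_bounded_linear by blast

lemma Ck_on_scaleR:
  "Ck_on k W f \<Longrightarrow> Ck_on k W g \<Longrightarrow> Ck_on k W (\<lambda>x. (f x :: real) *\<^sub>R g x)"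
proof (induction k arbitrary: f g)
  case 0
  then show ?case by (auto intro: continuous_intros)
next
  case (Suc k)
  from Suc.prems(1) obtain f' where "\<forall>x\<in>W. (f has_derivative f' x) (at x)" "\<forall>v. Ck_on k W (\<lambda>x. f' x v)"
    by (rule Ck_on_SucE)
  moreover from Suc.prems(2) obtain g' where "\<forall>x\<in>W. (g has_derivative g' x) (at x)" "\<forall>v. Ck_on k W (\<lambda>x. g' x v)"
    by (rule Ck_on_SucE)
  moreover have "Ck_on k W f" "Ck_on k W g" using Suc.prems Ck_on_Suc_imp by blast+
  ultimately show ?case
    by (intro Ck_on_SucI[of _ _ "\<lambda>x v. f x *\<^sub>R g' x v + f' x v *\<^sub>R g x"])
       (auto intro!: Suc.IH Ck_on_add has_derivative_scaleR)
qed

lemma Ck_on_mult: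
  "Ck_on k W f \<Longrightarrow> Ck_on k W g \<Longrightarrow> Ck_on k W (\<lambda>x. (f x :: real) * g x)"
  using Ck_on_scaleR[of k W f g] by simp

lemma Ck_on_inner: "Ck_on k W f \<Longrightarrow> Ck_on k W (\<lambda>x. f x \<bullet> (b :: 'b::euclidean_space))"
  by (rule Ck_on_bounded_linear[OF bounded_linear_inner_left])

lemma Ck_on_compose:
  fixes f :: "'e::euclidean_space \<Rightarrow> 'd::euclidean_space" and g :: "'d \<Rightarrow> 'b::real_normed_vector"
  assumes "Ck_on k W f" "Ck_on k W' g" "open W'" "f ` W \<subseteq> W'"
  shows "Ck_on k W (\<lambda>x. g (f x))"
  using assms(1,2)
proof (induction k arbitrary: g)
  case 0
  then show ?case using assms(4) by (auto intro: continuous_on_compose2)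
next
  case (Suc k)
  obtain f' where f': "\<forall>x\<in>W. (f has_derivative f' x) (at x)" "\<forall>v. Ck_on k W (\<lambda>x. f' x v)"
    using Suc.prems(1) by (rule Ck_on_SucE)
  obtain g' where g': "\<forall>x\<in>W'. (g has_derivative g' x) (at x)" "\<forall>v. Ck_on k W' (\<lambda>x. g' x v)"
    using Suc.prems(2) by (rule Ck_on_SucE)
  have kf: "Ck_on k W f" using Suc.prems Ck_on_Suc_imp by blast
  \<comment> \<open>The vector \<open>f' x v\<close> depends on \<open>x\<close>. Expanding it in
    the basis leaves only compositions of \<open>f\<close> with \<open>g'\<close> at a fixed vector
    \<open>b\<close>, to which the induction hypothesis applies.\<close>
  have eq: "g' (f x) (f' x v) = (\<Sum>b\<in>Basis. (f' x v \<bullet> b) *\<^sub>R g' (f x) b)" if "x \<in> W" for x v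
  proof -
    have "linear (g' (f x))" using g'(1) assms(4) that has_derivative_linear by blast
    then show ?thesis
      by (subst euclidean_representation[of "f' x v", symmetric])
         (simp add: linear_sum linear_cmul)
  qed
  have d: "((\<lambda>x. g (f x)) has_derivative (\<lambda>v. \<Sum>b\<in>Basis. (f' x v \<bullet> b) *\<^sub>R g' (f x) b)) (at x)" if "x \<in> W" for x
    using has_derivative_compose[OF f'(1)[rule_format, OF that] g'(1)[rule_format, of "f x"]] assms(4) that eq[OF that] by auto
  show ?case
    using d by (intro Ck_on_SucI[of _ _ "\<lambda>x v. \<Sum>b\<in>Basis. (f' x v \<bullet> b) *\<^sub>R g' (f x) b"])
      (auto intro!: Ck_on_sum Ck_on_scaleR Ck_on_inner f'(2)[rule_format] Suc.IH kf g'(2)[rule_format])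
qed

lemma Ck_on_open_cover:
  assumes "\<And>x. x \<in> W \<Longrightarrow> \<exists>W'. open W' \<and> x \<in> W' \<and> Ck_on k W' f"
  shows "Ck_on k W f"
  using assms
proof (induction k arbitrary: f)
  case 0
  then show ?case
    by (metis Ck_on.simps(1) continuous_at_imp_continuous_on continuous_on_eq_continuous_at)
next
  case (Suc k)
  \<comment> \<open>The local witnesses for the derivative have to be glued. By uniqueness of
    derivatives each of them agrees with this canonical choice.\<close>
  define f' where "f' x = frechet_derivative f (at x)" for x
  have *: "\<exists>W'. open W' \<and> x \<in> W' \<and> (\<forall>y\<in>W'. (f has_derivative f' y) (at y)) \<and> (\<forall>v. Ck_on k W' (\<lambda>x. f' x v))"
    if x: "x \<in> W" for x
  proof -
    obtain W' where W': "open W'" "x \<in> W'" "Ck_on (Suc k) W' f" using Suc.prems[OF x] by blast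
    from W'(3) obtain g where g: "\<forall>y\<in>W'. (f has_derivative g y) (at y)" "\<forall>v. Ck_on k W' (\<lambda>x. g x v)"
      by (rule Ck_on_SucE)
    have "g y = f' y" if "y \<in> W'" for y
      using g(1)[rule_format, OF that] frechet_derivative_at unfolding f'_def by (metis)
    then have "Ck_on k W' (\<lambda>x. f' x v)" for v
      by (intro Ck_on_cong_imp[OF W'(1) g(2)[rule_format, of v]]) auto
    then show ?thesis using W' g(1) \<open>\<And>y. y \<in> W' \<Longrightarrow> g y = f' y\<close> by metis
  qed
  show ?case
  proof (rule Ck_on_SucI[of _ _ f'])
    show "Ck_on k W (\<lambda>x. f' x v)" for v
      using * by (intro Suc.IH) blast
  qed (use * in blast)
qed

section \<open>Inverses of a family of linear maps depending on a parameter\<close>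

text \<open>Perturbation argument: if \<open>K\<close> bounds \<open>B x0\<close> and
  \<open>A x\<close> is within \<open>1 / (2 * K)\<close> of \<open>A x0\<close>, then the norm of
  \<open>v\<close> is at most \<open>K\<close> times that of \<open>A x v\<close> plus half the norm
  of \<open>v\<close>. This gives \<open>C = 2 * K\<close>.\<close>

lemma inverse_family_bound:
  fixes A B :: "'e::euclidean_space \<Rightarrow> 'd::euclidean_space \<Rightarrow> 'd"
  assumes W: "open W" "x0 \<in> W" and lin: "\<And>x. x \<in> W \<Longrightarrow> linear (A x)" "\<And>x. x \<in> W \<Longrightarrow> linear (B x)"
    and inv: "\<And>x v. x \<in> W \<Longrightarrow> B x (A x v) = v" "\<And>x v. x \<in> W \<Longrightarrow> A x (B x v) = v"
    and cont: "\<And>v. continuous_on W (\<lambda>x. A x v)"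
  obtains C where "C > 0" "\<forall>\<^sub>F x in at x0. x \<in> W \<and> (\<forall>v. norm (B x v) \<le> C * norm v)"
proof -
  obtain K where K: "K > 0" "\<And>v. norm (B x0 v) \<le> K * norm v"
    using linear_bounded_pos[OF lin(2)[OF W(2)]] by metis
  have "((\<lambda>x. \<Sum>b\<in>Basis. norm (A x b - A x0 b)) \<longlongrightarrow> (\<Sum>b\<in>(Basis::'d set). norm (A x0 b - A x0 b))) (at x0)"
    using cont W by (intro tendsto_intros) (simp add: continuous_on_eq_continuous_at isCont_def)
  then have "\<forall>\<^sub>F x in at x0. (\<Sum>b\<in>Basis. norm (A x b - A x0 b)) < 1 / (2 * K)"
    using K(1) by (intro order_tendstoD(2)) auto
  moreover have "\<forall>\<^sub>F x in at x0. x \<in> W" using W eventually_at_in_open' by blast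
  ultimately have "\<forall>\<^sub>F x in at x0. x \<in> W \<and> (\<forall>v. norm (B x v) \<le> (2 * K) * norm v)"
  proof eventually_elim
    case (elim x)
    have "norm (B x u) \<le> 2 * K * norm u" for u
    proof -
      define v where "v = B x u"
      have u: "u = A x v" using inv elim v_def by auto
      have "A x v - A x0 v = (\<Sum>b\<in>Basis. (v \<bullet> b) *\<^sub>R (A x b - A x0 b))"
        unfolding scaleR_diff_right sum_subtractf
        using linear_sum[OF lin(1)[OF elim(2)], of "\<lambda>b. (v \<bullet> b) *\<^sub>R b" Basis]
          linear_sum[OF lin(1)[OF W(2)], of "\<lambda>b. (v \<bullet> b) *\<^sub>R b" Basis]
        by (simp add: linear_cmul[OF lin(1)[OF elim(2)]] linear_cmul[OF lin(1)[OF W(2)]] euclidean_representation)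
      also have "norm \<dots> \<le> (\<Sum>b\<in>Basis. norm v * norm (A x b - A x0 b))"
        by (intro sum_norm_le) (auto intro!: mult_right_mono simp: Basis_le_norm)
      also have "\<dots> = norm v * (\<Sum>b\<in>Basis. norm (A x b - A x0 b))" by (simp add: sum_distrib_left)
      also have "\<dots> \<le> norm v * (1 / (2 * K))" using elim by (intro mult_left_mono) auto
      finally have "norm (A x v - A x0 v) \<le> norm v * (1 / (2 * K))" .
      moreover have "norm v \<le> K * norm (A x0 v)" using K(2)[of "A x0 v"] inv W by auto
      ultimately have "norm v \<le> K * (norm (A x v) + norm v * (1 / (2 * K)))"
        using K(1) norm_triangle_sub[of "A x0 v" "A x v"] norm_minus_commute[of "A x v" "A x0 v"]
        by (smt (verit) mult_left_mono)
      also have "\<dots> = K * norm (A x v) + norm v / 2" using K(1) by (simp add: field_simps)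
      finally have "norm v \<le> 2 * K * norm (A x v)" by simp
      then show ?thesis by (simp only: u[symmetric] v_def[symmetric])
    qed
    then show ?case using elim by auto
  qed
  then show ?thesis using that[of "2 * K"] K(1) by auto
qed

text \<open>With \<open>w = B x0 v\<close>, the difference \<open>B x v - B x0 v\<close> equals
  \<open>B x (A x0 w - A x w)\<close>. The uniform bound on \<open>B x\<close> reduces its
  convergence to that of \<open>A x w\<close>.\<close>

lemma inverse_family_continuous_on:
  fixes A B :: "'e::euclidean_space \<Rightarrow> 'd::euclidean_space \<Rightarrow> 'd"
  assumes W: "open W" and lin: "\<And>x. x \<in> W \<Longrightarrow> linear (A x)" "\<And>x. x \<in> W \<Longrightarrow> linear (B x)"
    and inv: "\<And>x v. x \<in> W \<Longrightarrow> B x (A x v) = v" "\<And>x v. x \<in> W \<Longrightarrow> A x (B x v) = v"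
    and cont: "\<And>v. continuous_on W (\<lambda>x. A x v)"
  shows "continuous_on W (\<lambda>x. B x v)"
proof (rule continuous_at_imp_continuous_on, rule ballI)
  fix x0 assume x0: "x0 \<in> W"
  obtain C where C: "C > 0" "\<forall>\<^sub>F x in at x0. x \<in> W \<and> (\<forall>v. norm (B x v) \<le> C * norm v)"
    by (rule inverse_family_bound[of W x0 A B, OF W x0 lin inv cont]) blast+
  define w where "w = B x0 v"
  have 1: "\<forall>\<^sub>F x in at x0. norm (B x v - B x0 v) \<le> C * norm (A x0 w - A x w)"
    using C(2)
  proof eventually_elim
    case (elim x)
    have "B x (A x0 w - A x w) = B x v - B x0 v"
      using linear_diff[OF lin(2)] elim inv x0 w_def by auto
    then show ?case using elim by metis
  qed
  have 2: "((\<lambda>x. C * norm (A x0 w - A x w)) \<longlongrightarrow> C * norm (A x0 w - A x0 w)) (at x0)"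
    using cont W x0 by (intro tendsto_intros) (simp add: continuous_on_eq_continuous_at isCont_def)
  have "((\<lambda>x. B x v - B x0 v) \<longlongrightarrow> 0) (at x0)"
    by (rule Lim_null_comparison[OF 1]) (use 2 in simp)
  then show "isCont (\<lambda>x. B x v) x0" using LIM_zero_iff isCont_def by blast
qed

text \<open>At a zero of one factor, continuity of the other is enough for the product rule. This is
  what allows differentiating an inverse family that is so far known only to be continuous.\<close>

lemma has_derivative_scaleR_at_zero:
  fixes h :: "'e::real_normed_vector \<Rightarrow> real"
  assumes h: "(h has_derivative h') (at x)" "h x = 0" and g: "isCont g x"
  shows "((\<lambda>y. h y *\<^sub>R g y) has_derivative (\<lambda>v. h' v *\<^sub>R g x)) (at x)"
proof -
  have bl: "bounded_linear h'" using h(1) by (rule has_derivative_bounded_linear)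
  then obtain K where K: "\<And>v. norm (h' v) \<le> norm v * K" using bounded_linear.bounded by blast
  have 0: "((\<lambda>y. norm (h y - h x - h' (y - x)) / norm (y - x)) \<longlongrightarrow> 0) (at x)"
    using h(1) by (simp add: has_derivative_iff_norm)
  have 1: "((\<lambda>y. norm (h y - h x - h' (y - x)) / norm (y - x) * norm (g y) + \<bar>K\<bar> * norm (g y - g x))
      \<longlongrightarrow> 0 * norm (g x) + \<bar>K\<bar> * norm (g x - g x)) (at x)"
    using g 0 by (intro tendsto_intros) (simp_all add: isCont_def)
  have 2: "\<forall>\<^sub>F y in at x. norm (norm ((h y *\<^sub>R g y - h x *\<^sub>R g x) - h' (y - x) *\<^sub>R g x) / norm (y - x))
      \<le> norm (h y - h x - h' (y - x)) / norm (y - x) * norm (g y) + \<bar>K\<bar> * norm (g y - g x)"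
  proof (rule eventually_mono[OF eventually_at_in_open'[OF open_UNIV UNIV_I]])
    fix y
    have "(h y *\<^sub>R g y - h x *\<^sub>R g x) - h' (y - x) *\<^sub>R g x =
        (h y - h x - h' (y - x)) *\<^sub>R g y + h' (y - x) *\<^sub>R (g y - g x)"
      using h(2) by (simp add: algebra_simps)
    then have "norm ((h y *\<^sub>R g y - h x *\<^sub>R g x) - h' (y - x) *\<^sub>R g x) \<le>
        norm (h y - h x - h' (y - x)) * norm (g y) + norm (h' (y - x)) * norm (g y - g x)"
      by (metis norm_triangle_ineq norm_scaleR real_norm_def)
    also have "\<dots> \<le> norm (h y - h x - h' (y - x)) * norm (g y) + (\<bar>K\<bar> * norm (y - x)) * norm (g y - g x)"
      using K[of "y - x"] abs_ge_self[of K] mult_left_mono[of K "\<bar>K\<bar>" "norm (y - x)"]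
      by (intro add_left_mono mult_right_mono) (auto simp: mult.commute)
    finally have *: "norm ((h y *\<^sub>R g y - h x *\<^sub>R g x) - h' (y - x) *\<^sub>R g x) \<le>
      norm (h y - h x - h' (y - x)) * norm (g y) + (\<bar>K\<bar> * norm (y - x)) * norm (g y - g x)" .
    show "norm (norm ((h y *\<^sub>R g y - h x *\<^sub>R g x) - h' (y - x) *\<^sub>R g x) / norm (y - x))
      \<le> norm (h y - h x - h' (y - x)) / norm (y - x) * norm (g y) + \<bar>K\<bar> * norm (g y - g x)"
    proof (cases "y = x")
      case False
      then show ?thesis using * by (simp add: divide_simps) (simp add: algebra_simps)
    qed auto
  qed
  have "((\<lambda>y. norm ((h y *\<^sub>R g y - h x *\<^sub>R g x) - h' (y - x) *\<^sub>R g x) / norm (y - x)) \<longlongrightarrow> 0) (at x)"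
    by (rule Lim_null_comparison[OF 2]) (use 1 in simp)
  then show ?thesis
    using bounded_linear_compose[OF bounded_linear_scaleR_left bl]
    by (simp add: has_derivative_iff_norm o_def)
qed

text \<open>The derivative of \<open>x \<mapsto> A(x)\<inverse> v\<close> in direction \<open>w\<close> is \<open>- A(x)\<inverse> (\<partial>\<^sub>w A)(x) A(x)\<inverse> v\<close>, which
  lowers the order of differentiability by one.\<close>

lemma Ck_on_inverse_family:
  fixes A B :: "'e::euclidean_space \<Rightarrow> 'd::euclidean_space \<Rightarrow> 'd"
  assumes W: "open W" and lin: "\<And>x. x \<in> W \<Longrightarrow> linear (A x)" "\<And>x. x \<in> W \<Longrightarrow> linear (B x)"
    and inv: "\<And>x v. x \<in> W \<Longrightarrow> B x (A x v) = v" "\<And>x v. x \<in> W \<Longrightarrow> A x (B x v) = v"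
    and A: "\<And>v. Ck_on k W (\<lambda>x. A x v)"
  shows "Ck_on k W (\<lambda>x. B x v)"
  using A
proof (induction k arbitrary: v)
  case 0
  then show ?case using inverse_family_continuous_on[OF W lin inv] by simp
next
  case (Suc k)
  have "\<forall>v. \<exists>A'. (\<forall>x\<in>W. ((\<lambda>x. A x v) has_derivative A' x) (at x)) \<and> (\<forall>w. Ck_on k W (\<lambda>x. A' x w))"
    using Suc.prems by (simp add: Ck_on.simps(2))
  then obtain A' where A': "\<And>v x. x \<in> W \<Longrightarrow> ((\<lambda>x. A x v) has_derivative A' v x) (at x)"
      "\<And>v w. Ck_on k W (\<lambda>x. A' v x w)"
    by metis
  have IH: "Ck_on k W (\<lambda>x. B x v)" for v
    using Suc.IH Suc.prems Ck_on_Suc_imp by blast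
  \<comment> \<open>The formula for the derivative, written in coordinates twice: once for the
    argument of the derivative of \<open>A\<close>, once for the argument of the outer
    \<open>B x\<close>.\<close>
  define D where "D x w = (\<Sum>c\<in>Basis. ((\<Sum>b\<in>Basis. (B x v \<bullet> b) *\<^sub>R (- A' b x w)) \<bullet> c) *\<^sub>R B x c)" for x w
  have sumrep: "L u = (\<Sum>b\<in>Basis. (u \<bullet> b) *\<^sub>R L b)" if "linear L" for L :: "'d \<Rightarrow> 'd" and u
    by (subst euclidean_representation[of u, symmetric]) (simp add: linear_sum[OF that] linear_cmul[OF that])
  show ?case
  proof (rule Ck_on_SucI[where f' = D])
    show "Ck_on k W (\<lambda>x. D x w)" for w
      unfolding D_def scaleR_minus_right
      by (intro Ck_on_sum Ck_on_scaleR Ck_on_inner IH A' Ck_on_bounded_linear[OF bounded_linear_minus[OF bounded_linear_ident]])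
    fix x0 assume x0: "x0 \<in> W"
    define u where "u = B x0 v"
    \<comment> \<open>Since \<open>B x v = u + B x (g x)\<close> and \<open>g\<close> vanishes at
      \<open>x0\<close>, each coordinate of \<open>g\<close> times \<open>B x c\<close> can be
      differentiated at \<open>x0\<close> with \<open>B\<close> merely continuous there.\<close>
    define g where "g x = (\<Sum>b\<in>Basis. (u \<bullet> b) *\<^sub>R (A x0 b - A x b))" for x
    have g: "g x = A x0 u - A x u" if "x \<in> W" for x
      unfolding g_def scaleR_diff_right sum_subtractf
      using sumrep[OF lin(1)[OF x0], of u] sumrep[OF lin(1)[OF that], of u] by simp
    have gd: "(g has_derivative (\<lambda>w. \<Sum>b\<in>Basis. (u \<bullet> b) *\<^sub>R (- A' b x0 w))) (at x0)"
      unfolding g_def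
      by (intro has_derivative_sum has_derivative_scaleR_right)
         (auto intro!: derivative_eq_intros A' x0)
    have "((\<lambda>x. \<Sum>c\<in>Basis. (g x \<bullet> c) *\<^sub>R B x c) has_derivative D x0) (at x0)"
      unfolding D_def u_def[symmetric]
    proof (intro has_derivative_sum has_derivative_scaleR_at_zero has_derivative_inner_left gd)
      show "g x0 \<bullet> c = 0" for c by (simp add: g_def)
      show "isCont (\<lambda>x. B x c) x0" for c
        using Ck_on_imp_continuous_on[OF IH[of c]] W x0 by (simp add: continuous_on_eq_continuous_at)
    qed
    then have "((\<lambda>x. u + (\<Sum>c\<in>Basis. (g x \<bullet> c) *\<^sub>R B x c)) has_derivative D x0) (at x0)"
      using has_derivative_add[OF has_derivative_const[of u]] by fastforce
    moreover have "u + (\<Sum>c\<in>Basis. (g x \<bullet> c) *\<^sub>R B x c) = B x v" if x: "x \<in> W" for x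
    proof -
      have "(\<Sum>c\<in>Basis. (g x \<bullet> c) *\<^sub>R B x c) = B x (g x)"
        by (rule sumrep[OF lin(2)[OF x], symmetric])
      also have "\<dots> = B x v - u"
        using g[OF x] linear_diff[OF lin(2)[OF x]] inv x x0 u_def by simp
      finally show ?thesis by simp
    qed
    ultimately show "((\<lambda>x. B x v) has_derivative D x0) (at x0)"
      by (rule has_derivative_transform_within_open[OF _ W x0])
  qed
qed

section \<open>The smooth inverse function theorem\<close>

abbreviation Cinf_on :: "'e::euclidean_space set \<Rightarrow> ('e \<Rightarrow> 'b::real_normed_vector) \<Rightarrow> bool" where
  "Cinf_on W f \<equiv> \<forall>k. Ck_on k W f"

text \<open>The witness of the derivative in \<open>Ck_on\<close> may change with \<open>k\<close>.
  Uniqueness identifies all of them with \<open>frechet_derivative\<close>, which therefore serves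
  every \<open>k\<close> at once.\<close>

lemma Cinf_on_derivative:
  assumes "open W" "Cinf_on W f"
  shows "x \<in> W \<Longrightarrow> (f has_derivative frechet_derivative f (at x)) (at x)"
    and "Cinf_on W (\<lambda>x. frechet_derivative f (at x) v)"
proof -
  show 1: "(f has_derivative frechet_derivative f (at x)) (at x)" if "x \<in> W" for x
    using assms(2)[rule_format, of "Suc 0"] that
    by (metis Ck_on.simps(2) differentiableI frechet_derivative_works)
  show "Cinf_on W (\<lambda>x. frechet_derivative f (at x) v)"
  proof
    fix k
    obtain f' where f': "\<forall>x\<in>W. (f has_derivative f' x) (at x)" "\<forall>v. Ck_on k W (\<lambda>x. f' x v)"
      using assms(2)[rule_format, of "Suc k"] by (rule Ck_on_SucE)
    have eq: "f' x v = frechet_derivative f (at x) v" if "x \<in> W" for x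
      using f'(1) 1 that has_derivative_unique by metis
    show "Ck_on k W (\<lambda>x. frechet_derivative f (at x) v)"
      by (rule Ck_on_cong_imp[OF assms(1) f'(2)[rule_format, of v]]) (rule eq)
  qed
qed

text \<open>The inverse function theorem yields a local inverse \<open>g\<close> whose derivative at
  \<open>y\<close> is the inverse of \<open>f' (g y)\<close>. Matrix inversion is smooth, so if
  \<open>g\<close> is of class \<open>k\<close>, then so is its derivative, and \<open>g\<close> is
  of class \<open>Suc k\<close>; the induction starts from continuity.\<close>

theorem smooth_inverse_function:
  fixes f :: "'e::euclidean_space \<Rightarrow> 'e"
  assumes U: "open U" "x0 \<in> U" and f: "Cinf_on U f"
    and L: "linear L" "\<And>v. L (frechet_derivative f (at x0) v) = v"
  obtains U' V g where "open U'" "U' \<subseteq> U" "x0 \<in> U'" "open V" "f x0 \<in> V" "homeomorphism U' V f g" "Cinf_on V g"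
proof -
  define f' where "f' x = frechet_derivative f (at x)" for x
  have d: "(f has_derivative f' x) (at x)" if "x \<in> U" for x
    using Cinf_on_derivative(1)[OF U(1) f that] by (simp add: f'_def)
  have bl: "bounded_linear (f' x)" if "x \<in> U" for x
    using d[OF that] by (rule has_derivative_bounded_linear)
  have Cf': "Cinf_on U (\<lambda>x. f' x v)" for v
    using Cinf_on_derivative(2)[OF U(1) f] by (simp add: f'_def)
  have app: "blinfun_apply (Blinfun (f' x)) = f' x" if "x \<in> U" for x
    using bl[OF that] by (rule bounded_linear_Blinfun_apply)
  have d': "(f has_derivative blinfun_apply (Blinfun (f' x))) (at x)" if "x \<in> U" for x
    using d that app by simp
  \<comment> \<open>The inverse function theorem asks for a continuous map into the bounded linear
    functions; in finite dimension continuity may be checked on each basis vector.\<close>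
  have cont: "continuous_on U (\<lambda>x. Blinfun (f' x))"
  proof (rule continuous_on_blinfun_componentwise)
    fix i :: 'e
    have "continuous_on U (\<lambda>x. f' x i)" using Cf'[of i] Ck_on_imp_continuous_on by blast
    then show "continuous_on U (\<lambda>x. blinfun_apply (Blinfun (f' x)) i)"
      by (rule continuous_on_eq) (simp add: app)
  qed
  have "blinfun_apply (Blinfun L o\<^sub>L Blinfun (f' x0)) v = blinfun_apply id_blinfun v" for v
    using L(2) app[OF U(2)] bounded_linear_Blinfun_apply[of L] L(1)
    by (simp add: f'_def linear_conv_bounded_linear)
  then have inv: "Blinfun L o\<^sub>L Blinfun (f' x0) = id_blinfun" by (rule blinfun_eqI)
  obtain U' V g g' where g: "open U'" "U' \<subseteq> U" "x0 \<in> U'" "open V" "f x0 \<in> V" "homeomorphism U' V f g"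
    and dg: "\<And>y. y \<in> V \<Longrightarrow> (g has_derivative (g' y)) (at y)"
    "\<And>y. y \<in> V \<Longrightarrow> g' y = Hilbert_Choice.inv (blinfun_apply (Blinfun (f' (g y))))"
    "\<And>y. y \<in> V \<Longrightarrow> bij (blinfun_apply (Blinfun (f' (g y))))"
    using inverse_function_theorem[OF U(1) d' cont U(2) inv] by metis
  have gV: "g y \<in> U'" "f (g y) = y" if "y \<in> V" for y
    using g(6) that by (auto simp: homeomorphism_def)
  have fU: "f x \<in> V" "g (f x) = x" if "x \<in> U'" for x
    using g(6) that by (auto simp: homeomorphism_def)
  define B where "B x = Hilbert_Choice.inv (f' x)" for x
  have bij: "bij (f' x)" if "x \<in> U'" for x
    using dg(3)[of "f x"] fU[OF that] app[of x] that g(2) by auto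
  have g'B: "g' y = B (g y)" if "y \<in> V" for y
    using dg(2)[OF that] app[of "g y"] gV(1)[OF that] g(2) by (auto simp: B_def)
  have B: "Ck_on k U' (\<lambda>x. B x v)" for k v
  proof (rule Ck_on_inverse_family[where A = f'])
    show "linear (f' x)" if "x \<in> U'" for x
      using bl that g(2) bounded_linear.linear by blast
    show "linear (B x)" if "x \<in> U'" for x
      using has_derivative_linear[OF dg(1)[of "f x"]] g'B[of "f x"] fU[OF that] by simp
    show "B x (f' x v) = v" "f' x (B x v) = v" if "x \<in> U'" for x v
      using bij[OF that] unfolding B_def by (simp_all add: bij_is_inj bij_is_surj surj_f_inv_f)
    show "Ck_on k U' (\<lambda>x. f' x v)" for v
      using Cf' Ck_on_subset[OF _ g(2)] by blast
  qed (rule g(1))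
  have "Ck_on k V g" for k
  proof (induction k)
    case 0
    then show ?case using g(6) by (simp add: homeomorphism_def)
  next
    case (Suc k)
    show ?case
    proof (rule Ck_on_SucI[where f' = g'])
      show "Ck_on k V (\<lambda>y. g' y v)" for v
      proof (rule Ck_on_cong_imp[OF g(4)])
        show "Ck_on k V (\<lambda>y. B (g y) v)"
          by (rule Ck_on_compose[OF Suc B g(1)]) (use gV in auto)
      qed (simp add: g'B)
    qed (rule dg(1))
  qed
  then show ?thesis using that g by blast
qed

section \<open>Iterated directional derivatives versus Frechet derivatives\<close>

lemma has_derivative_partialsI:
  fixes f :: "'e::euclidean_space \<Rightarrow> 'b::real_normed_vector"
  assumes W: "open W" "x \<in> W"
    and D: "\<And>b y. b \<in> Basis \<Longrightarrow> y \<in> W \<Longrightarrow> ((\<lambda>t. f (y + t *\<^sub>R b)) has_vector_derivative D b y) (at 0)"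
    and cont: "\<And>b. b \<in> Basis \<Longrightarrow> continuous_on W (D b)"
  shows "(f has_derivative (\<lambda>h. \<Sum>b\<in>Basis. (h \<bullet> b) *\<^sub>R D b x)) (at x)"
proof -
  \<comment> \<open>Increments are built up one coordinate at a time: the claim concerns those
    supported in \<open>B\<close>, and every new coordinate contributes at most
    \<open>e * norm h\<close> to the error.\<close>
  have *: "\<exists>d>0. \<forall>h. norm h < d \<longrightarrow> (\<forall>b\<in>Basis - B. h \<bullet> b = 0) \<longrightarrow>
      norm (f (x + h) - f x - (\<Sum>b\<in>B. (h \<bullet> b) *\<^sub>R D b x)) \<le> card B * e * norm h"
    if "B \<subseteq> Basis" "e > 0" for B and e :: real
    using finite_subset[OF that(1) finite_Basis] that
  proof (induction B rule: finite_induct)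
    case empty
    show ?case
    proof (intro exI[of _ 1] conjI allI impI)
      fix h :: 'e assume "\<forall>b\<in>Basis - {}. h \<bullet> b = 0"
      then have "h = 0" by (simp only: Diff_empty euclidean_all_zero_iff)
      then show "norm (f (x + h) - f x - (\<Sum>b\<in>{}. (h \<bullet> b) *\<^sub>R D b x)) \<le> card {} * e * norm h" by simp
    qed simp
  next
    case (insert b B)
    have b: "b \<in> Basis" using insert by auto
    obtain d1 where d1: "d1 > 0" "\<And>h. norm h < d1 \<Longrightarrow> (\<forall>b\<in>Basis - B. h \<bullet> b = 0) \<Longrightarrow>
      norm (f (x + h) - f x - (\<Sum>b\<in>B. (h \<bullet> b) *\<^sub>R D b x)) \<le> card B * e * norm h"
      using insert by auto
    obtain d0 where d0: "d0 > 0" "ball x d0 \<subseteq> W" using W open_contains_ball by blast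
    have "isCont (D b) x" using cont[OF b] W by (simp add: continuous_on_eq_continuous_at)
    then have "\<forall>\<^sub>F y in at x. dist (D b y) (D b x) < e"
      unfolding isCont_def using that(2) by (rule tendstoD)
    then obtain d2 where d2: "d2 > 0" "\<And>y. y \<noteq> x \<Longrightarrow> dist y x < d2 \<Longrightarrow> dist (D b y) (D b x) < e"
      unfolding eventually_at by auto
    show ?case
    proof (intro exI[of _ "min d1 (min d0 d2)"] conjI allI impI)
      fix h assume h: "norm h < min d1 (min d0 d2)" "\<forall>c\<in>Basis - insert b B. h \<bullet> c = 0"
      define h' where "h' = h - (h \<bullet> b) *\<^sub>R b"
      have hb: "h' \<bullet> c = (if c = b then 0 else h \<bullet> c)" if "c \<in> Basis" for c
        using b that by (simp add: h'_def inner_diff_left inner_Basis)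
      have nh': "norm h' \<le> norm h" by (rule norm_le_componentwise) (auto simp: hb)
      have seg: "norm (h' + t *\<^sub>R b) \<le> norm h" if t: "t \<in> closed_segment 0 (h \<bullet> b)" for t
      proof -
        have "\<bar>t\<bar> \<le> \<bar>h \<bullet> b\<bar>" using t by (auto simp: closed_segment_eq_real_ivl split: if_splits)
        then show ?thesis
          using b by (intro norm_le_componentwise) (auto simp: hb inner_add_left inner_Basis)
      qed
      have ih: "norm (f (x + h') - f x - (\<Sum>c\<in>B. (h' \<bullet> c) *\<^sub>R D c x)) \<le> card B * e * norm h'"
        using h nh' hb by (intro d1(2)) auto
      have sum: "(\<Sum>c\<in>B. (h' \<bullet> c) *\<^sub>R D c x) = (\<Sum>c\<in>B. (h \<bullet> c) *\<^sub>R D c x)"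
        using insert by (intro sum.cong) (auto simp: hb)
      \<comment> \<open>This is \<open>f\<close> along the newly added coordinate, corrected by its
        linear part at \<open>x\<close>. Its derivative is a difference of two values of
        \<open>D b\<close>, small by continuity, so the mean value inequality bounds its
        increment.\<close>
      define \<phi> where "\<phi> t = f (x + h' + t *\<^sub>R b) - t *\<^sub>R D b x" for t
      have "norm (\<phi> (h \<bullet> b) - \<phi> 0) \<le> e * norm (h \<bullet> b - 0)"
      proof (rule differentiable_bound[where S = "closed_segment 0 (h \<bullet> b)" and f = \<phi>
              and f' = "\<lambda>t s. s *\<^sub>R (D b (x + h' + t *\<^sub>R b) - D b x)"])
        fix t assume t: "t \<in> closed_segment 0 (h \<bullet> b)"
        define y where "y = x + h' + t *\<^sub>R b"
        have "dist y x \<le> norm h" using seg[OF t] by (simp add: y_def dist_norm add.assoc)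
        then have y: "y \<in> W" "dist y x < d2" using h d0(2) by (auto simp: dist_commute)
        have "((\<lambda>s. f (y + s *\<^sub>R b)) has_derivative (\<lambda>s. s *\<^sub>R D b y)) (at (t - t))"
          using D[OF b y(1)] by (simp add: has_vector_derivative_def)
        then have "((\<lambda>s. f (y + (s - t) *\<^sub>R b)) has_derivative (\<lambda>s. s *\<^sub>R D b y)) (at t)"
          by (rule has_derivative_compose[of "\<lambda>s. s - t" "\<lambda>s. s" t UNIV, rotated])
             (auto intro!: derivative_eq_intros)
        then have "((\<lambda>s. f (x + h' + s *\<^sub>R b)) has_derivative (\<lambda>s. s *\<^sub>R D b y)) (at t)"
          by (simp add: y_def algebra_simps)
        then have "(\<phi> has_derivative (\<lambda>s. s *\<^sub>R (D b y - D b x))) (at t)"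
          unfolding \<phi>_def scaleR_diff_right by (intro has_derivative_diff has_derivative_scaleR_left has_derivative_ident)
        then show "(\<phi> has_derivative (\<lambda>s. s *\<^sub>R (D b (x + h' + t *\<^sub>R b) - D b x))) (at t within closed_segment 0 (h \<bullet> b))"
          unfolding y_def by (rule has_derivative_at_withinI)
        have "norm (D b y - D b x) \<le> e" using d2(2)[OF _ y(2)] that(2) by (cases "y = x") (auto simp: dist_norm)
        then show "onorm (\<lambda>s. s *\<^sub>R (D b (x + h' + t *\<^sub>R b) - D b x)) \<le> e"
          using insert.prems unfolding y_def[symmetric]
          by (intro onorm_bound) (auto simp: mult.commute[of e] intro!: mult_left_mono)
      qed (auto)
      moreover have "\<phi> (h \<bullet> b) - \<phi> 0 = f (x + h) - f (x + h') - (h \<bullet> b) *\<^sub>R D b x"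
        by (simp add: \<phi>_def h'_def)
      moreover have "e * \<bar>h \<bullet> b\<bar> \<le> e * norm h"
        using insert.prems Basis_le_norm[OF b, of h] by (intro mult_left_mono) auto
      ultimately have 2: "norm (f (x + h) - f (x + h') - (h \<bullet> b) *\<^sub>R D b x) \<le> e * norm h"
        by (simp add: mult.commute)
      have "f (x + h) - f x - (\<Sum>c\<in>insert b B. (h \<bullet> c) *\<^sub>R D c x) =
         (f (x + h') - f x - (\<Sum>c\<in>B. (h' \<bullet> c) *\<^sub>R D c x)) + (f (x + h) - f (x + h') - (h \<bullet> b) *\<^sub>R D b x)"
        using insert by (simp add: sum algebra_simps)
      also have "norm \<dots> \<le> card B * e * norm h' + e * norm h"
        using norm_triangle_mono[OF ih 2] .
      also have "\<dots> \<le> card B * e * norm h + e * norm h"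
        using nh' insert.prems by (intro add_right_mono mult_left_mono) auto
      also have "\<dots> = card (insert b B) * e * norm h" using insert by (simp add: algebra_simps)
      finally show "norm (f (x + h) - f x - (\<Sum>c\<in>insert b B. (h \<bullet> c) *\<^sub>R D c x))
        \<le> card (insert b B) * e * norm h" .
    qed (use d0 d1 d2 in auto)
  qed
  show ?thesis
    unfolding has_derivative_within_alt
  proof (intro conjI allI impI)
    show "bounded_linear (\<lambda>h. \<Sum>b\<in>Basis. (h \<bullet> b) *\<^sub>R D b x)"
      by (intro bounded_linear_sum bounded_linear_scaleR_const bounded_linear_inner_left)
    fix e :: real assume e: "e > 0"
    \<comment> \<open>For \<open>B = Basis\<close> the accumulated error carries the factor
      \<open>DIM('e)\<close>, which this choice compensates.\<close>
    have "e / DIM('e) > 0" using e by simp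
    from *[OF subset_refl this] obtain d where d: "d > 0" "\<And>h. norm h < d \<Longrightarrow>
      norm (f (x + h) - f x - (\<Sum>b\<in>Basis. (h \<bullet> b) *\<^sub>R D b x)) \<le> DIM('e) * (e / DIM('e)) * norm h" by auto
    show "\<exists>d>0. \<forall>y\<in>UNIV. norm (y - x) < d \<longrightarrow>
        norm (f y - f x - (\<Sum>b\<in>Basis. ((y - x) \<bullet> b) *\<^sub>R D b x)) \<le> e * norm (y - x)"
      using d(1) d(2)[of "y - x" for y] by (intro exI[of _ d]) auto
  qed
qed

lemma iter_dderiv_append: "iter_dderiv (vs @ us) f = iter_dderiv vs (iter_dderiv us f)"
  by (induction vs) auto

lemma smooth_in_iter_dderiv: "smooth_in V W f \<Longrightarrow> set us \<subseteq> V \<Longrightarrow> smooth_in V W (iter_dderiv us f)"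
  unfolding smooth_in_def iter_dderiv_append[symmetric] by simp

text \<open>The definition of \<open>smooth_in\<close> makes all directional derivatives continuous.
  Those along the basis give a Frechet derivative, whose value on any vector is a combination of
  functions that are smooth in the same sense.\<close>

lemma smooth_in_UNIV_imp_Ck_on: "smooth_in UNIV W f \<Longrightarrow> Ck_on k W f"
proof (induction k arbitrary: f)
  case 0
  then have "continuous_on W (iter_dderiv [] f)" unfolding smooth_in_def by blast
  then show ?case by simp
next
  case (Suc k)
  have W: "open W" using Suc.prems by (simp add: smooth_in_def)
  have s: "smooth_in UNIV W (iter_dderiv [b] f)" for b
    using smooth_in_iter_dderiv[OF Suc.prems, of "[b]"] by simp
  have c: "continuous_on W (iter_dderiv [b] f)" for b
    using Suc.prems unfolding smooth_in_def by (metis subset_UNIV)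
  have d: "((\<lambda>t. f (y + t *\<^sub>R b)) has_vector_derivative iter_dderiv [b] f y) (at 0)" if "y \<in> W" for y b
  proof -
    have "(\<lambda>t. iter_dderiv [] f (y + t *\<^sub>R b)) differentiable (at 0)"
      using Suc.prems that unfolding smooth_in_def by (metis UNIV_I subset_UNIV)
    then show ?thesis by (simp add: vector_derivative_works)
  qed
  show ?case
  proof (rule Ck_on_SucI)
    show "(f has_derivative (\<lambda>h. \<Sum>b\<in>Basis. (h \<bullet> b) *\<^sub>R iter_dderiv [b] f x)) (at x)" if "x \<in> W" for x
      by (rule has_derivative_partialsI[OF W that]) (use c d in auto)
    show "Ck_on k W (\<lambda>x. \<Sum>b\<in>Basis. (v \<bullet> b) *\<^sub>R iter_dderiv [b] f x)" for v
      by (intro Ck_on_sum Ck_on_scaleR Ck_on_const Suc.IH s)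
  qed
qed

lemma Cinf_on_dderiv:
  assumes "open W" "Cinf_on W f" "x \<in> W"
  shows "((\<lambda>t. f (x + t *\<^sub>R v)) has_vector_derivative frechet_derivative f (at x) v) (at 0)"
proof -
  have 1: "(f has_derivative frechet_derivative f (at x)) (at (x + 0 *\<^sub>R v))"
    using Cinf_on_derivative(1)[OF assms] by simp
  have 2: "((\<lambda>t. x + t *\<^sub>R v) has_derivative (\<lambda>t. t *\<^sub>R v)) (at 0)"
    by (auto intro!: derivative_eq_intros)
  have "((\<lambda>t. f (x + t *\<^sub>R v)) has_derivative (\<lambda>t. frechet_derivative f (at x) (t *\<^sub>R v))) (at 0)"
    using has_derivative_compose[OF 2 1] by simp
  moreover have "linear (frechet_derivative f (at x))"
    using Cinf_on_derivative(1)[OF assms] has_derivative_linear by blast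
  ultimately show ?thesis
    by (simp add: has_vector_derivative_def linear_cmul)
qed

lemma iter_dderiv_Cinf_on:
  assumes "open W" "Cinf_on W f"
  shows "Cinf_on W (iter_dderiv vs f)"
proof (induction vs)
  case Nil
  then show ?case using assms by simp
next
  case (Cons v vs)
  define g where "g = iter_dderiv vs f"
  have g: "frechet_derivative g (at x) v = iter_dderiv (v # vs) f x" if "x \<in> W" for x
  proof -
    have "((\<lambda>t. g (x + t *\<^sub>R v)) has_vector_derivative frechet_derivative g (at x) v) (at 0)"
      using Cinf_on_dderiv[OF assms(1) _ that] Cons by (simp add: g_def)
    then show ?thesis by (simp add: g_def vector_derivative_at)
  qed
  have "Ck_on k W (iter_dderiv (v # vs) f)" for k
  proof (rule Ck_on_cong_imp[OF assms(1)])
    show "Ck_on k W (\<lambda>x. frechet_derivative g (at x) v)"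
      using Cinf_on_derivative(2)[OF assms(1), of g] Cons unfolding g_def by blast
  qed (rule g)
  then show ?case by blast
qed

lemma smooth_in_UNIV_iff: "smooth_in UNIV W f \<longleftrightarrow> open W \<and> Cinf_on W f"
proof
  assume "open W \<and> Cinf_on W f"
  then have W: "open W" and i: "\<And>vs. Cinf_on W (iter_dderiv vs f)"
    using iter_dderiv_Cinf_on by blast+
  show "smooth_in UNIV W f"
    unfolding smooth_in_def
  proof (intro conjI allI impI ballI)
    show "openin (top_of_set UNIV) W" using W by simp
    show "continuous_on W (iter_dderiv vs f)" for vs
      using Ck_on_imp_continuous_on i by blast
    show "(\<lambda>t. iter_dderiv vs f (x + t *\<^sub>R v)) differentiable at 0" if "x \<in> W" for vs x v
      using Cinf_on_dderiv[OF W i that] by (rule differentiableI_vector)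
  qed
next
  assume "smooth_in UNIV W f"
  then show "open W \<and> Cinf_on W f"
    using smooth_in_UNIV_imp_Ck_on by (auto simp: smooth_in_def)
qed

section \<open>Smooth maps on open subsets of a subspace\<close>

text \<open>Some linear projection onto \<open>V\<close>. Composing with it turns a function on an
  open subset of \<open>V\<close> into one on an open subset of the whole space, where the calculus
  above applies.\<close>

definition subspace_proj :: "'e::euclidean_space set \<Rightarrow> 'e \<Rightarrow> 'e" where
  "subspace_proj V = (SOME P. linear P \<and> range P \<subseteq> V \<and> (\<forall>x\<in>V. P x = x))"

lemma subspace_proj:
  assumes "subspace V"
  shows "linear (subspace_proj V)" "subspace_proj V x \<in> V" "x \<in> V \<Longrightarrow> subspace_proj V x = x"
proof -
  have "\<exists>P. range P \<subseteq> V \<and> linear P \<and> (\<forall>x\<in>V. P (id x) = x)"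
    by (rule linear_exists_left_inverse_on) (use assms in \<open>auto simp: linear_id id_def[symmetric]\<close>)
  then have "\<exists>P. linear P \<and> range P \<subseteq> V \<and> (\<forall>x\<in>V. P x = x)" by auto
  then have *: "linear (subspace_proj V) \<and> range (subspace_proj V) \<subseteq> V \<and> (\<forall>x\<in>V. subspace_proj V x = x)"
    unfolding subspace_proj_def by (rule someI_ex)
  show "linear (subspace_proj V)" "subspace_proj V x \<in> V" "x \<in> V \<Longrightarrow> subspace_proj V x = x"
    using * by auto
qed

lemma open_vimage_subspace_proj:
  assumes "subspace V" "openin (top_of_set V) W"
  shows "open (subspace_proj V -` W)"
proof -
  obtain T where T: "open T" "W = V \<inter> T" using assms(2) by (auto simp: openin_open)
  have "subspace_proj V -` W = subspace_proj V -` T" using T subspace_proj(2)[OF assms(1)] by auto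
  moreover have "continuous_on UNIV (subspace_proj V)"
    using subspace_proj(1)[OF assms(1)] linear_continuous_on linear_conv_bounded_linear by blast
  ultimately show ?thesis using open_vimage[OF T(1)] by simp
qed

lemma iter_dderiv_compose_subspace_proj:
  assumes "subspace V"
  shows "iter_dderiv vs (f \<circ> subspace_proj V) x = iter_dderiv (map (subspace_proj V) vs) f (subspace_proj V x)"
proof (induction vs arbitrary: x)
  case (Cons v vs)
  have "subspace_proj V (x + t *\<^sub>R v) = subspace_proj V x + t *\<^sub>R subspace_proj V v" for t
    using subspace_proj(1)[OF assms] by (simp add: linear_add linear_cmul)
  then show ?case using Cons by simp
qed simp

lemma map_subspace_proj: "subspace V \<Longrightarrow> set vs \<subseteq> V \<Longrightarrow> map (subspace_proj V) vs = vs"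
  by (induction vs) (auto simp: subspace_proj)

text \<open>Differentiating \<open>f \<circ> subspace_proj V\<close> along \<open>vs\<close> amounts
  to differentiating \<open>f\<close> along the projected vectors, at the projected point. For
  points and directions in \<open>V\<close> nothing changes, so smoothness can be carried in both
  directions.\<close>

lemma smooth_in_iff_Cinf_on:
  assumes V: "subspace V"
  shows "smooth_in V W f \<longleftrightarrow> openin (top_of_set V) W \<and> Cinf_on (subspace_proj V -` W) (f \<circ> subspace_proj V)"
proof (cases "openin (top_of_set V) W")
  case True
  note P = subspace_proj[OF V] and it = iter_dderiv_compose_subspace_proj[OF V]
  have o: "open (subspace_proj V -` W)" using open_vimage_subspace_proj[OF V True] .
  have WV: "W \<subseteq> V" using openin_imp_subset[OF True] .
  have shift: "subspace_proj V (x + t *\<^sub>R v) = subspace_proj V x + t *\<^sub>R subspace_proj V v" for x t v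
    using P(1) by (simp add: linear_add linear_cmul)
  have "smooth_in V W f \<longleftrightarrow> smooth_in UNIV (subspace_proj V -` W) (f \<circ> subspace_proj V)"
  proof
    assume f: "smooth_in V W f"
    show "smooth_in UNIV (subspace_proj V -` W) (f \<circ> subspace_proj V)"
      unfolding smooth_in_def
    proof (intro conjI allI impI ballI)
      fix vs
      have s: "set (map (subspace_proj V) vs) \<subseteq> V" using P by auto
      have "continuous_on W (iter_dderiv (map (subspace_proj V) vs) f)"
        using f s unfolding smooth_in_def by blast
      moreover have "continuous_on (subspace_proj V -` W) (subspace_proj V)"
        using P(1) linear_continuous_on linear_conv_bounded_linear by blast
      ultimately show "continuous_on (subspace_proj V -` W) (iter_dderiv vs (f \<circ> subspace_proj V))"
        unfolding it by (rule continuous_on_compose2) auto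
      fix v x assume "x \<in> subspace_proj V -` W"
      then show "(\<lambda>t. iter_dderiv vs (f \<circ> subspace_proj V) (x + t *\<^sub>R v)) differentiable at 0"
        using f s P(2) unfolding smooth_in_def it shift by blast
    qed (use o in simp)
  next
    assume f: "smooth_in UNIV (subspace_proj V -` W) (f \<circ> subspace_proj V)"
    have eq: "iter_dderiv vs (f \<circ> subspace_proj V) x = iter_dderiv vs f x" if "set vs \<subseteq> V" "x \<in> V" for vs x
      using it that map_subspace_proj[OF V that(1)] P(3) by metis
    have sub: "W \<subseteq> subspace_proj V -` W" using WV P(3) by auto
    show "smooth_in V W f"
      unfolding smooth_in_def
    proof (intro conjI allI impI ballI)
      fix vs assume vs: "set vs \<subseteq> V"
      have "continuous_on (subspace_proj V -` W) (iter_dderiv vs (f \<circ> subspace_proj V))"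
        using f unfolding smooth_in_def by blast
      then have "continuous_on W (iter_dderiv vs (f \<circ> subspace_proj V))"
        using sub continuous_on_subset by blast
      then show "continuous_on W (iter_dderiv vs f)"
        by (rule continuous_on_eq) (use eq[OF vs] WV in auto)
      fix v x assume v: "v \<in> V" and x: "x \<in> W"
      have "x + t *\<^sub>R v \<in> V" for t using v x WV V by (auto intro: subspace_add subspace_mul)
      moreover have "(\<lambda>t. iter_dderiv vs (f \<circ> subspace_proj V) (x + t *\<^sub>R v)) differentiable at 0"
        using f x sub unfolding smooth_in_def by blast
      ultimately show "(\<lambda>t. iter_dderiv vs f (x + t *\<^sub>R v)) differentiable at 0"
        using eq[OF vs] by simp
    qed (rule True)
  qed
  then show ?thesis using True o by (simp add: smooth_in_UNIV_iff)
qed (simp add: smooth_in_def)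

lemma smooth_in_openin: "smooth_in V W f \<Longrightarrow> openin (top_of_set V) W"
  by (simp add: smooth_in_def)

lemma smooth_in_cong:
  assumes "subspace V" "smooth_in V W f" "\<And>x. x \<in> W \<Longrightarrow> f x = g x"
  shows "smooth_in V W g"
proof -
  have "open (subspace_proj V -` W)" using assms open_vimage_subspace_proj smooth_in_openin by blast
  from Ck_on_cong_imp[OF this] show ?thesis using assms unfolding smooth_in_iff_Cinf_on[OF assms(1)]
    by (metis comp_apply vimageE)
qed

lemma smooth_in_subset:
  assumes "subspace V" "smooth_in V W f" "W' \<subseteq> W" "openin (top_of_set V) W'"
  shows "smooth_in V W' f"
  using assms Ck_on_subset[of _ "subspace_proj V -` W" "f \<circ> subspace_proj V" "subspace_proj V -` W'"]
  unfolding smooth_in_iff_Cinf_on[OF assms(1)] by (simp add: vimage_mono)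

lemma smooth_in_open_cover:
  assumes V: "subspace V" and *: "\<And>x. x \<in> W \<Longrightarrow> \<exists>W'. x \<in> W' \<and> W' \<subseteq> W \<and> smooth_in V W' f"
  shows "smooth_in V W f"
proof -
  have "openin (top_of_set V) W"
    using * smooth_in_openin openin_subopen[of _ W] by metis
  moreover have "Ck_on k (subspace_proj V -` W) (f \<circ> subspace_proj V)" for k
  proof (rule Ck_on_open_cover)
    fix x assume "x \<in> subspace_proj V -` W"
    then obtain W' where W': "subspace_proj V x \<in> W'" "smooth_in V W' f" using * by blast
    then show "\<exists>W'. open W' \<and> x \<in> W' \<and> Ck_on k W' (f \<circ> subspace_proj V)"
      using open_vimage_subspace_proj[OF V] unfolding smooth_in_iff_Cinf_on[OF V] by blast
  qed
  ultimately show ?thesis unfolding smooth_in_iff_Cinf_on[OF V] by blast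
qed

lemma smooth_in_const: "subspace V \<Longrightarrow> openin (top_of_set V) W \<Longrightarrow> smooth_in V W (\<lambda>x. c)"
  by (simp add: smooth_in_iff_Cinf_on o_def Ck_on_const)

lemma smooth_in_add: "subspace V \<Longrightarrow> smooth_in V W f \<Longrightarrow> smooth_in V W g \<Longrightarrow> smooth_in V W (\<lambda>x. f x + g x)"
  by (simp add: smooth_in_iff_Cinf_on o_def Ck_on_add)

lemma smooth_in_mult:
  fixes f g :: "'e::euclidean_space \<Rightarrow> real"
  shows "subspace V \<Longrightarrow> smooth_in V W f \<Longrightarrow> smooth_in V W g \<Longrightarrow> smooth_in V W (\<lambda>x. f x * g x)"
  by (simp add: smooth_in_iff_Cinf_on o_def Ck_on_mult)

lemma smooth_in_linear:
  assumes "subspace V" "linear L" "openin (top_of_set V) W"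
  shows "smooth_in V W L"
  unfolding smooth_in_iff_Cinf_on[OF assms(1)]
  using assms Ck_on_linear[OF linear_compose[OF subspace_proj(1)]] by blast

lemma smooth_in_compose:
  fixes f :: "'e::euclidean_space \<Rightarrow> 'd::euclidean_space"
  assumes V: "subspace V" "subspace V'" and f: "smooth_in V W f" and g: "smooth_in V' W' g"
    and sub: "f ` W \<subseteq> W'"
  shows "smooth_in V W (g \<circ> f)"
proof -
  have "W' \<subseteq> V'" using smooth_in_openin[OF g] by (rule openin_imp_subset)
  then have P: "subspace_proj V' (f x) = f x" if "x \<in> W" for x
    using that sub subspace_proj(3)[OF V(2)] by blast
  have "Ck_on k (subspace_proj V -` W) (\<lambda>x. (g \<circ> subspace_proj V') ((f \<circ> subspace_proj V) x))" for k
  proof (rule Ck_on_compose)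
    show "Ck_on k (subspace_proj V' -` W') (g \<circ> subspace_proj V')"
      using g smooth_in_iff_Cinf_on[OF V(2)] by blast
    show "Ck_on k (subspace_proj V -` W) (f \<circ> subspace_proj V)"
      using f smooth_in_iff_Cinf_on[OF V(1)] by blast
    show "open (subspace_proj V' -` W')"
      using open_vimage_subspace_proj[OF V(2)] g smooth_in_openin by blast
    show "(f \<circ> subspace_proj V) ` (subspace_proj V -` W) \<subseteq> subspace_proj V' -` W'"
      using P sub by auto
  qed
  then have "Ck_on k (subspace_proj V -` W) ((g \<circ> f) \<circ> subspace_proj V)" for k
    by (rule Ck_on_cong_imp[OF open_vimage_subspace_proj[OF V(1) smooth_in_openin[OF f]]]) (simp add: P)
  then show ?thesis using f unfolding smooth_in_iff_Cinf_on[OF V(1)] by blast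
qed

lemma smooth_in_has_vector_derivative:
  assumes "smooth_in V W f" "x \<in> W" "v \<in> V"
  shows "((\<lambda>t. f (x + t *\<^sub>R v)) has_vector_derivative iter_dderiv [v] f x) (at 0)"
proof -
  have "(\<lambda>t. iter_dderiv [] f (x + t *\<^sub>R v)) differentiable at 0"
    using assms unfolding smooth_in_def by (metis empty_set empty_subsetI)
  then show ?thesis by (simp add: vector_derivative_works)
qed

lemma smooth_in_has_derivative:
  assumes V: "subspace V" and f: "smooth_in V W f" and x: "x \<in> W"
  obtains f' where "linear f'" "\<And>v. v \<in> V \<Longrightarrow> iter_dderiv [v] f x = f' v"
    "((f \<circ> subspace_proj V) has_derivative f') (at x)"
proof -
  let ?F = "f \<circ> subspace_proj V"
  have o: "open (subspace_proj V -` W)" using open_vimage_subspace_proj[OF V] smooth_in_openin[OF f] by blast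
  have c: "Cinf_on (subspace_proj V -` W) ?F" using f smooth_in_iff_Cinf_on[OF V] by blast
  have WV: "W \<subseteq> V" using openin_imp_subset[OF smooth_in_openin[OF f]] .
  have x': "x \<in> subspace_proj V -` W" using x WV subspace_proj(3)[OF V] by auto
  define f' where "f' = frechet_derivative ?F (at x)"
  have d: "(?F has_derivative f') (at x)" unfolding f'_def by (rule Cinf_on_derivative(1)[OF o c x'])
  have 2: "iter_dderiv [v] f x = f' v" if v: "v \<in> V" for v
  proof -
    have "iter_dderiv [v] ?F x = iter_dderiv [v] f x"
      using iter_dderiv_compose_subspace_proj[OF V, of "[v]" f x] v x WV subspace_proj(3)[OF V] by auto
    moreover have "iter_dderiv [v] ?F x = f' v"
      using Cinf_on_dderiv[OF o c x', of v] unfolding f'_def by (simp add: vector_derivative_at)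
    ultimately show ?thesis by simp
  qed
  show ?thesis using that[OF has_derivative_linear[OF d] 2 d] .
qed

section \<open>Hadamard's lemma\<close>

text \<open>Each differentiation in \<open>x\<close> under the integral sign produces a factor
  \<open>t\<close> by the chain rule. The weight \<open>t ^ n\<close> makes the claim stable under
  this, so that the induction closes with \<open>n\<close> and \<open>H\<close> generalised; only
  \<open>n = 0\<close> is wanted in the end.\<close>

lemma integral_segment_Ck_on:
  fixes H :: "'e::euclidean_space \<Rightarrow> real"
  assumes "Cinf_on (ball x0 r) H"
  shows "Ck_on k (ball x0 r) (\<lambda>x. integral (cbox 0 1) (\<lambda>t. t ^ n * H (x0 + t *\<^sub>R (x - x0))))"
  using assms
proof (induction k arbitrary: n H)
  have seg: "x0 + t *\<^sub>R (x - x0) \<in> ball x0 r" if "x \<in> ball x0 r" "t \<in> cbox 0 1" for x t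
  proof -
    have "\<bar>t\<bar> * norm (x - x0) \<le> 1 * norm (x - x0)" using that(2) by (intro mult_right_mono) auto
    then show ?thesis using that(1) by (simp add: dist_norm norm_minus_commute)
  qed
  have cont: "continuous_on (U \<times> cbox 0 1) (\<lambda>(u, t). t ^ n * H (x0 + t *\<^sub>R (h u - x0)))"
    if H: "Cinf_on (ball x0 r) H" and h: "continuous_on U h" "h ` U \<subseteq> ball x0 r"
    for n H U and h :: "'u::t2_space \<Rightarrow> 'e"
  proof -
    have "continuous_on (U \<times> cbox 0 1) (\<lambda>p. H (x0 + snd p *\<^sub>R (h (fst p) - x0)))"
    proof (rule continuous_on_compose2[OF Ck_on_imp_continuous_on[OF H[rule_format]]])
      show "continuous_on (U \<times> cbox 0 1) (\<lambda>p. x0 + snd p *\<^sub>R (h (fst p) - x0))"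
        by (intro continuous_intros continuous_on_compose2[OF h(1)]) auto
    qed (use seg h(2) in force)
    then show ?thesis unfolding split_beta by (intro continuous_intros)
  qed
  {
    case 0
    show ?case
      using integral_continuous_on_param[OF cont[OF 0 continuous_on_id]] by simp
  next
    case (Suc k)
    let ?I = "\<lambda>n H x. integral (cbox 0 1) (\<lambda>t. t ^ n * H (x0 + t *\<^sub>R (x - x0)))"
    have it: "Cinf_on (ball x0 r) (iter_dderiv [b] H)" for b
      using iter_dderiv_Cinf_on[OF open_ball Suc.prems] .
    have d: "((\<lambda>s. ?I n H (x + s *\<^sub>R b)) has_vector_derivative ?I (Suc n) (iter_dderiv [b] H) x) (at 0)"
      if x: "x \<in> ball x0 r" for x b
    proof -
      define U where "U = (\<lambda>s. x + s *\<^sub>R b) -` ball x0 r"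
      have co: "continuous_on A (\<lambda>s. x + s *\<^sub>R b)" for A by (intro continuous_intros)
      have U: "open U" "0 \<in> U" using x open_vimage[OF open_ball co] by (auto simp: U_def)
      \<comment> \<open>Leibniz's rule is applied over a convex parameter set. \<open>U\<close> is
        convex as the preimage of a ball under an affine map.\<close>
      have "convex ((\<lambda>s. s *\<^sub>R b) -` ((\<lambda>y. - x + y) ` ball x0 r))"
        by (intro convex_linear_vimage convex_translation convex_ball linear_scaleR_left)
      moreover have "(\<lambda>s. s *\<^sub>R b) -` ((\<lambda>y. - x + y) ` ball x0 r) = U"
        by (force simp: U_def image_iff)
      ultimately have "convex U" by simp
      have "((\<lambda>s. ?I n H (x + s *\<^sub>R b)) has_vector_derivative ?I (Suc n) (iter_dderiv [b] H) (x + 0 *\<^sub>R b)) (at 0 within U)"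
      proof (rule leibniz_rule_vector_derivative[OF _ _ _ U(2) \<open>convex U\<close>])
        fix s t :: real assume s: "s \<in> U" and t: "t \<in> cbox 0 1"
        define y where "y s = x0 + t *\<^sub>R (x + s *\<^sub>R b - x0)" for s
        have y: "y s \<in> ball x0 r" using seg[OF _ t] s by (simp add: y_def U_def)
        have 1: "(H has_derivative frechet_derivative H (at (y s))) (at (y s))"
          using Cinf_on_derivative(1)[OF open_ball Suc.prems y] .
        have 2: "(y has_derivative (\<lambda>h. (t * h) *\<^sub>R b)) (at s)"
          unfolding y_def by (auto intro!: derivative_eq_intros)
        have e: "frechet_derivative H (at (y s)) b = iter_dderiv [b] H (y s)"
          using Cinf_on_dderiv[OF open_ball Suc.prems y, of b] by (simp add: vector_derivative_at)
        have "((\<lambda>s. H (y s)) has_vector_derivative t * iter_dderiv [b] H (y s)) (at s)"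
          using has_derivative_compose[OF 2 1] has_derivative_linear[OF 1]
          unfolding e[symmetric] has_vector_derivative_def by (simp add: linear_cmul mult_ac)
        then have "((\<lambda>s. t ^ n * H (y s)) has_vector_derivative t ^ n * (t * iter_dderiv [b] H (y s))) (at s)"
          by (rule has_vector_derivative_mult_right)
        then show "((\<lambda>s. t ^ n * H (x0 + t *\<^sub>R (x + s *\<^sub>R b - x0))) has_vector_derivative
            t ^ Suc n * iter_dderiv [b] H (x0 + t *\<^sub>R (x + s *\<^sub>R b - x0))) (at s within U)"
          unfolding y_def by (simp only: power_Suc mult_ac has_vector_derivative_at_within)
      next
        fix s assume s: "s \<in> U"
        have "continuous_on (cbox 0 1) (\<lambda>t. H (x0 + t *\<^sub>R (x + s *\<^sub>R b - x0)))"
          by (rule continuous_on_compose2[OF Ck_on_imp_continuous_on[OF Suc.prems[rule_format]]])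
             (use s seg in \<open>auto simp: U_def intro!: continuous_intros\<close>)
        then have "continuous_on (cbox 0 1) (\<lambda>t. t ^ n * H (x0 + t *\<^sub>R (x + s *\<^sub>R b - x0)))"
          by (intro continuous_intros)
        then show "(\<lambda>t. t ^ n * H (x0 + t *\<^sub>R (x + s *\<^sub>R b - x0))) integrable_on cbox 0 1"
          by (rule integrable_continuous)
      next
        show "continuous_on (U \<times> cbox 0 1)
            (\<lambda>(s, t). t ^ Suc n * iter_dderiv [b] H (x0 + t *\<^sub>R (x + s *\<^sub>R b - x0)))"
          by (rule cont[OF it co]) (auto simp: U_def)
      qed
      then show ?thesis using at_within_open[OF U(2,1)] by simp
    qed
    have c: "continuous_on (ball x0 r) (?I (Suc n) (iter_dderiv [b] H))" for b
      using Ck_on_imp_continuous_on[OF Suc.IH[OF it]] .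
    show ?case
    proof (rule Ck_on_SucI)
      show "(?I n H has_derivative (\<lambda>h. \<Sum>b\<in>Basis. (h \<bullet> b) *\<^sub>R ?I (Suc n) (iter_dderiv [b] H) x)) (at x)"
        if "x \<in> ball x0 r" for x
        by (rule has_derivative_partialsI[OF open_ball that]) (use c d in auto)
      show "Ck_on k (ball x0 r) (\<lambda>x. \<Sum>b\<in>Basis. (v \<bullet> b) *\<^sub>R ?I (Suc n) (iter_dderiv [b] H) x)" for v
        by (intro Ck_on_sum Ck_on_scaleR Ck_on_const Suc.IH it)
    qed
  }
qed

text \<open>The coefficient \<open>g b\<close> is the average, along the segment from
  \<open>x0\<close> to \<open>x\<close>, of the derivative in direction \<open>b\<close> of
  \<open>f\<close> composed with the projection; the expansion is the fundamental theorem of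
  calculus on this segment. As \<open>b\<close> ranges over the basis of the ambient space, the
  value at \<open>x0\<close> involves the projected direction.\<close>

lemma smooth_in_hadamard:
  fixes f :: "'e::euclidean_space \<Rightarrow> real"
  assumes V: "subspace V" and f: "smooth_in V W f" and x0: "x0 \<in> W"
  obtains W' g where "x0 \<in> W'" "W' \<subseteq> W" "\<And>b. smooth_in V W' (g b)"
    "\<And>x. x \<in> W' \<Longrightarrow> f x = f x0 + (\<Sum>b\<in>Basis. ((x - x0) \<bullet> b) * g b x)"
    "\<And>b. g b x0 = iter_dderiv [subspace_proj V b] f x0"
proof -
  define P where "P = subspace_proj V"
  note P = subspace_proj[OF V, folded P_def]
  define F where "F = f \<circ> P"
  have WV: "W \<subseteq> V" using openin_imp_subset[OF smooth_in_openin[OF f]] .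
  have o: "open (P -` W)"
    using open_vimage_subspace_proj[OF V smooth_in_openin[OF f]] by (simp add: P_def)
  have "x0 \<in> P -` W" using x0 WV P(3) by auto
  then obtain r where r: "r > 0" "ball x0 r \<subseteq> P -` W" using o open_contains_ball by blast
  have "Cinf_on (P -` W) F" using f unfolding smooth_in_iff_Cinf_on[OF V] F_def P_def by blast
  then have c: "Cinf_on (ball x0 r) F" using Ck_on_subset[OF _ r(2)] by blast
  have it: "Cinf_on (ball x0 r) (iter_dderiv [b] F)" for b
    using iter_dderiv_Cinf_on[OF open_ball c] .
  define g where "g b x = integral (cbox 0 1) (\<lambda>t. iter_dderiv [b] F (x0 + t *\<^sub>R (x - x0)))" for b x
  have g: "Cinf_on (ball x0 r) (g b)" for b
    unfolding g_def[abs_def] using integral_segment_Ck_on[OF it[of b], of _ 0] by (simp del: iter_dderiv.simps)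
  define W' where "W' = ball x0 r \<inter> V"
  have oW': "openin (top_of_set V) W'" by (auto simp: W'_def Int_commute)
  have W'W: "W' \<subseteq> W" using r(2) P(3) by (auto simp: W'_def)
  have 1: "smooth_in V W' (g b)" for b
  proof -
    have "Ck_on k (P -` W') (\<lambda>x. g b (P x))" for k
      by (rule Ck_on_compose[OF Ck_on_linear[OF P(1)] g[rule_format] open_ball]) (auto simp: W'_def)
    then show ?thesis using oW' unfolding smooth_in_iff_Cinf_on[OF V] by (simp add: P_def o_def)
  qed
  have 2: "f x = f x0 + (\<Sum>b\<in>Basis. ((x - x0) \<bullet> b) * g b x)" if x: "x \<in> W'" for x
  proof -
    have seg: "x0 + t *\<^sub>R (x - x0) \<in> ball x0 r" if "t \<in> {0..1}" for t
    proof -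
      have "\<bar>t\<bar> * norm (x - x0) \<le> 1 * norm (x - x0)" using that by (intro mult_right_mono) auto
      then show ?thesis using x by (simp add: W'_def dist_norm norm_minus_commute)
    qed
    have "continuous_on {0..1} (\<lambda>t. iter_dderiv [b] F (x0 + t *\<^sub>R (x - x0)))" for b
      by (rule continuous_on_compose2[OF Ck_on_imp_continuous_on[OF it[rule_format]]])
         (use seg in \<open>auto intro!: continuous_intros\<close>)
    then have int: "((\<lambda>t. iter_dderiv [b] F (x0 + t *\<^sub>R (x - x0))) has_integral g b x) {0..1}" for b
      unfolding g_def cbox_interval using integrable_continuous_real by (blast intro: integrable_integral)
    have "((\<lambda>t. F (x0 + t *\<^sub>R (x - x0))) has_vector_derivative
        (\<Sum>b\<in>Basis. ((x - x0) \<bullet> b) * iter_dderiv [b] F (x0 + t *\<^sub>R (x - x0)))) (at t within {0..1})"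
      if t: "t \<in> {0..1}" for t
    proof -
      define y where "y t = x0 + t *\<^sub>R (x - x0)" for t
      have y: "y t \<in> ball x0 r" using seg[OF t] by (simp add: y_def)
      have a: "(F has_derivative frechet_derivative F (at (y t))) (at (y t))"
        using Cinf_on_derivative(1)[OF open_ball c y] .
      have b: "(y has_derivative (\<lambda>h. h *\<^sub>R (x - x0))) (at t)"
        unfolding y_def by (auto intro!: derivative_eq_intros)
      have lin: "linear (frechet_derivative F (at (y t)))" using has_derivative_linear[OF a] .
      have e: "frechet_derivative F (at (y t)) b = iter_dderiv [b] F (y t)" for b
        using Cinf_on_dderiv[OF open_ball c y, of b] by (simp add: vector_derivative_at)
      have "frechet_derivative F (at (y t)) (x - x0) = (\<Sum>b\<in>Basis. ((x - x0) \<bullet> b) * iter_dderiv [b] F (y t))"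
        by (subst euclidean_representation[of "x - x0", symmetric])
           (simp only: linear_sum[OF lin] linear_cmul[OF lin] e[symmetric] real_scaleR_def)
      then have "((\<lambda>t. F (y t)) has_vector_derivative
          (\<Sum>b\<in>Basis. ((x - x0) \<bullet> b) * iter_dderiv [b] F (y t))) (at t)"
        using has_derivative_compose[OF b a] unfolding has_vector_derivative_def
        by (simp only: linear_cmul[OF lin])
      then show ?thesis unfolding y_def by (rule has_vector_derivative_at_within)
    qed
    then have "((\<lambda>t. \<Sum>b\<in>Basis. ((x - x0) \<bullet> b) * iter_dderiv [b] F (x0 + t *\<^sub>R (x - x0))) has_integral
        (F (x0 + 1 *\<^sub>R (x - x0)) - F (x0 + 0 *\<^sub>R (x - x0)))) {0..1}"
      by (rule fundamental_theorem_of_calculus[OF zero_le_one])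
    moreover have "((\<lambda>t. \<Sum>b\<in>Basis. ((x - x0) \<bullet> b) * iter_dderiv [b] F (x0 + t *\<^sub>R (x - x0))) has_integral
        (\<Sum>b\<in>Basis. ((x - x0) \<bullet> b) * g b x)) {0..1}"
      by (intro has_integral_sum has_integral_mult_right int finite_Basis)
    ultimately have "F (x0 + 1 *\<^sub>R (x - x0)) - F (x0 + 0 *\<^sub>R (x - x0)) = (\<Sum>b\<in>Basis. ((x - x0) \<bullet> b) * g b x)"
      by (rule has_integral_unique)
    moreover have "F x = f x" "F x0 = f x0" using P(3) x x0 WV by (auto simp: F_def W'_def)
    ultimately show ?thesis by simp
  qed
  have 3: "g b x0 = iter_dderiv [subspace_proj V b] f x0" for b
  proof -
    have "g b x0 = iter_dderiv [b] F x0" by (simp add: g_def)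
    also have "\<dots> = iter_dderiv [P b] f x0"
      using iter_dderiv_compose_subspace_proj[OF V, of "[b]" f x0] P(3) x0 WV
      by (auto simp: F_def P_def)
    finally show ?thesis by (simp add: P_def)
  qed
  have "x0 \<in> W'" using r(1) x0 WV by (auto simp: W'_def)
  then show ?thesis using that[of W' g] W'W 1 2 3 by blast
qed

section \<open>Germs of smooth functions\<close>

lemma iter_dderiv_local:
  assumes V: "subspace V" and W: "openin (top_of_set V) W" "x \<in> W" and v: "v \<in> V"
    and eq: "\<And>y. y \<in> W \<Longrightarrow> f y = g y"
  shows "iter_dderiv [v] f x = iter_dderiv [v] g x"
proof -
  obtain T where T: "open T" "W = V \<inter> T" using W(1) by (auto simp: openin_open)
  define A where "A = (\<lambda>t. x + t *\<^sub>R v) -` T"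
  have "continuous_on UNIV (\<lambda>t. x + t *\<^sub>R v)" by (intro continuous_intros)
  then have A: "open A" "0 \<in> A" using open_vimage[OF T(1)] T W(2) by (auto simp: A_def)
  have "f (x + t *\<^sub>R v) = g (x + t *\<^sub>R v)" if "t \<in> A" for t
    using that T v W(2) V by (intro eq) (auto simp: A_def intro: subspace_add subspace_mul)
  then have "((\<lambda>t. f (x + t *\<^sub>R v)) has_vector_derivative D) (at 0) \<longleftrightarrow>
      ((\<lambda>t. g (x + t *\<^sub>R v)) has_vector_derivative D) (at 0)" for D
    by (intro has_vector_derivative_cong_ev eventually_mono[OF eventually_nhds_in_open[OF A]])
       (use eq[OF W(2)] in auto)
  then show ?thesis by (simp add: vector_derivative_def)
qed

section \<open>Charts, and smoothness tested in one chart\<close>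

lemma model_subspace: "smooth_manifold M \<Longrightarrow> subspace (model M)"
  by (simp add: smooth_manifold_def)

lemma ex_chart:
  assumes "smooth_manifold M" "p \<in> pts M"
  obtains U \<phi> where "(U, \<phi>) \<in> atlas M" "p \<in> U"
  using assms unfolding smooth_manifold_def by blast

lemma chart_transition:
  assumes "smooth_manifold M" "(U, \<phi>) \<in> atlas M" "(U', \<phi>') \<in> atlas M"
  shows "smooth_in (model M) (\<phi> ` (U \<inter> U')) (\<phi>' \<circ> inv_into U \<phi>)"
  using assms unfolding smooth_manifold_def by blast

lemma
  assumes "smooth_manifold M" "(U, \<phi>) \<in> atlas M"
  shows chart_is_chart: "is_chart M U \<phi>"
    and chart_openin: "openin (topo M) U"
    and chart_subset: "U \<subseteq> pts M"
    and chart_image_openin: "openin (top_of_set (model M)) (\<phi> ` U)"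
    and chart_image_subset: "\<phi> ` U \<subseteq> model M"
    and chart_inj_on: "inj_on \<phi> U"
proof -
  show 1: "is_chart M U \<phi>" using assms unfolding smooth_manifold_def by blast
  show 2: "openin (topo M) U" using 1 by (simp add: is_chart_def)
  show "U \<subseteq> pts M" using 2 by (rule openin_subset)
  show 3: "openin (top_of_set (model M)) (\<phi> ` U)" using 1 by (simp add: is_chart_def)
  show "\<phi> ` U \<subseteq> model M" using openin_imp_subset[OF 3] .
  have "homeomorphic_map (subtopology (topo M) U) (top_of_set (\<phi> ` U)) \<phi>" using 1 by (simp add: is_chart_def)
  then show "inj_on \<phi> U" using \<open>U \<subseteq> pts M\<close>
    using homeomorphic_imp_injective_map[of "subtopology (topo M) U"] by (simp add: inf.absorb2)
qed

lemma chart_open_image: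
  assumes "smooth_manifold M" "(U, \<phi>) \<in> atlas M" "openin (topo M) W" "W \<subseteq> U"
  shows "openin (top_of_set (model M)) (\<phi> ` W)"
proof -
  have "homeomorphic_map (subtopology (topo M) U) (top_of_set (\<phi> ` U)) \<phi>"
    using chart_is_chart[OF assms(1,2)] by (simp add: is_chart_def)
  then have "open_map (subtopology (topo M) U) (top_of_set (\<phi> ` U)) \<phi>"
    by (rule homeomorphic_imp_open_map)
  moreover have "openin (subtopology (topo M) U) W"
    using openin_open_subtopology[OF chart_openin[OF assms(1,2)]] assms(3,4) by simp
  ultimately have "openin (top_of_set (\<phi> ` U)) (\<phi> ` W)" by (simp add: open_map_def)
  then show ?thesis using chart_image_openin[OF assms(1,2)] openin_trans by blast
qed

lemma chart_open_preimage:
  assumes "smooth_manifold M" "(U, \<phi>) \<in> atlas M" "openin (top_of_set (model M)) T"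
  shows "openin (topo M) {q \<in> U. \<phi> q \<in> T}"
proof -
  have "homeomorphic_map (subtopology (topo M) U) (top_of_set (\<phi> ` U)) \<phi>"
    using chart_is_chart[OF assms(1,2)] by (simp add: is_chart_def)
  then have c: "continuous_map (subtopology (topo M) U) (top_of_set (\<phi> ` U)) \<phi>"
    by (rule homeomorphic_imp_continuous_map)
  have "openin (top_of_set (\<phi> ` U)) (\<phi> ` U \<inter> T)"
    using assms(3) chart_image_subset[OF assms(1,2)] by (auto simp: openin_open)
  from openin_continuous_map_preimage[OF c this]
  have "openin (subtopology (topo M) U) {q \<in> topspace (subtopology (topo M) U). \<phi> q \<in> \<phi> ` U \<inter> T}" .
  moreover have "{q \<in> topspace (subtopology (topo M) U). \<phi> q \<in> \<phi> ` U \<inter> T} = {q \<in> U. \<phi> q \<in> T}"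
    using chart_subset[OF assms(1,2)] by auto
  ultimately show ?thesis using openin_open_subtopology[OF chart_openin[OF assms(1,2)]] by simp
qed

text \<open>Passing to another chart composes with a smooth transition map, so a single chart
  decides.\<close>

lemma smooth_fun_on_chartI:
  assumes M: "smooth_manifold M" and c: "(U, \<phi>) \<in> atlas M" and W: "openin (topo M) W" "W \<subseteq> U"
    and f: "smooth_in (model M) (\<phi> ` W) (f \<circ> inv_into U \<phi>)"
  shows "smooth_fun_on M W f"
  unfolding smooth_fun_on_def
proof (intro conjI W(1) ballI, clarify)
  fix U' \<phi>' assume c': "(U', \<phi>') \<in> atlas M"
  note V = model_subspace[OF M] and inj = chart_inj_on[OF M c] and inj' = chart_inj_on[OF M c']
  have o: "openin (topo M) (U' \<inter> W)" using chart_openin[OF M c'] W(1) by blast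
  have o': "openin (top_of_set (model M)) (\<phi>' ` (U' \<inter> W))" using chart_open_image[OF M c' o] by simp
  have "smooth_in (model M) (\<phi>' ` (U' \<inter> W)) (\<phi> \<circ> inv_into U' \<phi>')"
    by (rule smooth_in_subset[OF V chart_transition[OF M c' c] _ o']) (use W(2) in auto)
  then have "smooth_in (model M) (\<phi>' ` (U' \<inter> W)) ((f \<circ> inv_into U \<phi>) \<circ> (\<phi> \<circ> inv_into U' \<phi>'))"
    by (rule smooth_in_compose[OF V V _ f]) (use inj' in auto)
  then show "smooth_in (model M) (\<phi>' ` (U' \<inter> W)) (f \<circ> inv_into U' \<phi>')"
    by (rule smooth_in_cong[OF V]) (use inj inj' W(2) in auto)
qed

lemma smooth_fun_onD:
  assumes "smooth_fun_on M W f" "(U, \<phi>) \<in> atlas M"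
  shows "smooth_in (model M) (\<phi> ` (U \<inter> W)) (f \<circ> inv_into U \<phi>)"
  using assms unfolding smooth_fun_on_def by blast

lemma smooth_fun_on_openin: "smooth_fun_on M W f \<Longrightarrow> openin (topo M) W"
  by (simp add: smooth_fun_on_def)

lemma smooth_fun_on_subset:
  assumes M: "smooth_manifold M" and f: "smooth_fun_on M W f" and W': "W' \<subseteq> W" "openin (topo M) W'"
  shows "smooth_fun_on M W' f"
  unfolding smooth_fun_on_def
proof (intro conjI W'(2) ballI, clarify)
  fix U \<phi> assume c: "(U, \<phi>) \<in> atlas M"
  show "smooth_in (model M) (\<phi> ` (U \<inter> W')) (f \<circ> inv_into U \<phi>)"
    by (rule smooth_in_subset[OF model_subspace[OF M] smooth_fun_onD[OF f c]])
       (use W' chart_open_image[OF M c, of "U \<inter> W'"] chart_openin[OF M c] in auto)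
qed

text \<open>Reduces smoothness on open sets to smoothness of germs. This is the form needed later,
  since functions on a leaf extend to \<open>M\<close> only locally.\<close>

lemma smooth_fun_on_iff_near:
  assumes M: "smooth_manifold M"
  shows "smooth_fun_on M W f \<longleftrightarrow> openin (topo M) W \<and> (\<forall>p\<in>W. smooth_near M p f)"
proof
  assume "openin (topo M) W \<and> (\<forall>p\<in>W. smooth_near M p f)"
  then have W: "openin (topo M) W" and f: "\<And>p. p \<in> W \<Longrightarrow> smooth_near M p f" by auto
  show "smooth_fun_on M W f"
    unfolding smooth_fun_on_def
  proof (intro conjI W ballI, clarify)
    fix U \<phi> assume c: "(U, \<phi>) \<in> atlas M"
    show "smooth_in (model M) (\<phi> ` (U \<inter> W)) (f \<circ> inv_into U \<phi>)"
    proof (rule smooth_in_open_cover[OF model_subspace[OF M]])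
      fix x assume "x \<in> \<phi> ` (U \<inter> W)"
      then obtain p where p: "p \<in> U" "p \<in> W" "x = \<phi> p" by auto
      obtain Wp where Wp: "p \<in> Wp" "smooth_fun_on M Wp f" using f[OF p(2)] by (auto simp: smooth_near_def)
      have "openin (topo M) (Wp \<inter> W)" using W smooth_fun_on_openin[OF Wp(2)] by blast
      from smooth_fun_onD[OF smooth_fun_on_subset[OF M Wp(2) _ this] c]
      have "smooth_in (model M) (\<phi> ` (U \<inter> (Wp \<inter> W))) (f \<circ> inv_into U \<phi>)" by simp
      then show "\<exists>W'. x \<in> W' \<and> W' \<subseteq> \<phi> ` (U \<inter> W) \<and> smooth_in (model M) W' (f \<circ> inv_into U \<phi>)"
        using p Wp(1) by (intro exI[of _ "\<phi> ` (U \<inter> (Wp \<inter> W))"]) auto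
    qed
  qed
qed (auto simp: smooth_near_def smooth_fun_on_openin)

lemma smooth_near_imp_pts: "smooth_near M p f \<Longrightarrow> p \<in> pts M"
  unfolding smooth_near_def using openin_subset smooth_fun_on_openin by blast

lemma smooth_near_chartE:
  assumes M: "smooth_manifold M" and c: "(U, \<phi>) \<in> atlas M" "p \<in> U" and f: "smooth_near M p f"
  obtains W where "openin (topo M) W" "p \<in> W" "W \<subseteq> U" "smooth_in (model M) (\<phi> ` W) (f \<circ> inv_into U \<phi>)"
proof -
  obtain W where W: "p \<in> W" "smooth_fun_on M W f" using f by (auto simp: smooth_near_def)
  have "openin (topo M) (U \<inter> W)" using chart_openin[OF M c(1)] smooth_fun_on_openin[OF W(2)] by blast
  then show ?thesis using that[of "U \<inter> W"] smooth_fun_onD[OF W(2) c(1)] W(1) c(2) by blast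
qed

lemma smooth_near_chartI:
  assumes M: "smooth_manifold M" and c: "(U, \<phi>) \<in> atlas M" and W: "openin (topo M) W" "p \<in> W" "W \<subseteq> U"
    and f: "smooth_in (model M) (\<phi> ` W) (f \<circ> inv_into U \<phi>)"
  shows "smooth_near M p f"
  using smooth_fun_on_chartI[OF M c W(1,3) f] W(2) by (auto simp: smooth_near_def)

lemma eventually_nhdsin_self:
  "eventually P (nhdsin X p) \<Longrightarrow> p \<in> topspace X \<Longrightarrow> P p"
  by (auto simp: eventually_nhdsin)

lemma eventually_smooth_near:
  assumes "smooth_manifold M" "smooth_near M p f"
  shows "\<forall>\<^sub>F q in nhdsin (topo M) p. smooth_near M q f"
proof -
  obtain W where "p \<in> W" "smooth_fun_on M W f" using assms(2) by (auto simp: smooth_near_def)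
  then show ?thesis unfolding eventually_nhdsin smooth_near_def using smooth_fun_on_openin by blast
qed

lemma smooth_near_const: "smooth_manifold M \<Longrightarrow> p \<in> pts M \<Longrightarrow> smooth_near M p (\<lambda>x. c)"
proof -
  assume M: "smooth_manifold M" and p: "p \<in> pts M"
  obtain U \<phi> where c: "(U, \<phi>) \<in> atlas M" "p \<in> U" using ex_chart[OF M p] .
  show ?thesis
    by (rule smooth_near_chartI[OF M c(1) chart_openin[OF M c(1)] c(2) subset_refl])
       (simp add: o_def smooth_in_const model_subspace[OF M] chart_image_openin[OF M c(1)])
qed

lemma smooth_near_binop:
  assumes M: "smooth_manifold M" and f: "smooth_near M p f" and g: "smooth_near M p g"
    and bin: "\<And>W f' g' :: 'e::euclidean_space \<Rightarrow> real. smooth_in (model M) W f' \<Longrightarrow> smooth_in (model M) W g' \<Longrightarrow>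
      smooth_in (model M) W (\<lambda>x. b (f' x) (g' x))"
  shows "smooth_near (M :: ('a, 'e) manifold) p (\<lambda>x. b (f x) (g x))"
proof -
  obtain U \<phi> where c: "(U, \<phi>) \<in> atlas M" "p \<in> U" using ex_chart[OF M smooth_near_imp_pts[OF f]] .
  obtain W where W: "openin (topo M) W" "p \<in> W" "W \<subseteq> U" "smooth_in (model M) (\<phi> ` W) (f \<circ> inv_into U \<phi>)"
    using smooth_near_chartE[OF M c f] .
  obtain W' where W': "openin (topo M) W'" "p \<in> W'" "W' \<subseteq> U" "smooth_in (model M) (\<phi> ` W') (g \<circ> inv_into U \<phi>)"
    using smooth_near_chartE[OF M c g] .
  have o: "openin (topo M) (W \<inter> W')" using W W' by blast
  have o': "openin (top_of_set (model M)) (\<phi> ` (W \<inter> W'))" using chart_open_image[OF M c(1) o] W by blast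
  note sub = smooth_in_subset[OF model_subspace[OF M] _ _ o']
  show ?thesis
  proof (rule smooth_near_chartI[OF M c(1) o])
    show "smooth_in (model M) (\<phi> ` (W \<inter> W')) ((\<lambda>x. b (f x) (g x)) \<circ> inv_into U \<phi>)"
      using bin[OF sub[OF W(4)] sub[OF W'(4)]] by (simp add: o_def image_mono)
  qed (use W W' in auto)
qed

lemma smooth_near_add:
  "smooth_manifold M \<Longrightarrow> smooth_near M p f \<Longrightarrow> smooth_near M p g \<Longrightarrow> smooth_near M p (\<lambda>x. f x + g x)"
  by (rule smooth_near_binop) (simp_all add: smooth_in_add model_subspace)

lemma smooth_near_mult:
  "smooth_manifold M \<Longrightarrow> smooth_near M p f \<Longrightarrow> smooth_near M p g \<Longrightarrow> smooth_near M p (\<lambda>x. f x * g x)"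
  by (rule smooth_near_binop) (simp_all add: smooth_in_mult model_subspace)

lemma smooth_near_cmult:
  assumes M: "smooth_manifold M" and f: "smooth_near M p f"
  shows "smooth_near M p (\<lambda>x. c * f x)"
  by (rule smooth_near_mult[OF M smooth_near_const[OF M smooth_near_imp_pts[OF f]] f])

lemma smooth_near_diff:
  "smooth_manifold M \<Longrightarrow> smooth_near M p f \<Longrightarrow> smooth_near M p g \<Longrightarrow> smooth_near M p (\<lambda>x. f x - g x)"
  using smooth_near_add[of M p f "\<lambda>x. (-1) * g x"] smooth_near_cmult[of M p g "-1"] by simp

lemma smooth_near_sum:
  assumes "smooth_manifold M" "p \<in> pts M" "\<And>i. i \<in> I \<Longrightarrow> smooth_near M p (f i)"
  shows "smooth_near M p (\<lambda>x. \<Sum>i\<in>I. f i x)"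
  using assms(3)
proof (induction I rule: infinite_finite_induct)
  case (insert i I)
  then have "smooth_near M p (f i)" "smooth_near M p (\<lambda>x. \<Sum>i\<in>I. f i x)" by simp_all
  from smooth_near_add[OF assms(1) this] show ?case using insert by simp
qed (simp_all add: smooth_near_const assms(1,2))

lemma smooth_near_cong:
  assumes M: "smooth_manifold M" and f: "smooth_near M p f"
    and eq: "\<forall>\<^sub>F q in nhdsin (topo M) p. f q = g q"
  shows "smooth_near M p g"
proof -
  note p = smooth_near_imp_pts[OF f]
  obtain W0 where W0: "openin (topo M) W0" "p \<in> W0" "\<And>q. q \<in> W0 \<Longrightarrow> f q = g q"
    using eq p by (auto simp: eventually_nhdsin)
  obtain U \<phi> where c: "(U, \<phi>) \<in> atlas M" "p \<in> U" using ex_chart[OF M p] .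
  obtain W where W: "openin (topo M) W" "p \<in> W" "W \<subseteq> U" "smooth_in (model M) (\<phi> ` W) (f \<circ> inv_into U \<phi>)"
    using smooth_near_chartE[OF M c f] .
  have o: "openin (topo M) (W \<inter> W0)" using W W0 by blast
  have o': "openin (top_of_set (model M)) (\<phi> ` (W \<inter> W0))" using chart_open_image[OF M c(1) o] W by blast
  have s: "smooth_in (model M) (\<phi> ` (W \<inter> W0)) (f \<circ> inv_into U \<phi>)"
    by (rule smooth_in_subset[OF model_subspace[OF M] W(4) _ o']) auto
  have "smooth_in (model M) (\<phi> ` (W \<inter> W0)) (g \<circ> inv_into U \<phi>)"
    by (rule smooth_in_cong[OF model_subspace[OF M] s])
       (use W W0(3) chart_inj_on[OF M c(1)] in \<open>auto simp: subset_iff\<close>)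
  then show ?thesis using smooth_near_chartI[OF M c(1) o] W W0 by blast
qed

lemma smooth_near_chart_compose:
  assumes M: "smooth_manifold M" and c: "(U, \<phi>) \<in> atlas M" "p \<in> U" and h: "smooth_in (model M) T h" "\<phi> p \<in> T"
  shows "smooth_near M p (\<lambda>q. h (\<phi> q))"
proof -
  note V = model_subspace[OF M] and inj = chart_inj_on[OF M c(1)]
  define W where "W = {q \<in> U. \<phi> q \<in> T}"
  have W: "openin (topo M) W" "p \<in> W" "W \<subseteq> U"
    using chart_open_preimage[OF M c(1) smooth_in_openin[OF h(1)]] c h by (auto simp: W_def)
  have s: "smooth_in (model M) (\<phi> ` W) h"
    by (rule smooth_in_subset[OF V h(1) _ chart_open_image[OF M c(1) W(1,3)]]) (auto simp: W_def)
  have "smooth_in (model M) (\<phi> ` W) ((\<lambda>q. h (\<phi> q)) \<circ> inv_into U \<phi>)"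
    by (rule smooth_in_cong[OF V s]) (use inj W in \<open>auto simp: subset_iff\<close>)
  then show ?thesis by (rule smooth_near_chartI[OF M c(1) W])
qed

lemma smooth_near_coord:
  assumes "smooth_manifold M" "(U, \<phi>) \<in> atlas M" "p \<in> U"
  shows "smooth_near M p (\<lambda>q. \<phi> q \<bullet> b)"
proof (rule smooth_near_chart_compose[OF assms])
  show "smooth_in (model M) (\<phi> ` U) (\<lambda>x. x \<bullet> b)"
    by (rule smooth_in_linear[OF model_subspace[OF assms(1)]])
       (auto simp: chart_image_openin[OF assms(1,2)] bounded_linear.linear[OF bounded_linear_inner_left])
qed (use assms(3) in blast)

section \<open>Tangent vectors and covectors\<close>

lemma
  assumes "v \<in> tangent M p" "smooth_near M p f" "smooth_near M p g"
  shows tangent_lincomb: "v (\<lambda>x. a * f x + b * g x) = a * v f + b * v g"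
    and tangent_mult: "v (\<lambda>x. f x * g x) = v f * g p + f p * v g"
proof -
  have "\<forall>f g. smooth_near M p f \<longrightarrow> smooth_near M p g \<longrightarrow>
      (\<forall>a b. v (\<lambda>x. a * f x + b * g x) = a * v f + b * v g) \<and> v (\<lambda>x. f x * g x) = v f * g p + f p * v g"
    using assms(1) unfolding tangent_def by blast
  from mp[OF mp[OF spec[OF spec[OF this, of f], of g] assms(2)] assms(3)]
  have *: "(\<forall>a b. v (\<lambda>x. a * f x + b * g x) = a * v f + b * v g) \<and> v (\<lambda>x. f x * g x) = v f * g p + f p * v g" .
  show "v (\<lambda>x. a * f x + b * g x) = a * v f + b * v g"
    by (rule spec[OF spec[OF conjunct1[OF *], of a], of b])
  show "v (\<lambda>x. f x * g x) = v f * g p + f p * v g" by (rule conjunct2[OF *])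
qed

lemma tangent_cong:
  assumes "v \<in> tangent M p" "smooth_near M p f" "smooth_near M p g"
    and "\<forall>\<^sub>F q in nhdsin (topo M) p. f q = g q"
  shows "v f = v g"
proof -
  have "\<exists>W. openin (topo M) W \<and> p \<in> W \<and> (\<forall>x\<in>W. f x = g x)"
    using assms(4) smooth_near_imp_pts[OF assms(2)] by (auto simp: eventually_nhdsin)
  then show ?thesis using assms(1-3) unfolding tangent_def by blast
qed

lemma tangent_cong':
  assumes "smooth_manifold M" "v \<in> tangent M p" "smooth_near M p f"
    and "\<forall>\<^sub>F q in nhdsin (topo M) p. f q = g q"
  shows "v f = v g"
  by (rule tangent_cong[OF assms(2,3) smooth_near_cong[OF assms(1,3,4)] assms(4)])

lemma tangent_not_smooth: "v \<in> tangent M p \<Longrightarrow> \<not> smooth_near M p f \<Longrightarrow> v f = 0"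
  by (simp add: tangent_def)

lemma tangentI:
  assumes "\<And>f g a b. smooth_near M p f \<Longrightarrow> smooth_near M p g \<Longrightarrow> v (\<lambda>x. a * f x + b * g x) = a * v f + b * v g"
    and "\<And>f g. smooth_near M p f \<Longrightarrow> smooth_near M p g \<Longrightarrow> v (\<lambda>x. f x * g x) = v f * g p + f p * v g"
    and "\<And>f g. smooth_near M p f \<Longrightarrow> smooth_near M p g \<Longrightarrow> (\<forall>\<^sub>F q in nhdsin (topo M) p. f q = g q) \<Longrightarrow> v f = v g"
    and "\<And>f. \<not> smooth_near M p f \<Longrightarrow> v f = 0"
  shows "v \<in> tangent M p"
  unfolding tangent_def
proof (intro CollectI conjI allI impI)
  fix f g assume fg: "smooth_near M p f" "smooth_near M p g" "\<exists>W. openin (topo M) W \<and> p \<in> W \<and> (\<forall>x\<in>W. f x = g x)"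
  show "v f = v g" by (rule assms(3)[OF fg(1,2)]) (use fg(3) in \<open>auto simp: eventually_nhdsin\<close>)
qed (rule assms; assumption)+

context
  fixes M :: "('a, 'e::euclidean_space) manifold" and v p
  assumes M: "smooth_manifold M" and v: "v \<in> tangent M p"
begin

lemma tangent_add: "smooth_near M p f \<Longrightarrow> smooth_near M p g \<Longrightarrow> v (\<lambda>x. f x + g x) = v f + v g"
  using tangent_lincomb[OF v, of f g 1 1] by simp

lemma tangent_diff: "smooth_near M p f \<Longrightarrow> smooth_near M p g \<Longrightarrow> v (\<lambda>x. f x - g x) = v f - v g"
  using tangent_lincomb[OF v, of f g 1 "-1"] by simp

lemma tangent_cmult: "smooth_near M p f \<Longrightarrow> v (\<lambda>x. c * f x) = c * v f"
  using tangent_lincomb[OF v, of f f c 0] by simp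

lemma tangent_const: "p \<in> pts M \<Longrightarrow> v (\<lambda>x. c) = 0"
proof -
  assume p: "p \<in> pts M"
  have "v (\<lambda>x. 1) = 0"
    using tangent_mult[OF v smooth_near_const[OF M p, of 1] smooth_near_const[OF M p, of 1]] by simp
  then show ?thesis
    using tangent_cmult[OF smooth_near_const[OF M p, of 1], of c] by simp
qed

lemma tangent_sum:
  assumes "p \<in> pts M" "\<And>i. i \<in> I \<Longrightarrow> smooth_near M p (f i)"
  shows "v (\<lambda>x. \<Sum>i\<in>I. f i x) = (\<Sum>i\<in>I. v (f i))"
  using assms(2)
proof (induction I rule: infinite_finite_induct)
  case (insert i I)
  then have "smooth_near M p (f i)" "smooth_near M p (\<lambda>x. \<Sum>i\<in>I. f i x)"
    by (simp_all add: smooth_near_sum M assms(1))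
  from tangent_add[OF this] show ?case using insert by simp
qed (simp_all add: tangent_const assms(1))

end

lemma tangent_subspace:
  assumes u: "u \<in> tangent M p" and v: "v \<in> tangent M p"
  shows "(\<lambda>f. a * u f + b * v f) \<in> tangent M p"
proof (rule tangentI)
  fix f g assume fg: "smooth_near M p f" "smooth_near M p g"
  show "a * u (\<lambda>x. c * f x + d * g x) + b * v (\<lambda>x. c * f x + d * g x) =
     c * (a * u f + b * v f) + d * (a * u g + b * v g)" for c d
    by (simp add: tangent_lincomb[OF u fg] tangent_lincomb[OF v fg] algebra_simps)
  show "a * u (\<lambda>x. f x * g x) + b * v (\<lambda>x. f x * g x) = (a * u f + b * v f) * g p + f p * (a * u g + b * v g)"
    by (simp add: tangent_mult[OF u fg] tangent_mult[OF v fg] algebra_simps)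
  show "a * u f + b * v f = a * u g + b * v g" if "\<forall>\<^sub>F q in nhdsin (topo M) p. f q = g q"
    using tangent_cong[OF u fg that] tangent_cong[OF v fg that] by simp
next
  fix f assume f: "\<not> smooth_near M p f"
  show "a * u f + b * v f = 0" using tangent_not_smooth[OF u f] tangent_not_smooth[OF v f] by simp
qed

lemma zero_in_tangent: "(\<lambda>f. 0) \<in> tangent M p"
  by (rule tangentI) simp_all

lemma tangent_sum_mem:
  "(\<And>i. i \<in> I \<Longrightarrow> v i \<in> tangent M p) \<Longrightarrow> (\<lambda>f. \<Sum>i\<in>I. c i * v i f) \<in> tangent M p"
proof (induction I rule: infinite_finite_induct)
  case (insert i I)
  then have "v i \<in> tangent M p" "(\<lambda>f. \<Sum>i\<in>I. c i * v i f) \<in> tangent M p" by simp_all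
  from tangent_subspace[OF this, of "c i" 1] show ?case using insert by simp
qed (simp_all add: zero_in_tangent)

section \<open>Coordinate derivations and the expansion of tangent vectors\<close>

text \<open>The coordinate derivation in direction \<open>v\<close>. The value 0 on functions that
  are not smooth near \<open>p\<close> is the normalisation that \<open>tangent\<close>
  imposes.\<close>

definition chart_vec :: "('a, 'e::euclidean_space) manifold \<Rightarrow> 'a set \<Rightarrow> ('a \<Rightarrow> 'e) \<Rightarrow> 'e \<Rightarrow> 'a \<Rightarrow> 'a tvec" where
  "chart_vec M U \<phi> v p = (\<lambda>f. if smooth_near M p f then iter_dderiv [v] (f \<circ> inv_into U \<phi>) (\<phi> p) else 0)"

lemma chart_vec_has_vector_derivative:
  assumes M: "smooth_manifold M" and c: "(U, \<phi>) \<in> atlas M" "p \<in> U" and v: "v \<in> model M" and f: "smooth_near M p f"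
  shows "((\<lambda>t. f (inv_into U \<phi> (\<phi> p + t *\<^sub>R v))) has_vector_derivative chart_vec M U \<phi> v p f) (at 0)"
proof -
  obtain W where W: "openin (topo M) W" "p \<in> W" "W \<subseteq> U" "smooth_in (model M) (\<phi> ` W) (f \<circ> inv_into U \<phi>)"
    using smooth_near_chartE[OF M c f] .
  show ?thesis
    using smooth_in_has_vector_derivative[OF W(4) imageI[OF W(2)] v] f
    by (simp add: chart_vec_def)
qed

lemma chart_vec_eqI:
  assumes M: "smooth_manifold M" and c: "(U, \<phi>) \<in> atlas M" "p \<in> U" and v: "v \<in> model M" and f: "smooth_near M p f"
    and d: "((\<lambda>t. f (inv_into U \<phi> (\<phi> p + t *\<^sub>R v))) has_vector_derivative d) (at 0)"
  shows "chart_vec M U \<phi> v p f = d"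
  using chart_vec_has_vector_derivative[OF M c v f] d by (rule vector_derivative_unique_at)

lemma chart_vec_tangent:
  assumes M: "smooth_manifold M" and c: "(U, \<phi>) \<in> atlas M" "p \<in> U" and v: "v \<in> model M"
  shows "chart_vec M U \<phi> v p \<in> tangent M p"
proof (rule tangentI)
  note hvd = chart_vec_has_vector_derivative[OF M c v]
  have p: "p \<in> pts M" using chart_subset[OF M c(1)] c(2) by blast
  have inv: "inv_into U \<phi> (\<phi> p) = p" using chart_inj_on[OF M c(1)] c(2) by simp
  fix f g assume fg: "smooth_near M p f" "smooth_near M p g"
  show "chart_vec M U \<phi> v p (\<lambda>x. a * f x + b * g x) = a * chart_vec M U \<phi> v p f + b * chart_vec M U \<phi> v p g" for a b
  proof (rule chart_vec_eqI[OF M c v])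
    show "smooth_near M p (\<lambda>x. a * f x + b * g x)"
      by (intro smooth_near_add[OF M] smooth_near_cmult[OF M] fg)
  qed (intro has_vector_derivative_add has_vector_derivative_mult_right hvd fg)
  show "chart_vec M U \<phi> v p (\<lambda>x. f x * g x) = chart_vec M U \<phi> v p f * g p + f p * chart_vec M U \<phi> v p g"
  proof (rule chart_vec_eqI[OF M c v])
    show "smooth_near M p (\<lambda>x. f x * g x)" by (rule smooth_near_mult[OF M fg])
    show "((\<lambda>t. f (inv_into U \<phi> (\<phi> p + t *\<^sub>R v)) * g (inv_into U \<phi> (\<phi> p + t *\<^sub>R v))) has_vector_derivative
        chart_vec M U \<phi> v p f * g p + f p * chart_vec M U \<phi> v p g) (at 0)"
      using has_vector_derivative_mult[OF hvd[OF fg(1)] hvd[OF fg(2)]] inv by (simp add: add.commute)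
  qed
  assume ev: "\<forall>\<^sub>F q in nhdsin (topo M) p. f q = g q"
  then obtain W where W: "openin (topo M) W" "p \<in> W" "\<And>q. q \<in> W \<Longrightarrow> f q = g q"
    using p by (auto simp: eventually_nhdsin)
  have o: "openin (topo M) (U \<inter> W)" using W chart_openin[OF M c(1)] by blast
  have "iter_dderiv [v] (f \<circ> inv_into U \<phi>) (\<phi> p) = iter_dderiv [v] (g \<circ> inv_into U \<phi>) (\<phi> p)"
  proof (rule iter_dderiv_local[OF model_subspace[OF M] _ _ v])
    show "openin (top_of_set (model M)) (\<phi> ` (U \<inter> W))" using chart_open_image[OF M c(1) o] by simp
  qed (use c W chart_inj_on[OF M c(1)] in auto)
  then show "chart_vec M U \<phi> v p f = chart_vec M U \<phi> v p g" using fg by (simp add: chart_vec_def)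
qed (simp add: chart_vec_def)

lemma chart_vec_smooth:
  assumes M: "smooth_manifold M" and c: "(U, \<phi>) \<in> atlas M" "p \<in> U" and v: "v \<in> model M" and f: "smooth_near M p f"
  shows "smooth_near M p (\<lambda>q. chart_vec M U \<phi> v q f)"
proof -
  obtain W where W: "openin (topo M) W" "p \<in> W" "W \<subseteq> U" "smooth_in (model M) (\<phi> ` W) (f \<circ> inv_into U \<phi>)"
    using smooth_near_chartE[OF M c f] .
  have "smooth_in (model M) (\<phi> ` W) (iter_dderiv [v] (f \<circ> inv_into U \<phi>))"
    using smooth_in_iter_dderiv[OF W(4), of "[v]"] v by simp
  from smooth_near_chart_compose[OF M c this imageI[OF W(2)]]
  have s: "smooth_near M p (\<lambda>q. iter_dderiv [v] (f \<circ> inv_into U \<phi>) (\<phi> q))" .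
  have "\<forall>\<^sub>F q in nhdsin (topo M) p. iter_dderiv [v] (f \<circ> inv_into U \<phi>) (\<phi> q) = chart_vec M U \<phi> v q f"
    using eventually_smooth_near[OF M f] by eventually_elim (simp add: chart_vec_def)
  then show ?thesis by (rule smooth_near_cong[OF M s])
qed

text \<open>Recovers \<open>v\<close> from the derivation it induces. In
  \<open>smooth_extension\<close> this turns injectivity of the tangent map into injectivity of a
  linear map between model spaces.\<close>

lemma chart_vec_coord:
  assumes M: "smooth_manifold M" and c: "(U, \<phi>) \<in> atlas M" "p \<in> U" and v: "v \<in> model M"
  shows "chart_vec M U \<phi> v p (\<lambda>q. \<phi> q \<bullet> b) = v \<bullet> b"
proof -
  have "iter_dderiv [v] ((\<lambda>q. \<phi> q \<bullet> b) \<circ> inv_into U \<phi>) (\<phi> p) = iter_dderiv [v] (\<lambda>x. x \<bullet> b) (\<phi> p)"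
    by (rule iter_dderiv_local[OF model_subspace[OF M] chart_image_openin[OF M c(1)] imageI[OF c(2)] v])
       (use chart_inj_on[OF M c(1)] in auto)
  also have "\<dots> = v \<bullet> b"
    by (auto intro!: vector_derivative_at derivative_eq_intros simp: has_vector_derivative_def inner_add_left)
  finally show ?thesis using smooth_near_coord[OF M c] by (simp add: chart_vec_def)
qed

text \<open>The index ranges over the basis of the ambient space \<open>'e\<close>, not of the model space: the projections of its
  vectors span the model space but need not be independent.\<close>

definition chart_frame :: "('a, 'e::euclidean_space) manifold \<Rightarrow> 'a set \<Rightarrow> ('a \<Rightarrow> 'e) \<Rightarrow> 'e \<Rightarrow> 'a \<Rightarrow> 'a tvec" where
  "chart_frame M U \<phi> b = chart_vec M U \<phi> (subspace_proj (model M) b)"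

lemma chart_frame_tangent:
  "smooth_manifold M \<Longrightarrow> (U, \<phi>) \<in> atlas M \<Longrightarrow> p \<in> U \<Longrightarrow> chart_frame M U \<phi> b p \<in> tangent M p"
  unfolding chart_frame_def by (rule chart_vec_tangent) (simp_all add: subspace_proj model_subspace)

text \<open>Hadamard's lemma writes \<open>f\<close> near \<open>p\<close> as \<open>f(p) + \<Sum>\<^sub>b (x\<^sub>b - x\<^sub>b(p)) g\<^sub>b\<close>.\<close>

lemma tangent_expansion:
  fixes M :: "('a, 'e::euclidean_space) manifold"
  assumes M: "smooth_manifold M" and c: "(U, \<phi>) \<in> atlas M" "p \<in> U" and v: "v \<in> tangent M p"
  shows "v f = (\<Sum>b\<in>Basis. v (\<lambda>q. \<phi> q \<bullet> b) * chart_frame M U \<phi> b p f)"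
proof (cases "smooth_near M p f")
  case True
  note V = model_subspace[OF M]
  have p: "p \<in> pts M" using chart_subset[OF M c(1)] c(2) by blast
  have inv: "inv_into U \<phi> (\<phi> q) = q" if "q \<in> U" for q using chart_inj_on[OF M c(1)] that by simp
  obtain W where W: "openin (topo M) W" "p \<in> W" "W \<subseteq> U" "smooth_in (model M) (\<phi> ` W) (f \<circ> inv_into U \<phi>)"
    using smooth_near_chartE[OF M c True] .
  obtain T g where T: "\<phi> p \<in> T" "T \<subseteq> \<phi> ` W" and g: "\<And>b. smooth_in (model M) T (g b)"
    and eq: "\<And>x. x \<in> T \<Longrightarrow> (f \<circ> inv_into U \<phi>) x = (f \<circ> inv_into U \<phi>) (\<phi> p) + (\<Sum>b\<in>Basis. ((x - \<phi> p) \<bullet> b) * g b x)"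
    and g0: "\<And>b. g b (\<phi> p) = iter_dderiv [subspace_proj (model M) b] (f \<circ> inv_into U \<phi>) (\<phi> p)"
    using smooth_in_hadamard[OF V W(4) imageI[OF W(2)]] by blast
  have co: "smooth_near M p (\<lambda>q. \<phi> q \<bullet> b)" for b by (rule smooth_near_coord[OF M c])
  have gs: "smooth_near M p (\<lambda>q. g b (\<phi> q))" for b by (rule smooth_near_chart_compose[OF M c g T(1)])
  have ds: "smooth_near M p (\<lambda>q. \<phi> q \<bullet> b - \<phi> p \<bullet> b)" for b
    by (rule smooth_near_diff[OF M co smooth_near_const[OF M p]])
  have ps: "smooth_near M p (\<lambda>q. (\<phi> q \<bullet> b - \<phi> p \<bullet> b) * g b (\<phi> q))" for b
    by (rule smooth_near_mult[OF M ds gs])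
  have ev: "\<forall>\<^sub>F q in nhdsin (topo M) p. f q = f p + (\<Sum>b\<in>Basis. (\<phi> q \<bullet> b - \<phi> p \<bullet> b) * g b (\<phi> q))"
    unfolding eventually_nhdsin
  proof (intro disjI2 exI[of _ "{q \<in> U. \<phi> q \<in> T}"] conjI ballI)
    show "openin (topo M) {q \<in> U. \<phi> q \<in> T}"
      by (rule chart_open_preimage[OF M c(1) smooth_in_openin[OF g]])
    show "f q = f p + (\<Sum>b\<in>Basis. (\<phi> q \<bullet> b - \<phi> p \<bullet> b) * g b (\<phi> q))" if "q \<in> {q \<in> U. \<phi> q \<in> T}" for q
      using eq[of "\<phi> q"] that inv c(2) by (simp add: inner_diff_left)
  qed (use c T in auto)
  have "v f = v (\<lambda>q. f p + (\<Sum>b\<in>Basis. (\<phi> q \<bullet> b - \<phi> p \<bullet> b) * g b (\<phi> q)))"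
    by (rule tangent_cong'[OF M v True ev])
  also have "\<dots> = v (\<lambda>q. f p) + v (\<lambda>q. \<Sum>b\<in>Basis. (\<phi> q \<bullet> b - \<phi> p \<bullet> b) * g b (\<phi> q))"
    by (rule tangent_add[OF M v smooth_near_const[OF M p] smooth_near_sum[OF M p ps]])
  also have "\<dots> = (\<Sum>b\<in>Basis. v (\<lambda>q. (\<phi> q \<bullet> b - \<phi> p \<bullet> b) * g b (\<phi> q)))"
    by (simp add: tangent_const[OF M v p] tangent_sum[OF M v p ps])
  also have "\<dots> = (\<Sum>b\<in>Basis. v (\<lambda>q. \<phi> q \<bullet> b) * chart_frame M U \<phi> b p f)"
  proof (rule sum.cong[OF refl])
    fix b :: 'e
    \<comment> \<open>The first factor vanishes at \<open>p\<close>, so only one term of the Leibniz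
      rule survives.\<close>
    have "v (\<lambda>q. (\<phi> q \<bullet> b - \<phi> p \<bullet> b) * g b (\<phi> q)) = v (\<lambda>q. \<phi> q \<bullet> b - \<phi> p \<bullet> b) * g b (\<phi> p)"
      by (simp add: tangent_mult[OF v ds gs])
    also have "\<dots> = v (\<lambda>q. \<phi> q \<bullet> b) * chart_frame M U \<phi> b p f"
      using True by (simp add: tangent_diff[OF M v co smooth_near_const[OF M p]] tangent_const[OF M v p] g0
          chart_frame_def chart_vec_def del: iter_dderiv.simps)
    finally show "v (\<lambda>q. (\<phi> q \<bullet> b - \<phi> p \<bullet> b) * g b (\<phi> q)) = v (\<lambda>q. \<phi> q \<bullet> b) * chart_frame M U \<phi> b p f" .
  qed
  finally show ?thesis .
next
  case False
  then show ?thesis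
    using tangent_not_smooth[OF v] by (simp add: chart_frame_def chart_vec_def)
qed

section \<open>Covectors and differentials of germs\<close>

lemma cotangent_lincomb:
  assumes "\<alpha> \<in> cotangent M p" "u \<in> tangent M p" "v \<in> tangent M p"
  shows "\<alpha> (\<lambda>f. a * u f + b * v f) = a * \<alpha> u + b * \<alpha> v"
  using assms by (simp add: cotangent_def)

lemma cotangent_outside: "\<alpha> \<in> cotangent M p \<Longrightarrow> v \<notin> tangent M p \<Longrightarrow> \<alpha> v = 0"
  by (simp add: cotangent_def)

lemma cotangent_zero: "\<alpha> \<in> cotangent M p \<Longrightarrow> \<alpha> (\<lambda>f. 0) = 0"
  using cotangent_lincomb[OF _ zero_in_tangent zero_in_tangent, of \<alpha> M p 0 0] by simp

lemma cotangent_sum: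
  assumes \<alpha>: "\<alpha> \<in> cotangent M p"
  shows "(\<And>i. i \<in> I \<Longrightarrow> v i \<in> tangent M p) \<Longrightarrow> \<alpha> (\<lambda>f. \<Sum>i\<in>I. c i * v i f) = (\<Sum>i\<in>I. c i * \<alpha> (v i))"
proof (induction I rule: infinite_finite_induct)
  case (insert i I)
  then have "v i \<in> tangent M p" "(\<lambda>f. \<Sum>i\<in>I. c i * v i f) \<in> tangent M p"
    by (simp_all add: tangent_sum_mem)
  from cotangent_lincomb[OF \<alpha> this, of "c i" 1] show ?case using insert by simp
qed (simp_all add: cotangent_zero[OF \<alpha>])

lemma cotangent_subspace:
  assumes "\<alpha> \<in> cotangent M p" "\<beta> \<in> cotangent M p"
  shows "(\<lambda>v. a * \<alpha> v + b * \<beta> v) \<in> cotangent M p"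
  using assms unfolding cotangent_def by (auto simp: algebra_simps)

lemma differential_cotangent:
  assumes "smooth_near M p f"
  shows "differential M p f \<in> cotangent M p"
  by (simp add: cotangent_def differential_def tangent_subspace)

lemma differential_apply: "v \<in> tangent M p \<Longrightarrow> differential M p f v = v f"
  by (simp add: differential_def)

lemma differential_cong:
  assumes "smooth_near M p f" "smooth_near M p g" "\<forall>\<^sub>F q in nhdsin (topo M) p. f q = g q"
  shows "differential M p f = differential M p g"
  using tangent_cong[OF _ assms] by (auto simp: differential_def)

lemma differential_lincomb:
  assumes "smooth_near M p f" "smooth_near M p g"
  shows "differential M p (\<lambda>x. a * f x + b * g x) = (\<lambda>v. a * differential M p f v + b * differential M p g v)"
  by (rule ext) (simp add: differential_def tangent_lincomb[OF _ assms])

lemma cotangent_eqI: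
  assumes "\<alpha> \<in> cotangent M p" "\<beta> \<in> cotangent M p" "\<And>v. v \<in> tangent M p \<Longrightarrow> \<alpha> v = \<beta> v"
  shows "\<alpha> = \<beta>"
proof
  fix v show "\<alpha> v = \<beta> v"
    using assms(3) cotangent_outside[OF assms(1)] cotangent_outside[OF assms(2)]
    by (cases "v \<in> tangent M p") simp_all
qed

lemma cotangent_expansion:
  fixes M :: "('a, 'e::euclidean_space) manifold"
  assumes M: "smooth_manifold M" and c: "(U, \<phi>) \<in> atlas M" "p \<in> U" and \<alpha>: "\<alpha> \<in> cotangent M p"
  shows "\<alpha> = (\<lambda>v. \<Sum>b\<in>Basis. \<alpha> (chart_frame M U \<phi> b p) * differential M p (\<lambda>q. \<phi> q \<bullet> b) v)"
proof
  fix v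
  show "\<alpha> v = (\<Sum>b\<in>Basis. \<alpha> (chart_frame M U \<phi> b p) * differential M p (\<lambda>q. \<phi> q \<bullet> b) v)"
  proof (cases "v \<in> tangent M p")
    case True
    have "v = (\<lambda>f. \<Sum>b\<in>Basis. v (\<lambda>q. \<phi> q \<bullet> b) * chart_frame M U \<phi> b p f)"
      using tangent_expansion[OF M c True] by (rule ext)
    then have "\<alpha> v = \<alpha> (\<lambda>f. \<Sum>b\<in>Basis. v (\<lambda>q. \<phi> q \<bullet> b) * chart_frame M U \<phi> b p f)" by simp
    also have "\<dots> = (\<Sum>b\<in>Basis. v (\<lambda>q. \<phi> q \<bullet> b) * \<alpha> (chart_frame M U \<phi> b p))"
      by (rule cotangent_sum[OF \<alpha> chart_frame_tangent[OF M c]])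
    finally show ?thesis using True by (simp add: differential_apply mult.commute)
  qed (simp add: cotangent_outside[OF \<alpha>] differential_def)
qed

text \<open>The function is a linear combination of the coordinates, its coefficients being the
  values of \<alpha> on the coordinate frame. Consequently identities between multivectors may be
  tested on differentials, where they become identities between derivatives of functions.\<close>

lemma cotangent_eq_differential:
  fixes M :: "('a, 'e::euclidean_space) manifold"
  assumes M: "smooth_manifold M" and p: "p \<in> pts M" and \<alpha>: "\<alpha> \<in> cotangent M p"
  obtains f where "smooth_near M p f" "\<alpha> = differential M p f"
proof -
  obtain U \<phi> where c: "(U, \<phi>) \<in> atlas M" "p \<in> U" using ex_chart[OF M p] .
  define f where "f q = (\<Sum>b\<in>Basis. \<alpha> (chart_frame M U \<phi> b p) * (\<phi> q \<bullet> b))" for q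
  have s: "smooth_near M p (\<lambda>q. \<alpha> (chart_frame M U \<phi> b p) * (\<phi> q \<bullet> b))" for b
    by (intro smooth_near_cmult[OF M] smooth_near_coord[OF M c])
  have f: "smooth_near M p f" unfolding f_def by (rule smooth_near_sum[OF M p s])
  have "\<alpha> = differential M p f"
  proof (rule cotangent_eqI[OF \<alpha> differential_cotangent[OF f]])
    fix v assume v: "v \<in> tangent M p"
    have "v f = (\<Sum>b\<in>Basis. \<alpha> (chart_frame M U \<phi> b p) * v (\<lambda>q. \<phi> q \<bullet> b))"
      unfolding f_def tangent_sum[OF M v p s] tangent_cmult[OF M v smooth_near_coord[OF M c]] ..
    then show "\<alpha> v = differential M p f v"
      using fun_cong[OF cotangent_expansion[OF M c \<alpha>], of v] v by (simp add: differential_apply)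
  qed
  then show ?thesis using that f by blast
qed

section \<open>Vector fields, bivector fields and 2-forms\<close>

lemma vector_field_on_iff:
  assumes M: "smooth_manifold M"
  shows "vector_field_on M W X \<longleftrightarrow> openin (topo M) W \<and>
    (\<forall>p\<in>W. X p \<in> tangent M p \<and> (\<forall>f. smooth_near M p f \<longrightarrow> smooth_near M p (\<lambda>q. X q f)))"
proof
  assume X: "vector_field_on M W X"
  then have W: "openin (topo M) W" by (simp add: vector_field_on_def)
  have "smooth_near M p (\<lambda>q. X q f)" if p: "p \<in> W" and f: "smooth_near M p f" for p f
  proof -
    obtain W0 where W0: "p \<in> W0" "smooth_fun_on M W0 f" using f by (auto simp: smooth_near_def)
    have "openin (topo M) (W \<inter> W0)" using W smooth_fun_on_openin[OF W0(2)] by blast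
    from smooth_fun_on_subset[OF M W0(2) _ this] have "smooth_fun_on M (W \<inter> W0) f" by simp
    moreover have "smooth_fun_on M (W \<inter> W0) f \<longrightarrow> smooth_fun_on M (W \<inter> W0) (\<lambda>q. X q f)"
      using X unfolding vector_field_on_def by simp
    ultimately show ?thesis using p W0(1) by (auto simp: smooth_near_def)
  qed
  then show "openin (topo M) W \<and>
    (\<forall>p\<in>W. X p \<in> tangent M p \<and> (\<forall>f. smooth_near M p f \<longrightarrow> smooth_near M p (\<lambda>q. X q f)))"
    using X by (simp add: vector_field_on_def)
next
  assume X: "openin (topo M) W \<and>
    (\<forall>p\<in>W. X p \<in> tangent M p \<and> (\<forall>f. smooth_near M p f \<longrightarrow> smooth_near M p (\<lambda>q. X q f)))"
  show "vector_field_on M W X"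
    unfolding vector_field_on_def smooth_fun_on_iff_near[OF M] using X by (simp add: subset_iff)
qed

context
  fixes M :: "('a, 'e::euclidean_space) manifold" and W X
  assumes M: "smooth_manifold M" and X: "vector_field_on M W X"
begin

lemma vector_field_on_openin: "openin (topo M) W"
  using X by (simp add: vector_field_on_def)

lemma vector_field_on_tangent: "p \<in> W \<Longrightarrow> X p \<in> tangent M p"
  using X by (simp add: vector_field_on_def)

lemma vector_field_on_smooth: "p \<in> W \<Longrightarrow> smooth_near M p f \<Longrightarrow> smooth_near M p (\<lambda>q. X q f)"
  using X by (simp add: vector_field_on_iff[OF M])

lemma vector_field_on_subset: "openin (topo M) W' \<Longrightarrow> W' \<subseteq> W \<Longrightarrow> vector_field_on M W' X"
  using X by (auto simp: vector_field_on_iff[OF M] subset_iff)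

lemma vector_field_on_eventually: "p \<in> W \<Longrightarrow> \<forall>\<^sub>F q in nhdsin (topo M) p. q \<in> W"
  using vector_field_on_openin by (auto simp: eventually_nhdsin)

end

lemma vector_field_on_lincomb:
  assumes M: "smooth_manifold M" and X: "vector_field_on M W X" and c: "\<And>p. p \<in> W \<Longrightarrow> smooth_near M p c"
  shows "vector_field_on M W (\<lambda>q f. c q * X q f)"
  unfolding vector_field_on_iff[OF M]
proof (intro conjI ballI allI impI)
  show "openin (topo M) W" by (rule vector_field_on_openin[OF M X])
  fix p assume p: "p \<in> W"
  show "(\<lambda>f. c p * X p f) \<in> tangent M p"
    using tangent_subspace[OF vector_field_on_tangent[OF M X p] vector_field_on_tangent[OF M X p], of "c p" 0] by simp
  show "smooth_near M p (\<lambda>q. c q * X q f)" if "smooth_near M p f" for f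
    by (rule smooth_near_mult[OF M c[OF p] vector_field_on_smooth[OF M X p that]])
qed

lemma chart_frame_vector_field:
  assumes M: "smooth_manifold M" and c: "(U, \<phi>) \<in> atlas M"
  shows "vector_field_on M U (chart_frame M U \<phi> b)"
  unfolding vector_field_on_iff[OF M]
  using chart_openin[OF M c] chart_frame_tangent[OF M c]
    chart_vec_smooth[OF M c _ subspace_proj(2)[OF model_subspace[OF M]]]
  unfolding chart_frame_def by blast

lemma lie_bracket_apply: "smooth_near M p f \<Longrightarrow> lie_bracket M X Y p f = X p (\<lambda>q. Y q f) - Y p (\<lambda>q. X q f)"
  by (simp add: lie_bracket_def)

lemma lie_bracket_tangent:
  assumes M: "smooth_manifold M" and X: "vector_field_on M W X" and Y: "vector_field_on M W Y" and p: "p \<in> W"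
  shows "lie_bracket M X Y p \<in> tangent M p"
proof (rule tangentI)
  fix f g assume f: "smooth_near M p f" and g: "smooth_near M p g"
  have evf: "\<forall>\<^sub>F q in nhdsin (topo M) p. smooth_near M q f" and evg: "\<forall>\<^sub>F q in nhdsin (topo M) p. smooth_near M q g"
    using eventually_smooth_near[OF M] f g by auto
  have evW: "\<forall>\<^sub>F q in nhdsin (topo M) p. q \<in> W" by (rule vector_field_on_eventually[OF M X p])
  have lin: "u p (\<lambda>q. w q (\<lambda>x. a * f x + b * g x)) = a * u p (\<lambda>q. w q f) + b * u p (\<lambda>q. w q g)"
    if u: "vector_field_on M W u" and w: "vector_field_on M W w" for u w a b
  proof -
    have "\<forall>\<^sub>F q in nhdsin (topo M) p. a * w q f + b * w q g = w q (\<lambda>x. a * f x + b * g x)"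
      using evf evg evW
      by eventually_elim (simp add: tangent_lincomb[OF vector_field_on_tangent[OF M w]])
    from tangent_cong'[OF M vector_field_on_tangent[OF M u p] _ this]
    show ?thesis
      using tangent_lincomb[OF vector_field_on_tangent[OF M u p]] vector_field_on_smooth[OF M w p] f g
      by (simp add: smooth_near_add[OF M] smooth_near_cmult[OF M])
  qed
  show "lie_bracket M X Y p (\<lambda>x. a * f x + b * g x) = a * lie_bracket M X Y p f + b * lie_bracket M X Y p g" for a b
    using f g by (simp add: lie_bracket_apply lin[OF X Y] lin[OF Y X] smooth_near_add[OF M] smooth_near_cmult[OF M] algebra_simps)
  \<comment> \<open>The two middle terms are exchanged when \<open>u\<close> and \<open>w\<close>
    are swapped, so they cancel in the commutator and a derivation remains.\<close>
  have prod: "u p (\<lambda>q. w q (\<lambda>x. f x * g x)) = u p (\<lambda>q. w q f) * g p + w p f * u p g + u p f * w p g + f p * u p (\<lambda>q. w q g)"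
    if u: "vector_field_on M W u" and w: "vector_field_on M W w" for u w
  proof -
    have ev: "\<forall>\<^sub>F q in nhdsin (topo M) p. w q f * g q + f q * w q g = w q (\<lambda>x. f x * g x)"
      using evf evg evW
      by eventually_elim (simp add: tangent_mult[OF vector_field_on_tangent[OF M w]])
    note t = vector_field_on_tangent[OF M u p]
    have s: "smooth_near M p (\<lambda>q. w q f)" "smooth_near M p (\<lambda>q. w q g)"
      using vector_field_on_smooth[OF M w p] f g by auto
    have s2: "smooth_near M p (\<lambda>q. w q f * g q)" "smooth_near M p (\<lambda>q. f q * w q g)"
      by (rule smooth_near_mult[OF M s(1) g], rule smooth_near_mult[OF M f s(2)])
    from tangent_cong'[OF M t smooth_near_add[OF M s2] ev]
    show ?thesis
      by (simp add: tangent_add[OF M t s2] tangent_mult[OF t s(1) g] tangent_mult[OF t f s(2)])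
  qed
  show "lie_bracket M X Y p (\<lambda>x. f x * g x) = lie_bracket M X Y p f * g p + f p * lie_bracket M X Y p g"
    using f g by (simp add: lie_bracket_apply prod[OF X Y] prod[OF Y X] smooth_near_mult[OF M] algebra_simps)
  assume ev: "\<forall>\<^sub>F q in nhdsin (topo M) p. f q = g q"
  have loc: "u p (\<lambda>q. w q f) = u p (\<lambda>q. w q g)"
    if u: "vector_field_on M W u" and w: "vector_field_on M W w" for u w
  proof -
    obtain A where A: "openin (topo M) A" "p \<in> A" "\<And>q. q \<in> A \<Longrightarrow> f q = g q"
      using ev smooth_near_imp_pts[OF f] by (auto simp: eventually_nhdsin)
    have "\<forall>\<^sub>F q in nhdsin (topo M) p. q \<in> A" using A by (auto simp: eventually_nhdsin)
    then have "\<forall>\<^sub>F q in nhdsin (topo M) p. w q f = w q g"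
      using evf evg evW
    proof eventually_elim
      case (elim q)
      have "\<forall>\<^sub>F q in nhdsin (topo M) q. f q = g q" using A elim(1) by (auto simp: eventually_nhdsin)
      from tangent_cong[OF vector_field_on_tangent[OF M w elim(4)] elim(2,3) this] show ?case .
    qed
    from tangent_cong'[OF M vector_field_on_tangent[OF M u p] vector_field_on_smooth[OF M w p f] this]
    show ?thesis .
  qed
  show "lie_bracket M X Y p f = lie_bracket M X Y p g"
    using f g by (simp add: lie_bracket_apply loc[OF X Y] loc[OF Y X])
qed (simp add: lie_bracket_def)

lemma kvector_field_smooth:
  assumes M: "smooth_manifold M" and P: "kvector_field M 2 P" and f: "smooth_near M p f" and g: "smooth_near M p g"
  shows "smooth_near M p (\<lambda>q. P q [differential M q f, differential M q g])"
proof -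
  obtain A where A: "p \<in> A" "smooth_fun_on M A f" using f by (auto simp: smooth_near_def)
  obtain B where B: "p \<in> B" "smooth_fun_on M B g" using g by (auto simp: smooth_near_def)
  have o: "openin (topo M) (A \<inter> B)" using A B smooth_fun_on_openin by blast
  have "smooth_fun_on M (A \<inter> B) f" "smooth_fun_on M (A \<inter> B) g"
    by (rule smooth_fun_on_subset[OF M A(2) _ o], simp) (rule smooth_fun_on_subset[OF M B(2) _ o], simp)
  moreover have "\<forall>U fs. length fs = 2 \<longrightarrow> openin (topo M) U \<longrightarrow> (\<forall>f\<in>set fs. smooth_fun_on M U f) \<longrightarrow>
        smooth_fun_on M U (\<lambda>p. P p (map (differential M p) fs))"
    using P by (simp add: kvector_field_def)
  from this[rule_format, of "[f, g]" "A \<inter> B"] have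
    "smooth_fun_on M (A \<inter> B) f \<Longrightarrow> smooth_fun_on M (A \<inter> B) g \<Longrightarrow>
      smooth_fun_on M (A \<inter> B) (\<lambda>p. P p [differential M p f, differential M p g])"
    using o by auto
  ultimately show ?thesis using A(1) B(1) by (auto simp: smooth_near_def)
qed

lemma kform_field_smooth:
  assumes M: "smooth_manifold M" and \<omega>: "kform_field M 2 \<omega>"
    and X: "vector_field_on M W X" and Y: "vector_field_on M W Y" and p: "p \<in> W"
  shows "smooth_near M p (\<lambda>q. \<omega> q [X q, Y q])"
proof -
  have "\<forall>U Xs. length Xs = 2 \<longrightarrow> openin (topo M) U \<longrightarrow> (\<forall>X\<in>set Xs. vector_field_on M U X) \<longrightarrow>
        smooth_fun_on M U (\<lambda>p. \<omega> p (map (\<lambda>X. X p) Xs))"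
    using \<omega> by (simp add: kform_field_def)
  from this[rule_format, of "[X, Y]" W] have "smooth_fun_on M W (\<lambda>p. \<omega> p [X p, Y p])"
    using vector_field_on_openin[OF M X] X Y by auto
  then show ?thesis using p by (auto simp: smooth_near_def)
qed

section \<open>Alternating functions of two arguments, for covectors and vectors alike\<close>

context
  fixes T :: "('b \<Rightarrow> real) set" and \<eta>
  assumes closed: "\<And>x y a b. x \<in> T \<Longrightarrow> y \<in> T \<Longrightarrow> (\<lambda>t. a * x t + b * y t) \<in> T"
    and alt: "alternating_on 2 T \<eta>"
begin

lemma alternating2_lincomb1:
  assumes "x \<in> T" "y \<in> T" "z \<in> T"
  shows "\<eta> [\<lambda>t. a * x t + b * y t, z] = a * \<eta> [x, z] + b * \<eta> [y, z]"
proof -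
  have "\<forall>i<2. \<forall>y\<in>T. \<forall>w\<in>T. \<forall>a b.
      \<eta> ([x, z][i := (\<lambda>t. a * y t + b * w t)]) = a * \<eta> ([x, z][i := y]) + b * \<eta> ([x, z][i := w])"
    by (rule conjunct1[OF alt[unfolded alternating_on_def, THEN spec, THEN mp, THEN mp]]) (use assms in simp_all)
  then have "\<forall>y\<in>T. \<forall>w\<in>T. \<forall>a b.
      \<eta> ([x, z][0 := (\<lambda>t. a * y t + b * w t)]) = a * \<eta> ([x, z][0 := y]) + b * \<eta> ([x, z][0 := w])"
    by (rule allE[of _ 0]) simp
  from this[THEN bspec, OF assms(1), THEN bspec, OF assms(2)] show ?thesis by simp
qed

lemma alternating2_lincomb2:
  assumes "x \<in> T" "y \<in> T" "z \<in> T"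
  shows "\<eta> [z, \<lambda>t. a * x t + b * y t] = a * \<eta> [z, x] + b * \<eta> [z, y]"
proof -
  have "\<forall>i<2. \<forall>y\<in>T. \<forall>w\<in>T. \<forall>a b.
      \<eta> ([z, x][i := (\<lambda>t. a * y t + b * w t)]) = a * \<eta> ([z, x][i := y]) + b * \<eta> ([z, x][i := w])"
    by (rule conjunct1[OF alt[unfolded alternating_on_def, THEN spec, THEN mp, THEN mp]]) (use assms in simp_all)
  then have "\<forall>y\<in>T. \<forall>w\<in>T. \<forall>a b.
      \<eta> ([z, x][1 := (\<lambda>t. a * y t + b * w t)]) = a * \<eta> ([z, x][1 := y]) + b * \<eta> ([z, x][1 := w])"
    by (rule allE[of _ 1]) simp
  from this[THEN bspec, OF assms(1), THEN bspec, OF assms(2)] show ?thesis by simp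
qed

lemma alternating2_same: "x \<in> T \<Longrightarrow> \<eta> [x, x] = 0"
proof -
  assume "x \<in> T"
  then have "\<forall>i<2. \<forall>j<2. i \<noteq> j \<longrightarrow> [x, x] ! i = [x, x] ! j \<longrightarrow> \<eta> [x, x] = 0"
    using alt unfolding alternating_on_def by simp
  from this[rule_format, of 0 1] show ?thesis by simp
qed

lemma alternating2_swap:
  assumes "x \<in> T" "y \<in> T"
  shows "\<eta> [y, x] = - \<eta> [x, y]"
proof -
  have s: "(\<lambda>t. 1 * x t + 1 * y t) \<in> T" by (rule closed[OF assms])
  have "0 = \<eta> [\<lambda>t. 1 * x t + 1 * y t, \<lambda>t. 1 * x t + 1 * y t]" by (rule alternating2_same[OF s, symmetric])
  also have "\<dots> = \<eta> [x, \<lambda>t. 1 * x t + 1 * y t] + \<eta> [y, \<lambda>t. 1 * x t + 1 * y t]"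
    using alternating2_lincomb1[OF assms s, of 1 1] by simp
  also have "\<dots> = \<eta> [x, y] + \<eta> [y, x]"
    using alternating2_lincomb2[OF assms assms(1), of 1 1] alternating2_lincomb2[OF assms assms(2), of 1 1]
      alternating2_same[OF assms(1)] alternating2_same[OF assms(2)] by simp
  finally show ?thesis by simp
qed

text \<open>Membership of the sum in \<open>T\<close> is proved along with the formula, because
  \<open>T\<close> is only known to be closed under binary combinations. The empty sum is covered by
  \<open>0 * z t + 0 * z t\<close>.\<close>

lemma alternating2_sum1:
  assumes z: "z \<in> T"
  shows "(\<And>i. i \<in> I \<Longrightarrow> x i \<in> T) \<Longrightarrow>
    (\<lambda>t. \<Sum>i\<in>I. c i * x i t) \<in> T \<and> \<eta> [\<lambda>t. \<Sum>i\<in>I. c i * x i t, z] = (\<Sum>i\<in>I. c i * \<eta> [x i, z])"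
proof (induction I rule: infinite_finite_induct)
  case (insert i I)
  then have x: "x i \<in> T" "(\<lambda>t. \<Sum>i\<in>I. c i * x i t) \<in> T"
    and ih: "\<eta> [\<lambda>t. \<Sum>i\<in>I. c i * x i t, z] = (\<Sum>i\<in>I. c i * \<eta> [x i, z])" by simp_all
  show ?case using insert.hyps closed[OF x, of "c i" 1] alternating2_lincomb1[OF x z, of "c i" 1] ih by simp
qed (use closed[OF z z, of 0 0] alternating2_lincomb1[OF z z z, of 0 0] in simp_all)

lemma alternating2_sum2:
  assumes z: "z \<in> T" and x: "\<And>i. i \<in> I \<Longrightarrow> x i \<in> T"
  shows "\<eta> [z, \<lambda>t. \<Sum>i\<in>I. c i * x i t] = (\<Sum>i\<in>I. c i * \<eta> [z, x i])"
proof -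
  have *: "(\<lambda>t. \<Sum>i\<in>I. c i * x i t) \<in> T \<and> \<eta> [\<lambda>t. \<Sum>i\<in>I. c i * x i t, z] = (\<Sum>i\<in>I. c i * \<eta> [x i, z])"
    by (rule alternating2_sum1[OF z]) (rule x)
  from alternating2_swap[OF conjunct1[OF *] z]
  have "\<eta> [z, \<lambda>t. \<Sum>i\<in>I. c i * x i t] = - (\<Sum>i\<in>I. c i * \<eta> [x i, z])"
    using conjunct2[OF *] by simp
  also have "\<dots> = (\<Sum>i\<in>I. c i * \<eta> [z, x i])"
    using alternating2_swap[OF _ z] x by (simp add: sum_negf)
  finally show ?thesis .
qed

end

section \<open>The Schouten bracket\<close>

lemma wedge_vecs_1: "wedge_vecs [a] [\<alpha>] = \<alpha> a"
proof -
  have "{\<pi>. \<pi> permutes {..<Suc 0}} = {id}"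
    by (simp add: lessThan_Suc permutes_sing)
  then show ?thesis by (simp add: wedge_def vec_to_kvec_def sign_id)
qed

lemma sum_permutes_2:
  fixes F :: "(nat \<Rightarrow> nat) \<Rightarrow> real"
  shows "sum F {\<pi>. \<pi> permutes {..<Suc (Suc 0)}} = F id + F (Transposition.transpose 0 (Suc 0))"
proof -
  have i: "{..<Suc (Suc 0)} = insert 0 {Suc 0}" by auto
  have f: "finite {Suc 0}" "0 \<notin> {Suc 0}" by auto
  show ?thesis
    unfolding i sum_over_permutations_insert[OF f] permutes_sing by simp
qed

lemma wedge_vecs_2: "wedge_vecs [a, b] [\<alpha>, \<beta>] = \<alpha> a * \<beta> b - \<beta> a * \<alpha> b"
  unfolding wedge_vecs.simps(2)[of a] wedge_def[of 1]
  by (simp add: sum_permutes_2 sign_swap_id sign_id wedge_vecs_1[simplified] vec_to_kvec_def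
      del: wedge_vecs.simps) (simp add: wedge_vecs_1 del: wedge_vecs.simps)

text \<open>The six terms arise from writing a permutation of {0, 1, 2} as the identity or a
  transposition moving 0, composed with a permutation of {1, 2}.\<close>

lemma sum_permutes_3:
  fixes F :: "(nat \<Rightarrow> nat) \<Rightarrow> real"
  shows "(\<Sum>\<pi> | \<pi> permutes {..<Suc (Suc (Suc 0))}. of_int (sign \<pi>) * F \<pi>) =
    F id - F (Transposition.transpose 1 2) - F (Transposition.transpose 0 1) + F (Transposition.transpose 0 1 \<circ> Transposition.transpose 1 2)
    - F (Transposition.transpose 0 2) + F (Transposition.transpose 0 2 \<circ> Transposition.transpose 1 2)"
proof -
  have i: "{..<Suc (Suc (Suc 0))} = insert 0 (insert 1 {2})" by auto
  have f: "finite {1, 2::nat}" "0 \<notin> {1, 2::nat}" and f': "finite {2::nat}" "1 \<notin> {2::nat}" by auto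
  show ?thesis
    unfolding i sum_over_permutations_insert[OF f] sum_over_permutations_insert[OF f'] permutes_sing
    by (simp add: sign_compose permutation_swap_id sign_swap_id sign_id)
qed

text \<open>Stated for arbitrary \<open>Q\<close>, so the antisymmetrisation of \<open>Q\<close>
  remains visible; the divisor 2 is \<open>fact 1 * fact 2\<close> from the normalisation of
  \<open>wedge\<close>.\<close>

lemma wedge_vec_2:
  "wedge 1 2 (vec_to_kvec a) Q [\<alpha>, \<beta>, \<gamma>] =
    (\<alpha> a * (Q [\<beta>, \<gamma>] - Q [\<gamma>, \<beta>]) + \<beta> a * (Q [\<gamma>, \<alpha>] - Q [\<alpha>, \<gamma>]) + \<gamma> a * (Q [\<alpha>, \<beta>] - Q [\<beta>, \<alpha>])) / 2"
proof -
  have u: "[0..<1] = [0::nat]" "[1..<1 + 2] = [1, 2::nat]" by (simp_all add: upt_rec)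
  have s: "{..<1 + 2} = {..<Suc (Suc (Suc 0))}" by auto
  show ?thesis
    unfolding wedge_def s u mult.assoc sum_permutes_3
    by (simp add: vec_to_kvec_def Transposition.transpose_def numeral_2_eq_2) (simp add: field_simps)
qed

lemma wedge_vecs_3:
  "wedge_vecs [a, b, c] [\<alpha>, \<beta>, \<gamma>] =
    \<alpha> a * (\<beta> b * \<gamma> c - \<gamma> b * \<beta> c) + \<beta> a * (\<gamma> b * \<alpha> c - \<alpha> b * \<gamma> c) + \<gamma> a * (\<alpha> b * \<beta> c - \<beta> b * \<alpha> c)"
proof -
  have "wedge_vecs [a, b, c] = wedge 1 2 (vec_to_kvec a) (wedge_vecs [b, c])"
    by (simp add: numeral_2_eq_2)
  then show ?thesis
    unfolding wedge_vec_2 wedge_vecs_2 by (simp only: wedge_vec_2 wedge_vecs_2) (simp add: field_simps)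
qed

lemma sum_list_map_eq_sum: "(\<Sum>x\<leftarrow>xs. f x) = (\<Sum>i<length xs. f (xs ! i))"
  by (simp add: sum_list_sum_nth atLeast0LessThan)

lemma list_length_2: "length xs = 2 \<Longrightarrow> xs = [xs ! 0, xs ! 1]"
  by (cases xs; cases "tl xs") auto

lemma list_length_1: "length xs = 1 \<Longrightarrow> xs = [xs ! 0]"
  by (cases xs) auto

section \<open>The Schouten bracket as a combination of iterated brackets of functions\<close>

context
  fixes M :: "('a, 'e::euclidean_space) manifold" and W Xss P
  assumes M: "smooth_manifold M" and dec: "decomposition_on M 2 W Xss P"
begin

lemma decomposition_2_field:
  assumes "i < length Xss"
  shows "vector_field_on M W (Xss ! i ! 0)" "vector_field_on M W (Xss ! i ! 1)"
    "Xss ! i = [Xss ! i ! 0, Xss ! i ! 1]"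
proof -
  have *: "length (Xss ! i) = 2" "\<forall>X\<in>set (Xss ! i). vector_field_on M W X"
    using dec nth_mem[OF assms] unfolding decomposition_on_def by auto
  then show "vector_field_on M W (Xss ! i ! 0)" "vector_field_on M W (Xss ! i ! 1)"
    "Xss ! i = [Xss ! i ! 0, Xss ! i ! 1]"
    using nth_mem[of 0 "Xss ! i"] nth_mem[of 1 "Xss ! i"] list_length_2 by auto
qed

lemma decomposition_2_apply:
  assumes q: "q \<in> W" and f: "smooth_near M q f" and g: "smooth_near M q g"
  shows "P q [differential M q f, differential M q g] =
    (\<Sum>i<length Xss. (Xss ! i ! 0) q f * (Xss ! i ! 1) q g - (Xss ! i ! 0) q g * (Xss ! i ! 1) q f)"
proof -
  have "P q [differential M q f, differential M q g] =
      (\<Sum>Xs\<leftarrow>Xss. wedge_vecs (map (\<lambda>X. X q) Xs) [differential M q f, differential M q g])"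
    using dec q differential_cotangent[OF f] differential_cotangent[OF g] unfolding decomposition_on_def by simp
  also have "\<dots> = (\<Sum>i<length Xss. (Xss ! i ! 0) q f * (Xss ! i ! 1) q g - (Xss ! i ! 0) q g * (Xss ! i ! 1) q f)"
    unfolding sum_list_map_eq_sum
  proof (rule sum.cong[OF refl])
    fix i assume "i \<in> {..<length Xss}"
    then have i: "i < length Xss" by simp
    have t: "(Xss ! i ! 0) q \<in> tangent M q" "(Xss ! i ! 1) q \<in> tangent M q"
      using vector_field_on_tangent[OF M _ q] decomposition_2_field[OF i] by auto
    have "map (\<lambda>X. X q) (Xss ! i) = [(Xss ! i ! 0) q, (Xss ! i ! 1) q]"
      by (subst decomposition_2_field(3)[OF i]) simp
    then show "wedge_vecs (map (\<lambda>X. X q) (Xss ! i)) [differential M q f, differential M q g] =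
        (Xss ! i ! 0) q f * (Xss ! i ! 1) q g - (Xss ! i ! 0) q g * (Xss ! i ! 1) q f"
      using t by (simp only: wedge_vecs_2 differential_apply)
  qed
  finally show ?thesis .
qed

lemma decomposition_2_deriv:
  assumes p: "p \<in> W" and f: "smooth_near M p f" and g: "smooth_near M p g" and v: "v \<in> tangent M p"
  shows "v (\<lambda>q. P q [differential M q f, differential M q g]) =
    (\<Sum>i<length Xss. v (\<lambda>q. (Xss ! i ! 0) q f) * (Xss ! i ! 1) p g + (Xss ! i ! 0) p f * v (\<lambda>q. (Xss ! i ! 1) q g)
      - (v (\<lambda>q. (Xss ! i ! 0) q g) * (Xss ! i ! 1) p f + (Xss ! i ! 0) p g * v (\<lambda>q. (Xss ! i ! 1) q f)))"
    and "smooth_near M p (\<lambda>q. P q [differential M q f, differential M q g])"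
proof -
  have W: "openin (topo M) W" using dec by (simp add: decomposition_on_def)
  then have pM: "p \<in> pts M" using openin_subset p by blast
  have s: "smooth_near M p (\<lambda>q. (Xss ! i ! 0) q f)" "smooth_near M p (\<lambda>q. (Xss ! i ! 1) q f)"
     "smooth_near M p (\<lambda>q. (Xss ! i ! 0) q g)" "smooth_near M p (\<lambda>q. (Xss ! i ! 1) q g)" if "i < length Xss" for i
    using vector_field_on_smooth[OF M decomposition_2_field(1)[OF that] p]
      vector_field_on_smooth[OF M decomposition_2_field(2)[OF that] p] f g by auto
  let ?a = "\<lambda>i q. (Xss ! i ! 0) q f * (Xss ! i ! 1) q g" and ?b = "\<lambda>i q. (Xss ! i ! 0) q g * (Xss ! i ! 1) q f"
  have ab: "smooth_near M p (?a i)" "smooth_near M p (?b i)" if "i < length Xss" for i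
    by (rule smooth_near_mult[OF M s(1)[OF that] s(4)[OF that]], rule smooth_near_mult[OF M s(3)[OF that] s(2)[OF that]])
  have d: "smooth_near M p (\<lambda>q. ?a i q - ?b i q)" if "i \<in> {..<length Xss}" for i
    using smooth_near_diff[OF M ab[of i]] that by simp
  have sum: "smooth_near M p (\<lambda>q. \<Sum>i<length Xss. ?a i q - ?b i q)"
    by (rule smooth_near_sum[OF M pM d])
  have "\<forall>\<^sub>F q in nhdsin (topo M) p. q \<in> W" using W p by (auto simp: eventually_nhdsin)
  then have ev: "\<forall>\<^sub>F q in nhdsin (topo M) p. (\<Sum>i<length Xss. ?a i q - ?b i q) = P q [differential M q f, differential M q g]"
    using eventually_smooth_near[OF M f] eventually_smooth_near[OF M g]
    by eventually_elim (simp only: decomposition_2_apply)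
  show "smooth_near M p (\<lambda>q. P q [differential M q f, differential M q g])"
    by (rule smooth_near_cong[OF M sum ev])
  have "v (\<lambda>q. P q [differential M q f, differential M q g]) = v (\<lambda>q. \<Sum>i<length Xss. ?a i q - ?b i q)"
    by (rule tangent_cong'[OF M v sum ev, symmetric])
  also have "\<dots> = (\<Sum>i<length Xss. v (\<lambda>q. ?a i q - ?b i q))"
    by (rule tangent_sum[OF M v pM d])
  also have "\<dots> = (\<Sum>i<length Xss. v (\<lambda>q. (Xss ! i ! 0) q f) * (Xss ! i ! 1) p g + (Xss ! i ! 0) p f * v (\<lambda>q. (Xss ! i ! 1) q g)
      - (v (\<lambda>q. (Xss ! i ! 0) q g) * (Xss ! i ! 1) p f + (Xss ! i ! 0) p g * v (\<lambda>q. (Xss ! i ! 1) q f)))"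
  proof (rule sum.cong[OF refl])
    fix i assume "i \<in> {..<length Xss}"
    then have i: "i < length Xss" by simp
    show "v (\<lambda>q. ?a i q - ?b i q) = v (\<lambda>q. (Xss ! i ! 0) q f) * (Xss ! i ! 1) p g + (Xss ! i ! 0) p f * v (\<lambda>q. (Xss ! i ! 1) q g)
      - (v (\<lambda>q. (Xss ! i ! 0) q g) * (Xss ! i ! 1) p f + (Xss ! i ! 0) p g * v (\<lambda>q. (Xss ! i ! 1) q f))"
      unfolding tangent_diff[OF M v ab(1)[OF i] ab(2)[OF i]]
        tangent_mult[OF v s(1)[OF i] s(4)[OF i]] tangent_mult[OF v s(3)[OF i] s(2)[OF i]] ..
  qed
  finally show "v (\<lambda>q. P q [differential M q f, differential M q g]) =
    (\<Sum>i<length Xss. v (\<lambda>q. (Xss ! i ! 0) q f) * (Xss ! i ! 1) p g + (Xss ! i ! 0) p f * v (\<lambda>q. (Xss ! i ! 1) q g)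
      - (v (\<lambda>q. (Xss ! i ! 0) q g) * (Xss ! i ! 1) p f + (Xss ! i ! 0) p g * v (\<lambda>q. (Xss ! i ! 1) q f)))" .
qed

end

lemma schouten_decomposable_2_2:
  "schouten_decomposable M [X, X'] [Y, Y'] p \<alpha>s =
    wedge_vecs [lie_bracket M X Y p, X' p, Y' p] \<alpha>s - wedge_vecs [lie_bracket M X Y' p, X' p, Y p] \<alpha>s
    - wedge_vecs [lie_bracket M X' Y p, X p, Y' p] \<alpha>s + wedge_vecs [lie_bracket M X' Y' p, X p, Y p] \<alpha>s"
  by (simp add: schouten_decomposable_def lessThan_Suc nths_Cons del: wedge_vecs.simps)

lemma schouten_decomposable_1_2:
  "schouten_decomposable M [X] [Y, Y'] p \<alpha>s =
    wedge_vecs [lie_bracket M X Y p, Y' p] \<alpha>s - wedge_vecs [lie_bracket M X Y' p, Y p] \<alpha>s"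
  by (simp add: schouten_decomposable_def lessThan_Suc nths_Cons del: wedge_vecs.simps)

text \<open>The almost Poisson bracket of a bivector field, that is, the Jacobi bracket without its
  terms in \<open>E\<close>.\<close>

definition kvec_bracket :: "('a, 'e::euclidean_space) manifold \<Rightarrow> ('a \<Rightarrow> 'a kvec) \<Rightarrow> ('a \<Rightarrow> real) \<Rightarrow> ('a \<Rightarrow> real) \<Rightarrow> 'a \<Rightarrow> real" where
  "kvec_bracket M P f g q = P q [differential M q f, differential M q g]"

text \<open>What the decomposable fields formed from \<open>X\<close>, \<open>X'\<close> and from
  \<open>Y\<close>, \<open>Y'\<close> contribute to the iterated bracket: the outer field is applied
  to \<open>h\<close> and to the function given by the inner field on \<open>f\<close> and
  \<open>g\<close>, and the Leibniz rule is carried out.\<close>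

definition nested_term :: "('a \<Rightarrow> 'a tvec) \<Rightarrow> ('a \<Rightarrow> 'a tvec) \<Rightarrow> ('a \<Rightarrow> 'a tvec) \<Rightarrow> ('a \<Rightarrow> 'a tvec) \<Rightarrow>
    ('a \<Rightarrow> real) \<Rightarrow> ('a \<Rightarrow> real) \<Rightarrow> ('a \<Rightarrow> real) \<Rightarrow> 'a \<Rightarrow> real" where
  "nested_term X X' Y Y' f g h p =
    (X p (\<lambda>q. Y q f) * Y' p g + Y p f * X p (\<lambda>q. Y' q g) - (X p (\<lambda>q. Y q g) * Y' p f + Y p g * X p (\<lambda>q. Y' q f))) * X' p h
    - X p h * (X' p (\<lambda>q. Y q f) * Y' p g + Y p f * X' p (\<lambda>q. Y' q g) - (X' p (\<lambda>q. Y q g) * Y' p f + Y p g * X' p (\<lambda>q. Y' q f)))"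

lemma kvec_bracket_nested:
  assumes M: "smooth_manifold M" and P: "decomposition_on M 2 W Xss P" and Q: "decomposition_on M 2 W Yss Q"
    and p: "p \<in> W" and s: "smooth_near M p f" "smooth_near M p g" "smooth_near M p h"
  shows "kvec_bracket M P (kvec_bracket M Q f g) h p = (\<Sum>i<length Xss. \<Sum>j<length Yss.
    nested_term (Xss ! i ! 0) (Xss ! i ! 1) (Yss ! j ! 0) (Yss ! j ! 1) f g h p)"
proof -
  have u: "smooth_near M p (kvec_bracket M Q f g)"
    using decomposition_2_deriv(2)[OF M Q p s(1,2) zero_in_tangent] by (simp add: kvec_bracket_def[abs_def])
  have "kvec_bracket M P (kvec_bracket M Q f g) h p = (\<Sum>i<length Xss.
      (Xss ! i ! 0) p (kvec_bracket M Q f g) * (Xss ! i ! 1) p h - (Xss ! i ! 0) p h * (Xss ! i ! 1) p (kvec_bracket M Q f g))"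
    using decomposition_2_apply[OF M P p u s(3)] unfolding kvec_bracket_def[of M P] .
  also have "\<dots> = (\<Sum>i<length Xss. \<Sum>j<length Yss.
      nested_term (Xss ! i ! 0) (Xss ! i ! 1) (Yss ! j ! 0) (Yss ! j ! 1) f g h p)"
  proof (rule sum.cong[OF refl])
    fix i assume "i \<in> {..<length Xss}"
    then have i: "i < length Xss" by simp
    note t = decomposition_2_field(1,2)[OF M P i, THEN vector_field_on_tangent[OF M _ p]]
    have d: "v (kvec_bracket M Q f g) = (\<Sum>j<length Yss. v (\<lambda>q. (Yss ! j ! 0) q f) * (Yss ! j ! 1) p g
        + (Yss ! j ! 0) p f * v (\<lambda>q. (Yss ! j ! 1) q g)
        - (v (\<lambda>q. (Yss ! j ! 0) q g) * (Yss ! j ! 1) p f + (Yss ! j ! 0) p g * v (\<lambda>q. (Yss ! j ! 1) q f)))"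
      if "v \<in> tangent M p" for v
      using decomposition_2_deriv(1)[OF M Q p s(1,2) that] unfolding kvec_bracket_def[abs_def] .
    show "(Xss ! i ! 0) p (kvec_bracket M Q f g) * (Xss ! i ! 1) p h - (Xss ! i ! 0) p h * (Xss ! i ! 1) p (kvec_bracket M Q f g) =
        (\<Sum>j<length Yss. nested_term (Xss ! i ! 0) (Xss ! i ! 1) (Yss ! j ! 0) (Yss ! j ! 1) f g h p)"
      unfolding d[OF t(1)] d[OF t(2)] nested_term_def
      by (simp only: sum_distrib_right sum_distrib_left sum_subtractf[symmetric])
  qed
  finally show ?thesis .
qed

text \<open>The right-hand side does not mention the decompositions, so the Schouten bracket is well defined.\<close>

lemma schouten_decomposition_2_2:
  assumes M: "smooth_manifold M" and P: "decomposition_on M 2 W Xss P" and Q: "decomposition_on M 2 W Yss Q"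
    and p: "p \<in> W" and s: "smooth_near M p f" "smooth_near M p g" "smooth_near M p h"
  shows "(\<Sum>Xs\<leftarrow>Xss. \<Sum>Ys\<leftarrow>Yss. schouten_decomposable M Xs Ys p
      [differential M p f, differential M p g, differential M p h]) =
    - (kvec_bracket M P (kvec_bracket M Q f g) h p + kvec_bracket M Q (kvec_bracket M P f g) h p
     + kvec_bracket M P (kvec_bracket M Q g h) f p + kvec_bracket M Q (kvec_bracket M P g h) f p
     + kvec_bracket M P (kvec_bracket M Q h f) g p + kvec_bracket M Q (kvec_bracket M P h f) g p)"
proof -
  define T where "T f g h i j = nested_term (Xss ! i ! 0) (Xss ! i ! 1) (Yss ! j ! 0) (Yss ! j ! 1) f g h p" for f g h i j
  define T' where "T' f g h i j = nested_term (Yss ! j ! 0) (Yss ! j ! 1) (Xss ! i ! 0) (Xss ! i ! 1) f g h p" for f g h i j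
  note PQ = kvec_bracket_nested[OF M P Q p, folded T_def]
  have QP: "kvec_bracket M Q (kvec_bracket M P f g) h p = (\<Sum>i<length Xss. \<Sum>j<length Yss. T' f g h i j)"
    if "smooth_near M p f" "smooth_near M p g" "smooth_near M p h" for f g h
    unfolding kvec_bracket_nested[OF M Q P p that] T'_def by (rule sum.swap)
  show ?thesis
    unfolding PQ[OF s] PQ[OF s(2,3,1)] PQ[OF s(3,1,2)] QP[OF s] QP[OF s(2,3,1)] QP[OF s(3,1,2)]
      sum_list_map_eq_sum sum.distrib[symmetric] sum_negf[symmetric]
  proof (intro sum.cong refl)
    fix i j assume "i \<in> {..<length Xss}" "j \<in> {..<length Yss}"
    then have i: "i < length Xss" and j: "j < length Yss" by auto
    note X = decomposition_2_field(1,2)[OF M P i] and Y = decomposition_2_field(1,2)[OF M Q j]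
    \<comment> \<open>After unfolding, both sides are polynomials in the first and second
      derivatives of \<open>f\<close>, \<open>g\<close>, \<open>h\<close> along the four fields. The
      identity holds with these derivatives treated as indeterminates.\<close>
    show "schouten_decomposable M (Xss ! i) (Yss ! j) p [differential M p f, differential M p g, differential M p h] =
      - (T f g h i j + T' f g h i j + T g h f i j + T' g h f i j + T h f g i j + T' h f g i j)"
      by (subst decomposition_2_field(3)[OF M P i], subst decomposition_2_field(3)[OF M Q j],
          unfold schouten_decomposable_2_2 wedge_vecs_3 T_def T'_def nested_term_def
        differential_apply[OF lie_bracket_tangent[OF M X(1) Y(1) p]] differential_apply[OF lie_bracket_tangent[OF M X(1) Y(2) p]]
        differential_apply[OF lie_bracket_tangent[OF M X(2) Y(1) p]] differential_apply[OF lie_bracket_tangent[OF M X(2) Y(2) p]]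
        differential_apply[OF vector_field_on_tangent[OF M X(1) p]] differential_apply[OF vector_field_on_tangent[OF M X(2) p]]
        differential_apply[OF vector_field_on_tangent[OF M Y(1) p]] differential_apply[OF vector_field_on_tangent[OF M Y(2) p]]
        lie_bracket_apply[OF s(1)] lie_bracket_apply[OF s(2)] lie_bracket_apply[OF s(3)])
         algebra
  qed
qed

text \<open>The right-hand side is the Lie derivative of \<open>Q\<close> along \<open>E\<close>,
  evaluated on \<open>df\<close> and \<open>dg\<close>. The field \<open>E\<close> carries an
  arbitrary decomposition as well, because the description in \<open>schouten\<close> ranges over
  decompositions of both arguments, also in degree one.\<close>

lemma schouten_decomposition_1_2:
  assumes M: "smooth_manifold M" and P: "decomposition_on M 1 W Xss (\<lambda>q. vec_to_kvec (E q))"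
    and Q: "decomposition_on M 2 W Yss Q" and E: "vector_field_on M W E"
    and p: "p \<in> W" and s: "smooth_near M p f" "smooth_near M p g"
  shows "(\<Sum>Xs\<leftarrow>Xss. \<Sum>Ys\<leftarrow>Yss. schouten_decomposable M Xs Ys p [differential M p f, differential M p g]) =
    E p (kvec_bracket M Q f g) - kvec_bracket M Q (\<lambda>q. E q f) g p - kvec_bracket M Q f (\<lambda>q. E q g) p"
proof -
  define X Y Y' where "X i = Xss ! i ! 0" and "Y j = Yss ! j ! 0" and "Y' j = Yss ! j ! 1" for i j
  define m n where "m = length Xss" and "n = length Yss"
  note defs = X_def[symmetric] Y_def[symmetric] Y'_def[symmetric] m_def[symmetric] n_def[symmetric]
  have W: "openin (topo M) W" using Q by (simp add: decomposition_on_def)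
  then have pM: "p \<in> pts M" using openin_subset p by blast
  have evW: "\<forall>\<^sub>F q in nhdsin (topo M) p. q \<in> W" using W p by (auto simp: eventually_nhdsin)
  have X: "vector_field_on M W (X i)" "Xss ! i = [X i]" if "i < m" for i
  proof -
    have *: "length (Xss ! i) = 1" "\<forall>X\<in>set (Xss ! i). vector_field_on M W X"
      using P nth_mem[of i Xss] that unfolding decomposition_on_def m_def by auto
    then show "vector_field_on M W (X i)" "Xss ! i = [X i]"
      using nth_mem[of 0 "Xss ! i"] list_length_1 by (auto simp: X_def)
  qed
  have vY: "vector_field_on M W (Y i)" "vector_field_on M W (Y' i)" if "i < n" for i
    using decomposition_2_field[OF M Q that[unfolded n_def]] by (simp_all add: Y_def Y'_def)
  note tX = X(1)[THEN vector_field_on_tangent[OF M _ p]] and tY = vY[THEN vector_field_on_tangent[OF M _ p]]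
  have EX: "E q u = (\<Sum>i<m. X i q u)" if q: "q \<in> W" and u: "smooth_near M q u" for q u
  proof -
    have "E q u = vec_to_kvec (E q) [differential M q u]"
      using vector_field_on_tangent[OF M E q] by (simp add: vec_to_kvec_def differential_apply)
    also have "\<dots> = (\<Sum>Xs\<leftarrow>Xss. wedge_vecs (map (\<lambda>X. X q) Xs) [differential M q u])"
      using P q differential_cotangent[OF u] unfolding decomposition_on_def by simp
    also have "\<dots> = (\<Sum>i<m. X i q u)"
      unfolding sum_list_map_eq_sum m_def[symmetric]
    proof (rule sum.cong[OF refl])
      fix i assume "i \<in> {..<m}"
      then have i: "i < m" by simp
      show "wedge_vecs (map (\<lambda>X. X q) (Xss ! i)) [differential M q u] = X i q u"
        unfolding X(2)[OF i] list.map wedge_vecs_1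
        by (rule differential_apply[OF vector_field_on_tangent[OF M X(1)[OF i] q]])
    qed
    finally show ?thesis .
  qed
  have sE: "smooth_near M p (\<lambda>q. E q u)" if "smooth_near M p u" for u
    by (rule vector_field_on_smooth[OF M E p that])
  have vE: "v (\<lambda>q. E q u) = (\<Sum>i<m. v (\<lambda>q. X i q u))" if v: "v \<in> tangent M p" and u: "smooth_near M p u" for v u
  proof -
    have "\<forall>\<^sub>F q in nhdsin (topo M) p. E q u = (\<Sum>i<m. X i q u)"
      using evW eventually_smooth_near[OF M u] by eventually_elim (rule EX)
    from tangent_cong'[OF M v sE[OF u] this]
    have "v (\<lambda>q. E q u) = v (\<lambda>q. \<Sum>i<m. X i q u)" .
    also have "\<dots> = (\<Sum>i<m. v (\<lambda>q. X i q u))"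
      by (rule tangent_sum[OF M v pM]) (use vector_field_on_smooth[OF M X(1) p u] in simp)
    finally show ?thesis .
  qed
  have sQ: "smooth_near M p (kvec_bracket M Q f g)"
    using decomposition_2_deriv(2)[OF M Q p s zero_in_tangent] by (simp add: kvec_bracket_def[abs_def])
  have dQ: "v (kvec_bracket M Q f g) = (\<Sum>j<n. v (\<lambda>q. Y j q f) * Y' j p g + Y j p f * v (\<lambda>q. Y' j q g)
      - (v (\<lambda>q. Y j q g) * Y' j p f + Y j p g * v (\<lambda>q. Y' j q f)))" if "v \<in> tangent M p" for v
    using decomposition_2_deriv(1)[OF M Q p s that] unfolding kvec_bracket_def[abs_def] defs .
  have aQ: "kvec_bracket M Q u w p = (\<Sum>j<n. Y j p u * Y' j p w - Y j p w * Y' j p u)"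
    if "smooth_near M p u" "smooth_near M p w" for u w
    using decomposition_2_apply[OF M Q p that] unfolding kvec_bracket_def defs .
  have 1: "E p (kvec_bracket M Q f g) = (\<Sum>i<m. \<Sum>j<n. X i p (\<lambda>q. Y j q f) * Y' j p g + Y j p f * X i p (\<lambda>q. Y' j q g)
      - (X i p (\<lambda>q. Y j q g) * Y' j p f + Y j p g * X i p (\<lambda>q. Y' j q f)))"
    unfolding EX[OF p sQ] by (rule sum.cong[OF refl]) (simp add: dQ[OF tX])
  have 2: "kvec_bracket M Q (\<lambda>q. E q f) g p =
      (\<Sum>i<m. \<Sum>j<n. Y j p (\<lambda>q. X i q f) * Y' j p g - Y j p g * Y' j p (\<lambda>q. X i q f))"
  proof -
    have "kvec_bracket M Q (\<lambda>q. E q f) g p =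
        (\<Sum>j<n. \<Sum>i<m. Y j p (\<lambda>q. X i q f) * Y' j p g - Y j p g * Y' j p (\<lambda>q. X i q f))"
      unfolding aQ[OF sE[OF s(1)] s(2)]
      by (rule sum.cong[OF refl])
         (simp add: vE[OF tY(1) s(1)] vE[OF tY(2) s(1)] sum_distrib_right sum_distrib_left sum_subtractf)
    also have "\<dots> = (\<Sum>i<m. \<Sum>j<n. Y j p (\<lambda>q. X i q f) * Y' j p g - Y j p g * Y' j p (\<lambda>q. X i q f))"
      by (rule sum.swap)
    finally show ?thesis .
  qed
  have 3: "kvec_bracket M Q f (\<lambda>q. E q g) p =
      (\<Sum>i<m. \<Sum>j<n. Y j p f * Y' j p (\<lambda>q. X i q g) - Y j p (\<lambda>q. X i q g) * Y' j p f)"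
  proof -
    have "kvec_bracket M Q f (\<lambda>q. E q g) p =
        (\<Sum>j<n. \<Sum>i<m. Y j p f * Y' j p (\<lambda>q. X i q g) - Y j p (\<lambda>q. X i q g) * Y' j p f)"
      unfolding aQ[OF s(1) sE[OF s(2)]]
      by (rule sum.cong[OF refl])
         (simp add: vE[OF tY(1) s(2)] vE[OF tY(2) s(2)] sum_distrib_right sum_distrib_left sum_subtractf)
    also have "\<dots> = (\<Sum>i<m. \<Sum>j<n. Y j p f * Y' j p (\<lambda>q. X i q g) - Y j p (\<lambda>q. X i q g) * Y' j p f)"
      by (rule sum.swap)
    finally show ?thesis .
  qed
  show ?thesis
    unfolding 1 2 3 sum_list_map_eq_sum m_def[symmetric] n_def[symmetric] sum_subtractf[symmetric]
  proof (intro sum.cong refl)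
    fix i j assume "i \<in> {..<m}" "j \<in> {..<n}"
    then have i: "i < m" and j: "j < n" by auto
    have Yj: "Yss ! j = [Y j, Y' j]"
      using decomposition_2_field(3)[OF M Q j[unfolded n_def]] by (simp add: Y_def Y'_def)
    show "schouten_decomposable M (Xss ! i) (Yss ! j) p [differential M p f, differential M p g] =
        X i p (\<lambda>q. Y j q f) * Y' j p g + Y j p f * X i p (\<lambda>q. Y' j q g)
        - (X i p (\<lambda>q. Y j q g) * Y' j p f + Y j p g * X i p (\<lambda>q. Y' j q f))
        - (Y j p (\<lambda>q. X i q f) * Y' j p g - Y j p g * Y' j p (\<lambda>q. X i q f))
        - (Y j p f * Y' j p (\<lambda>q. X i q g) - Y j p (\<lambda>q. X i q g) * Y' j p f)"
      unfolding X(2)[OF i] Yj schouten_decomposable_1_2 wedge_vecs_2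
        differential_apply[OF lie_bracket_tangent[OF M X(1)[OF i] vY(1)[OF j] p]]
        differential_apply[OF lie_bracket_tangent[OF M X(1)[OF i] vY(2)[OF j] p]]
        differential_apply[OF tX[OF i]]
        differential_apply[OF tY(1)[OF j]] differential_apply[OF tY(2)[OF j]]
        lie_bracket_apply[OF s(1)] lie_bracket_apply[OF s(2)]
      by algebra
  qed
qed

section \<open>Existence of local decompositions, and the value of the Schouten bracket\<close>

lemma decomposition_on_subset:
  assumes "smooth_manifold M" "decomposition_on M k W Xss P" "openin (topo M) W'" "W' \<subseteq> W"
  shows "decomposition_on M k W' Xss P"
  using assms vector_field_on_subset[OF assms(1) _ assms(3,4)] unfolding decomposition_on_def by blast

text \<open>In a chart, \<open>P\<close> is half the sum over all \<open>b\<close> and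
  \<open>c\<close> of \<open>P(dx\<^sub>b, dx\<^sub>c)\<close> times the wedge of the coordinate
  fields; the half accounts for both orders of a pair, and each coefficient is absorbed in the first
  field. The coordinate fields need only span. Without such a decomposition the description in
  \<open>schouten\<close> would not determine a value.\<close>

lemma kvector_field_decomposition:
  fixes M :: "('a, 'e::euclidean_space) manifold"
  assumes M: "smooth_manifold M" and P: "kvector_field M 2 P" and p: "p \<in> pts M"
  obtains W Xss where "p \<in> W" "decomposition_on M 2 W Xss P"
proof -
  obtain U \<phi> where c: "(U, \<phi>) \<in> atlas M" "p \<in> U" using ex_chart[OF M p] .
  obtain bs :: "'e list" where bs: "set bs = Basis" "distinct bs"
    using finite_distinct_list[OF finite_Basis] by blast
  define dx where "dx b q = differential M q (\<lambda>x. \<phi> x \<bullet> b)" for b q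
  define F where "F b = chart_frame M U \<phi> b" for b
  define X where "X b c q f = (P q [dx b q, dx c q] / 2) * F b q f" for b c q f
  define Xss where "Xss = map (\<lambda>(b, c). [X b c, F c]) (List.product bs bs)"
  have co: "smooth_near M q (\<lambda>x. \<phi> x \<bullet> b)" if "q \<in> U" for q b
    by (rule smooth_near_coord[OF M c(1) that])
  have dx: "dx b q \<in> cotangent M q" if "q \<in> U" for q b
    unfolding dx_def by (rule differential_cotangent[OF co[OF that]])
  have F: "vector_field_on M U (F b)" for b
    unfolding F_def by (rule chart_frame_vector_field[OF M c(1)])
  have X: "vector_field_on M U (X b c)" for b c
    unfolding X_def[abs_def]
  proof (rule vector_field_on_lincomb[OF M F])
    fix q assume "q \<in> U"
    then have "smooth_near M q (\<lambda>q. (1/2) * P q [dx b q, dx c q])"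
      unfolding dx_def by (intro smooth_near_cmult[OF M] kvector_field_smooth[OF M P] co)
    then show "smooth_near M q (\<lambda>q. P q [dx b q, dx c q] / 2)" by simp
  qed
  have "decomposition_on M 2 U Xss P"
    unfolding decomposition_on_def
  proof (intro conjI ballI allI impI)
    show "openin (topo M) U" by (rule chart_openin[OF M c(1)])
    show "length Xs = 2" if "Xs \<in> set Xss" for Xs using that by (auto simp: Xss_def)
    show "vector_field_on M U Y" if "Xs \<in> set Xss" "Y \<in> set Xs" for Xs Y
      using that F X by (auto simp: Xss_def)
    fix q \<alpha>s assume q: "q \<in> U" and l: "length (\<alpha>s :: 'a covec list) = 2" and sub: "set \<alpha>s \<subseteq> cotangent M q"
    define \<alpha> \<beta> where "\<alpha> = \<alpha>s ! 0" and "\<beta> = \<alpha>s ! 1"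
    have \<alpha>s: "\<alpha>s = [\<alpha>, \<beta>]" using list_length_2[OF l] by (simp add: \<alpha>_def \<beta>_def)
    have \<alpha>: "\<alpha> \<in> cotangent M q" and \<beta>: "\<beta> \<in> cotangent M q" using sub \<alpha>s by auto
    note Fq = vector_field_on_tangent[OF M F q]
    have alt: "alternating_on 2 (cotangent M q) (P q)"
      using P chart_subset[OF M c(1)] q unfolding kvector_field_def by blast
    note cl = cotangent_subspace[of _ M q]
    define a where "a b = \<alpha> (F b q)" for b
    define a' where "a' b = \<beta> (F b q)" for b
    define R where "R b c = P q [dx b q, dx c q]" for b c
    have swap: "R c b = - R b c" for b c
      unfolding R_def by (rule alternating2_swap[OF cl alt dx[OF q] dx[OF q]])
    have "\<alpha> = (\<lambda>v. \<Sum>b\<in>Basis. a b * dx b q v)" "\<beta> = (\<lambda>v. \<Sum>b\<in>Basis. a' b * dx b q v)"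
      unfolding a_def a'_def dx_def F_def by (rule cotangent_expansion[OF M c(1) q \<alpha>], rule cotangent_expansion[OF M c(1) q \<beta>])
    then have "P q \<alpha>s = P q [\<lambda>v. \<Sum>b\<in>Basis. a b * dx b q v, \<beta>]" using \<alpha>s by simp
    also have "\<dots> = (\<Sum>b\<in>Basis. a b * P q [dx b q, \<beta>])"
      by (rule conjunct2[OF alternating2_sum1[OF cl alt \<beta> dx[OF q]]])
    also have "\<dots> = (\<Sum>b\<in>Basis. \<Sum>c\<in>Basis. a b * (a' c * R b c))"
    proof (rule sum.cong[OF refl])
      fix b :: 'e
      have "P q [dx b q, \<beta>] = P q [dx b q, \<lambda>v. \<Sum>c\<in>Basis. a' c * dx c q v]"
        using \<open>\<beta> = (\<lambda>v. \<Sum>b\<in>Basis. a' b * dx b q v)\<close> by simp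
      also have "\<dots> = (\<Sum>c\<in>Basis. a' c * R b c)"
        unfolding R_def by (rule alternating2_sum2[OF cl alt dx[OF q] dx[OF q]])
      finally show "a b * P q [dx b q, \<beta>] = (\<Sum>c\<in>Basis. a b * (a' c * R b c))" by (simp add: sum_distrib_left)
    qed
    finally have 1: "P q \<alpha>s = (\<Sum>b\<in>Basis. \<Sum>c\<in>Basis. a b * (a' c * R b c))" .
    have w: "wedge_vecs (map (\<lambda>Y. Y q) [X b c, F c]) \<alpha>s = (a b * a' c * R b c - a' b * a c * R b c) / 2" for b c
    proof -
      have *: "\<gamma> (X b c q) = R b c / 2 * \<gamma> (F b q)" if "\<gamma> \<in> cotangent M q" for \<gamma>
        using cotangent_lincomb[OF that Fq Fq, of "R b c / 2" b 0 b] by (simp add: X_def[abs_def] R_def)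
      show ?thesis
        unfolding \<alpha>s list.map wedge_vecs_2 *[OF \<alpha>] *[OF \<beta>] a_def a'_def by (simp add: field_simps)
    qed
    have "(\<Sum>Xs\<leftarrow>Xss. wedge_vecs (map (\<lambda>X. X q) Xs) \<alpha>s) =
        (\<Sum>bc\<leftarrow>List.product bs bs. (a (fst bc) * a' (snd bc) * R (fst bc) (snd bc) - a' (fst bc) * a (snd bc) * R (fst bc) (snd bc)) / 2)"
      unfolding Xss_def map_map o_def split_beta w ..
    also have "\<dots> = (\<Sum>bc\<in>Basis \<times> Basis. (a (fst bc) * a' (snd bc) * R (fst bc) (snd bc) - a' (fst bc) * a (snd bc) * R (fst bc) (snd bc)) / 2)"
      using bs by (simp add: sum_list_distinct_conv_sum_set distinct_product)
    also have "\<dots> = (\<Sum>b\<in>Basis. \<Sum>c\<in>Basis. (a b * a' c * R b c - a' b * a c * R b c) / 2)"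
      by (simp add: sum.cartesian_product split_beta)
    also have "\<dots> = ((\<Sum>b\<in>Basis. \<Sum>c\<in>Basis. a b * a' c * R b c) - (\<Sum>b\<in>Basis. \<Sum>c\<in>Basis. a' b * a c * R b c)) / 2"
      by (simp only: sum_subtractf sum_divide_distrib[symmetric])
    \<comment> \<open>Exchanging \<open>b\<close> and \<open>c\<close> and using the antisymmetry of
      \<open>R\<close> shows that the second double sum is the negative of the first, so the
      difference is twice the first and the divisor 2 disappears.\<close>
    also have "(\<Sum>b\<in>Basis. \<Sum>c\<in>Basis. a' b * a c * R b c) = (\<Sum>c\<in>Basis. \<Sum>b\<in>Basis. a' b * a c * R b c)"
      by (rule sum.swap)
    also have "\<dots> = - (\<Sum>b\<in>Basis. \<Sum>c\<in>Basis. a b * a' c * R b c)"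
      unfolding sum_negf[symmetric]
    proof (intro sum.cong refl)
      show "a' c * a b * R c b = - (a b * a' c * R b c)" for b c using swap[of c b] by simp
    qed
    finally show "P q \<alpha>s = (\<Sum>Xs\<leftarrow>Xss. wedge_vecs (map (\<lambda>X. X q) Xs) \<alpha>s)"
      using 1 by (simp add: mult.assoc)
  qed
  then show ?thesis using that c(2) by blast
qed

text \<open>The formula over decompositions shows that this value is admissible in the definite
  description, and a common domain of decomposition shows that it is the only one. For
  \<open>P = Q\<close> it is minus twice the Jacobiator of \<open>kvec_bracket\<close>.\<close>

lemma schouten_2_2:
  assumes M: "smooth_manifold M" and P: "kvector_field M 2 P" and Q: "kvector_field M 2 Q"
    and s: "smooth_near M p f" "smooth_near M p g" "smooth_near M p h"
  shows "schouten M 2 2 P Q p [differential M p f, differential M p g, differential M p h] =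
    - (kvec_bracket M P (kvec_bracket M Q f g) h p + kvec_bracket M Q (kvec_bracket M P f g) h p
     + kvec_bracket M P (kvec_bracket M Q g h) f p + kvec_bracket M Q (kvec_bracket M P g h) f p
     + kvec_bracket M P (kvec_bracket M Q h f) g p + kvec_bracket M Q (kvec_bracket M P h f) g p)"
  unfolding schouten_def
proof (rule the_equality)
  have p: "p \<in> pts M" using smooth_near_imp_pts[OF s(1)] .
  obtain W1 Xss where 1: "p \<in> W1" "decomposition_on M 2 W1 Xss P" using kvector_field_decomposition[OF M P p] .
  obtain W2 Yss where 2: "p \<in> W2" "decomposition_on M 2 W2 Yss Q" using kvector_field_decomposition[OF M Q p] .
  have o: "openin (topo M) (W1 \<inter> W2)" using 1(2) 2(2) by (auto simp: decomposition_on_def)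
  have d: "p \<in> W1 \<inter> W2" "decomposition_on M 2 (W1 \<inter> W2) Xss P" "decomposition_on M 2 (W1 \<inter> W2) Yss Q"
    using 1 2 decomposition_on_subset[OF M 1(2) o] decomposition_on_subset[OF M 2(2) o] by auto
  fix r
  assume "\<forall>W Xss Yss. p \<in> W \<longrightarrow> decomposition_on M 2 W Xss P \<longrightarrow> decomposition_on M 2 W Yss Q \<longrightarrow>
    r = (\<Sum>Xs\<leftarrow>Xss. \<Sum>Ys\<leftarrow>Yss. schouten_decomposable M Xs Ys p [differential M p f, differential M p g, differential M p h])"
  from this[rule_format, OF d] schouten_decomposition_2_2[OF M d(2,3,1) s]
  show "r = - (kvec_bracket M P (kvec_bracket M Q f g) h p + kvec_bracket M Q (kvec_bracket M P f g) h p
     + kvec_bracket M P (kvec_bracket M Q g h) f p + kvec_bracket M Q (kvec_bracket M P g h) f p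
     + kvec_bracket M P (kvec_bracket M Q h f) g p + kvec_bracket M Q (kvec_bracket M P h f) g p)" by (rule trans)
qed (use schouten_decomposition_2_2[OF M _ _ _ s] in auto)

lemma schouten_1_2:
  assumes M: "smooth_manifold M" and E: "vector_field_on M (pts M) E" and Q: "kvector_field M 2 Q"
    and s: "smooth_near M p f" "smooth_near M p g"
  shows "schouten M 1 2 (\<lambda>q. vec_to_kvec (E q)) Q p [differential M p f, differential M p g] =
    E p (kvec_bracket M Q f g) - kvec_bracket M Q (\<lambda>q. E q f) g p - kvec_bracket M Q f (\<lambda>q. E q g) p"
  unfolding schouten_def
proof (rule the_equality)
  have p: "p \<in> pts M" using smooth_near_imp_pts[OF s(1)] .
  obtain W Yss where 2: "p \<in> W" "decomposition_on M 2 W Yss Q" using kvector_field_decomposition[OF M Q p] .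
  have W: "openin (topo M) W" using 2(2) by (simp add: decomposition_on_def)
  have EW: "vector_field_on M W E" by (rule vector_field_on_subset[OF M E W openin_subset[OF W]])
  have 1: "decomposition_on M 1 W [[E]] (\<lambda>q. vec_to_kvec (E q))"
    unfolding decomposition_on_def
  proof (intro conjI ballI allI impI)
    fix q \<alpha>s assume "length (\<alpha>s :: 'a covec list) = 1"
    then obtain \<alpha> where "\<alpha>s = [\<alpha>]" using list_length_1 by blast
    then show "vec_to_kvec (E q) \<alpha>s = (\<Sum>Xs\<leftarrow>[[E]]. wedge_vecs (map (\<lambda>X. X q) Xs) \<alpha>s)"
      by (simp add: vec_to_kvec_def wedge_vecs_1 del: wedge_vecs.simps)
  qed (use W EW in auto)
  fix r
  assume "\<forall>W Xss Yss. p \<in> W \<longrightarrow> decomposition_on M 1 W Xss (\<lambda>q. vec_to_kvec (E q)) \<longrightarrow> decomposition_on M 2 W Yss Q \<longrightarrow>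
    r = (\<Sum>Xs\<leftarrow>Xss. \<Sum>Ys\<leftarrow>Yss. schouten_decomposable M Xs Ys p [differential M p f, differential M p g])"
  from this[rule_format, OF 2(1) 1 2(2)] schouten_decomposition_1_2[OF M 1 2(2) EW 2(1) s]
  show "r = E p (kvec_bracket M Q f g) - kvec_bracket M Q (\<lambda>q. E q f) g p - kvec_bracket M Q f (\<lambda>q. E q g) p"
    by (rule trans)
next
  show "\<forall>W Xss Yss. p \<in> W \<longrightarrow> decomposition_on M 1 W Xss (\<lambda>q. vec_to_kvec (E q)) \<longrightarrow> decomposition_on M 2 W Yss Q \<longrightarrow>
    E p (kvec_bracket M Q f g) - kvec_bracket M Q (\<lambda>q. E q f) g p - kvec_bracket M Q f (\<lambda>q. E q g) p =
    (\<Sum>Xs\<leftarrow>Xss. \<Sum>Ys\<leftarrow>Yss. schouten_decomposable M Xs Ys p [differential M p f, differential M p g])"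
  proof (intro allI impI)
    fix W Xss Yss
    assume W: "p \<in> W" and 1: "decomposition_on M 1 W Xss (\<lambda>q. vec_to_kvec (E q))" and 2: "decomposition_on M 2 W Yss Q"
    have o: "openin (topo M) W" using 2 by (simp add: decomposition_on_def)
    have EW: "vector_field_on M W E" by (rule vector_field_on_subset[OF M E o openin_subset[OF o]])
    show "E p (kvec_bracket M Q f g) - kvec_bracket M Q (\<lambda>q. E q f) g p - kvec_bracket M Q f (\<lambda>q. E q g) p =
    (\<Sum>Xs\<leftarrow>Xss. \<Sum>Ys\<leftarrow>Yss. schouten_decomposable M Xs Ys p [differential M p f, differential M p g])"
      by (rule schouten_decomposition_1_2[OF M 1 2 EW W s, symmetric])
  qed
qed

section \<open>The exterior derivative and the map \<open>\<Lambda>\<^sup>#\<close>\<close>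

context
  fixes M :: "('a, 'e::euclidean_space) manifold" and \<omega>
  assumes M: "smooth_manifold M" and \<omega>: "kform_field M 2 \<omega>"
begin

lemma kform_field_alternating: "p \<in> pts M \<Longrightarrow> alternating_on 2 (tangent M p) (\<omega> p)"
  using \<omega> by (simp add: kform_field_def)

text \<open>Tensoriality in \<open>X\<close> of the part of the invariant formula for \<open>d\<omega>\<close> that differentiates \<open>X\<close>.\<close>

lemma lie_term_expansion:
  assumes X: "vector_field_on M W X" and Y: "vector_field_on M W Y" and Z: "vector_field_on M W Z" and p: "p \<in> W"
    and c: "(U, \<phi>) \<in> atlas M" "p \<in> U"
  shows "Y p (\<lambda>q. \<omega> q [X q, Z q]) + \<omega> p [lie_bracket M X Y p, Z p] =
    (\<Sum>b\<in>Basis. X p (\<lambda>q. \<phi> q \<bullet> b) * (Y p (\<lambda>q. \<omega> q [chart_frame M U \<phi> b q, Z q])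
       + \<omega> p [lie_bracket M (chart_frame M U \<phi> b) Y p, Z p]))"
proof -
  define F where "F b = chart_frame M U \<phi> b" for b
  define x where "x b q = \<phi> q \<bullet> b" for b q
  define V where "V = W \<inter> U"
  have o: "openin (topo M) V"
    using vector_field_on_openin[OF M X] chart_openin[OF M c(1)] by (auto simp: V_def)
  have pV: "p \<in> V" using p c(2) by (simp add: V_def)
  then have pM: "p \<in> pts M" using openin_subset[OF o] by blast
  have evV: "\<forall>\<^sub>F q in nhdsin (topo M) p. q \<in> V" using o pV by (auto simp: eventually_nhdsin)
  have XV: "vector_field_on M V X" and YV: "vector_field_on M V Y" and ZV: "vector_field_on M V Z"
    using X Y Z vector_field_on_subset[OF M _ o] by (auto simp: V_def)
  have F: "vector_field_on M V (F b)" for b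
    using vector_field_on_subset[OF M chart_frame_vector_field[OF M c(1)] o] by (auto simp: V_def F_def)
  note tY = vector_field_on_tangent[OF M YV pV] and tF = vector_field_on_tangent[OF M F]
    and tZ = vector_field_on_tangent[OF M ZV] and tX = vector_field_on_tangent[OF M XV]
  have x: "smooth_near M p (x b)" for b
    using smooth_near_coord[OF M c] by (simp add: x_def[abs_def])
  have Xx: "smooth_near M p (\<lambda>q. X q (x b))" for b
    by (rule vector_field_on_smooth[OF M XV pV x])
  have Xexp: "X q = (\<lambda>f. \<Sum>b\<in>Basis. X q (x b) * F b q f)" if "q \<in> V" for q
    using tangent_expansion[OF M c(1) _ tX[OF that]] that unfolding x_def F_def V_def by blast
  have oFZ: "smooth_near M p (\<lambda>q. \<omega> q [F b q, Z q])" for b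
    by (rule kform_field_smooth[OF M \<omega> F ZV pV])
  \<comment> \<open>Here \<open>X\<close> is expanded in the coordinate frame with coefficients
    \<open>X q (x b)\<close>. The terms in which \<open>Y\<close> differentiates these coefficients
    occur with a plus sign in this sum and with a minus sign in the contribution of the Lie bracket,
    and cancel at the end.\<close>
  have d1: "Y p (\<lambda>q. \<omega> q [X q, Z q]) =
      (\<Sum>b\<in>Basis. Y p (\<lambda>q. X q (x b)) * \<omega> p [F b p, Z p] + X p (x b) * Y p (\<lambda>q. \<omega> q [F b q, Z q]))"
  proof -
    have "\<forall>\<^sub>F q in nhdsin (topo M) p. \<omega> q [X q, Z q] = (\<Sum>b\<in>Basis. X q (x b) * \<omega> q [F b q, Z q])"
      using evV
    proof eventually_elim
      case (elim q)
      have qM: "q \<in> pts M" using elim openin_subset[OF o] by blast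
      have "\<omega> q [X q, Z q] = \<omega> q [\<lambda>f. \<Sum>b\<in>Basis. X q (x b) * F b q f, Z q]" using Xexp[OF elim] by simp
      also have "\<dots> = (\<Sum>b\<in>Basis. X q (x b) * \<omega> q [F b q, Z q])"
        by (rule conjunct2[OF alternating2_sum1[OF tangent_subspace[of _ M q] kform_field_alternating[OF qM] tZ[OF elim] tF[OF elim]]])
      finally show ?case .
    qed
    from tangent_cong'[OF M tY kform_field_smooth[OF M \<omega> XV ZV pV] this]
    have "Y p (\<lambda>q. \<omega> q [X q, Z q]) = Y p (\<lambda>q. \<Sum>b\<in>Basis. X q (x b) * \<omega> q [F b q, Z q])" .
    also have "\<dots> = (\<Sum>b\<in>Basis. Y p (\<lambda>q. X q (x b) * \<omega> q [F b q, Z q]))"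
      by (rule tangent_sum[OF M tY pM smooth_near_mult[OF M Xx oFZ]])
    also have "\<dots> = (\<Sum>b\<in>Basis. Y p (\<lambda>q. X q (x b)) * \<omega> p [F b p, Z p] + X p (x b) * Y p (\<lambda>q. \<omega> q [F b q, Z q]))"
      unfolding tangent_mult[OF tY Xx oFZ] ..
    finally show ?thesis .
  qed
  have lie: "lie_bracket M X Y p = (\<lambda>f. 1 * (\<Sum>b\<in>Basis. X p (x b) * lie_bracket M (F b) Y p f)
      + (-1) * (\<Sum>b\<in>Basis. Y p (\<lambda>q. X q (x b)) * F b p f))"
  proof
    fix f
    show "lie_bracket M X Y p f = 1 * (\<Sum>b\<in>Basis. X p (x b) * lie_bracket M (F b) Y p f)
      + (-1) * (\<Sum>b\<in>Basis. Y p (\<lambda>q. X q (x b)) * F b p f)"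
    proof (cases "smooth_near M p f")
      case True
      have Ff: "smooth_near M p (\<lambda>q. F b q f)" for b by (rule vector_field_on_smooth[OF M F pV True])
      have "\<forall>\<^sub>F q in nhdsin (topo M) p. X q f = (\<Sum>b\<in>Basis. X q (x b) * F b q f)"
        using evV by eventually_elim (rule fun_cong[OF Xexp])
      from tangent_cong'[OF M tY vector_field_on_smooth[OF M XV pV True] this]
      have "Y p (\<lambda>q. X q f) = Y p (\<lambda>q. \<Sum>b\<in>Basis. X q (x b) * F b q f)" .
      also have "\<dots> = (\<Sum>b\<in>Basis. Y p (\<lambda>q. X q (x b) * F b q f))"
        by (rule tangent_sum[OF M tY pM smooth_near_mult[OF M Xx Ff]])
      also have "\<dots> = (\<Sum>b\<in>Basis. Y p (\<lambda>q. X q (x b)) * F b p f + X p (x b) * Y p (\<lambda>q. F b q f))"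
        unfolding tangent_mult[OF tY Xx Ff] ..
      finally have "Y p (\<lambda>q. X q f) = \<dots>" .
      moreover have "X p (\<lambda>q. Y q f) = (\<Sum>b\<in>Basis. X p (x b) * F b p (\<lambda>q. Y q f))"
        by (rule fun_cong[OF Xexp[OF pV]])
      ultimately show ?thesis
        unfolding lie_bracket_apply[OF True] by (simp add: algebra_simps sum.distrib sum_subtractf)
    next
      case False
      then show ?thesis using tangent_not_smooth[OF tF[OF pV] False] by (simp add: lie_bracket_def)
    qed
  qed
  have d2: "\<omega> p [lie_bracket M X Y p, Z p] =
      (\<Sum>b\<in>Basis. X p (x b) * \<omega> p [lie_bracket M (F b) Y p, Z p]) - (\<Sum>b\<in>Basis. Y p (\<lambda>q. X q (x b)) * \<omega> p [F b p, Z p])"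
  proof -
    note cl = tangent_subspace[of _ M p] and alt = kform_field_alternating[OF pM]
    note tl = lie_bracket_tangent[OF M F YV pV]
    have a: "(\<lambda>f. \<Sum>b\<in>Basis. X p (x b) * lie_bracket M (F b) Y p f) \<in> tangent M p \<and>
       \<omega> p [\<lambda>f. \<Sum>b\<in>Basis. X p (x b) * lie_bracket M (F b) Y p f, Z p] = (\<Sum>b\<in>Basis. X p (x b) * \<omega> p [lie_bracket M (F b) Y p, Z p])"
      by (rule alternating2_sum1[OF cl alt tZ[OF pV] tl])
    have b: "(\<lambda>f. \<Sum>b\<in>Basis. Y p (\<lambda>q. X q (x b)) * F b p f) \<in> tangent M p \<and>
       \<omega> p [\<lambda>f. \<Sum>b\<in>Basis. Y p (\<lambda>q. X q (x b)) * F b p f, Z p] = (\<Sum>b\<in>Basis. Y p (\<lambda>q. X q (x b)) * \<omega> p [F b p, Z p])"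
      by (rule alternating2_sum1[OF cl alt tZ[OF pV] tF[OF pV]])
    have "\<omega> p [lie_bracket M X Y p, Z p] = 1 * \<omega> p [\<lambda>f. \<Sum>b\<in>Basis. X p (x b) * lie_bracket M (F b) Y p f, Z p]
        + (-1) * \<omega> p [\<lambda>f. \<Sum>b\<in>Basis. Y p (\<lambda>q. X q (x b)) * F b p f, Z p]"
      unfolding lie by (rule alternating2_lincomb1[OF cl alt conjunct1[OF a] conjunct1[OF b] tZ[OF pV]])
    then show ?thesis unfolding conjunct2[OF a] conjunct2[OF b] by simp
  qed
  have xb: "(\<lambda>q. \<phi> q \<bullet> b) = x b" for b by (simp add: x_def[abs_def])
  show ?thesis
    unfolding d1 d2 F_def[symmetric] xb
    by (simp add: sum.distrib distrib_left)
qed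

text \<open>The invariant formula for a particular choice of three fields, before it is known to
  depend only on their values at \<open>p\<close>.\<close>

definition ext_deriv_at :: "('a \<Rightarrow> 'a tvec) \<Rightarrow> ('a \<Rightarrow> 'a tvec) \<Rightarrow> ('a \<Rightarrow> 'a tvec) \<Rightarrow> 'a \<Rightarrow> real" where
  "ext_deriv_at X Y Z p = X p (\<lambda>q. \<omega> q [Y q, Z q]) - Y p (\<lambda>q. \<omega> q [X q, Z q]) + Z p (\<lambda>q. \<omega> q [X q, Y q])
    - \<omega> p [lie_bracket M X Y p, Z p] + \<omega> p [lie_bracket M X Z p, Y p] - \<omega> p [lie_bracket M Y Z p, X p]"

text \<open>The four terms that involve derivatives of \<open>X\<close> group into two pairs of the
  form treated in \<open>lie_term_expansion\<close>, which see only \<open>X p\<close>; the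
  remaining two terms contain \<open>X p\<close> directly.\<close>

lemma ext_deriv_at_cong1:
  assumes "vector_field_on M W X" "vector_field_on M W X'" "vector_field_on M W Y" "vector_field_on M W Z"
    and p: "p \<in> W" and eq: "X p = X' p"
  shows "ext_deriv_at X Y Z p = ext_deriv_at X' Y Z p"
proof -
  have pM: "p \<in> pts M" using vector_field_on_openin[OF M assms(1)] openin_subset p by blast
  obtain U \<phi> where c: "(U, \<phi>) \<in> atlas M" "p \<in> U" using ex_chart[OF M pM] .
  have 1: "Y p (\<lambda>q. \<omega> q [X q, Z q]) + \<omega> p [lie_bracket M X Y p, Z p] =
      Y p (\<lambda>q. \<omega> q [X' q, Z q]) + \<omega> p [lie_bracket M X' Y p, Z p]"
    unfolding lie_term_expansion[OF assms(1,3,4) p c] lie_term_expansion[OF assms(2,3,4) p c] eq ..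
  have 2: "Z p (\<lambda>q. \<omega> q [X q, Y q]) + \<omega> p [lie_bracket M X Z p, Y p] =
      Z p (\<lambda>q. \<omega> q [X' q, Y q]) + \<omega> p [lie_bracket M X' Z p, Y p]"
    unfolding lie_term_expansion[OF assms(1,4,3) p c] lie_term_expansion[OF assms(2,4,3) p c] eq ..
  show ?thesis unfolding ext_deriv_at_def eq using 1 2 by simp
qed

lemma lie_bracket_swap: "lie_bracket M Y X p = (\<lambda>f. 0 * lie_bracket M X Y p f + (-1) * lie_bracket M X Y p f)"
  by (rule ext) (simp add: lie_bracket_def)

lemma
  assumes "vector_field_on M W X" "vector_field_on M W Y" "vector_field_on M W Z" and p: "p \<in> W"
  shows ext_deriv_at_swap12: "ext_deriv_at Y X Z p = - ext_deriv_at X Y Z p"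
    and ext_deriv_at_swap23: "ext_deriv_at X Z Y p = - ext_deriv_at X Y Z p"
proof -
  have o: "openin (topo M) W" by (rule vector_field_on_openin[OF M assms(1)])
  have WM: "W \<subseteq> pts M" using openin_subset[OF o] .
  have ev: "\<forall>\<^sub>F q in nhdsin (topo M) p. q \<in> W" using o p by (auto simp: eventually_nhdsin)
  have sw: "\<omega> q [B q, A q] = - \<omega> q [A q, B q]" if "vector_field_on M W A" "vector_field_on M W B" "q \<in> W" for A B q
    using alternating2_swap[OF tangent_subspace[of _ M q] kform_field_alternating
        vector_field_on_tangent[OF M that(1)] vector_field_on_tangent[OF M that(2)]] that(3) WM by blast
  have d: "C p (\<lambda>q. \<omega> q [B q, A q]) = - C p (\<lambda>q. \<omega> q [A q, B q])"
    if A: "vector_field_on M W A" and B: "vector_field_on M W B" and C: "vector_field_on M W C" for A B C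
  proof -
    note t = vector_field_on_tangent[OF M C p] and s = kform_field_smooth[OF M \<omega> A B p]
    have "\<forall>\<^sub>F q in nhdsin (topo M) p. \<omega> q [B q, A q] = (-1) * \<omega> q [A q, B q]"
      using ev by eventually_elim (simp add: sw[OF A B])
    from tangent_cong'[OF M t kform_field_smooth[OF M \<omega> B A p] this] show ?thesis
      by (simp only: tangent_cmult[OF M t s])
  qed
  have l: "\<omega> p [lie_bracket M B A p, C p] = - \<omega> p [lie_bracket M A B p, C p]"
    if A: "vector_field_on M W A" and B: "vector_field_on M W B" and C: "vector_field_on M W C" for A B C
  proof -
    have pM: "p \<in> pts M" using p WM by blast
    note t = lie_bracket_tangent[OF M A B p]
    have "\<omega> p [lie_bracket M B A p, C p] = 0 * \<omega> p [lie_bracket M A B p, C p] + (-1) * \<omega> p [lie_bracket M A B p, C p]"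
      unfolding lie_bracket_swap[of B A]
      by (rule alternating2_lincomb1[OF tangent_subspace[of _ M p] kform_field_alternating[OF pM] t t
          vector_field_on_tangent[OF M C p]])
    then show ?thesis by simp
  qed
  note XYZ = assms(1-3)
  show "ext_deriv_at Y X Z p = - ext_deriv_at X Y Z p"
    unfolding ext_deriv_at_def d[OF XYZ(1,2,3)] l[OF XYZ(1,2,3)] by simp
  show "ext_deriv_at X Z Y p = - ext_deriv_at X Y Z p"
    unfolding ext_deriv_at_def d[OF XYZ(2,3,1)] l[OF XYZ(2,3,1)] by simp
qed

text \<open>Dependence on the value at \<open>p\<close> is known in the first argument;
  transpositions bring the other two arguments into that place one after the other.\<close>

lemma ext_deriv_at_cong:
  assumes "vector_field_on M W X" "vector_field_on M W Y" "vector_field_on M W Z"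
    and "vector_field_on M W X'" "vector_field_on M W Y'" "vector_field_on M W Z'"
    and p: "p \<in> W" and eq: "X p = X' p" "Y p = Y' p" "Z p = Z' p"
  shows "ext_deriv_at X Y Z p = ext_deriv_at X' Y' Z' p"
proof -
  have "ext_deriv_at X Y Z p = ext_deriv_at X' Y Z p"
    by (rule ext_deriv_at_cong1[OF assms(1,4,2,3) p eq(1)])
  also have "\<dots> = - ext_deriv_at Y X' Z p"
    using ext_deriv_at_swap12[OF assms(4,2,3) p] by simp
  also have "\<dots> = - ext_deriv_at Y' X' Z p"
    using ext_deriv_at_cong1[OF assms(2,5,4,3) p eq(2)] by simp
  also have "\<dots> = ext_deriv_at Y' Z X' p"
    using ext_deriv_at_swap23[OF assms(5,4,3) p] by simp
  also have "\<dots> = - ext_deriv_at Z Y' X' p"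
    using ext_deriv_at_swap12[OF assms(5,3,4) p] by simp
  also have "\<dots> = - ext_deriv_at Z' Y' X' p"
    using ext_deriv_at_cong1[OF assms(3,6,5,4) p eq(3)] by simp
  also have "\<dots> = ext_deriv_at Z' X' Y' p"
    using ext_deriv_at_swap23[OF assms(6,5,4) p] by simp
  also have "\<dots> = - ext_deriv_at X' Z' Y' p"
    using ext_deriv_at_swap12[OF assms(6,4,5) p] by simp
  also have "\<dots> = ext_deriv_at X' Y' Z' p"
    using ext_deriv_at_swap23[OF assms(4,5,6) p] by simp
  finally show ?thesis .
qed

lemma ext_deriv_at_formula:
  "(\<Sum>i<length [X, Y, Z]. (-1) ^ i *
      ([X, Y, Z] ! i) p (\<lambda>q. \<omega> q (map (\<lambda>X. X q) (nths [X, Y, Z] (- {i}))))) +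
   (\<Sum>j<length [X, Y, Z]. \<Sum>i<j. (-1) ^ (i + j) *
      \<omega> p (lie_bracket M ([X, Y, Z] ! i) ([X, Y, Z] ! j) p # map (\<lambda>X. X p) (nths [X, Y, Z] (- {i, j})))) =
   ext_deriv_at X Y Z p"
  by (simp add: ext_deriv_at_def lessThan_Suc nths_Cons)

text \<open>The given fields are themselves an admissible extension of their values, which forces
  the value. Any other extension is compared with them on the intersection of the two
  domains.\<close>

lemma ext_deriv_eq:
  assumes "vector_field_on M W X" "vector_field_on M W Y" "vector_field_on M W Z" and p: "p \<in> W"
  shows "ext_deriv M \<omega> p [X p, Y p, Z p] = ext_deriv_at X Y Z p"
  unfolding ext_deriv_def
proof (rule the_equality)
  show "\<forall>W' Xs. p \<in> W' \<longrightarrow> (\<forall>X\<in>set Xs. vector_field_on M W' X) \<longrightarrow> map (\<lambda>X. X p) Xs = [X p, Y p, Z p] \<longrightarrow>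
     ext_deriv_at X Y Z p = (\<Sum>i<length Xs. (-1) ^ i *
            (Xs ! i) p (\<lambda>q. \<omega> q (map (\<lambda>X. X q) (nths Xs (- {i}))))) +
         (\<Sum>j<length Xs. \<Sum>i<j. (-1) ^ (i + j) *
            \<omega> p (lie_bracket M (Xs ! i) (Xs ! j) p # map (\<lambda>X. X p) (nths Xs (- {i, j}))))"
  proof (intro allI impI)
    fix W' Xs
    assume W': "p \<in> W'" and f: "\<forall>X\<in>set Xs. vector_field_on M W' X" and m: "map (\<lambda>X. X p) Xs = [X p, Y p, Z p]"
    from m obtain A B C where Xs: "Xs = [A, B, C]" and eq: "X p = A p" "Y p = B p" "Z p = C p"
      by (auto simp: map_eq_Cons_conv)
    have A: "vector_field_on M W' A" "vector_field_on M W' B" "vector_field_on M W' C" using f Xs by auto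
    have o: "openin (topo M) (W \<inter> W')"
      using vector_field_on_openin[OF M assms(1)] vector_field_on_openin[OF M A(1)] by blast
    have pW: "p \<in> W \<inter> W'" using p W' by blast
    have 1: "vector_field_on M (W \<inter> W') V" if "vector_field_on M W V" for V
      by (rule vector_field_on_subset[OF M that o]) auto
    have 2: "vector_field_on M (W \<inter> W') V" if "vector_field_on M W' V" for V
      by (rule vector_field_on_subset[OF M that o]) auto
    show "ext_deriv_at X Y Z p = (\<Sum>i<length Xs. (-1) ^ i *
            (Xs ! i) p (\<lambda>q. \<omega> q (map (\<lambda>X. X q) (nths Xs (- {i}))))) +
         (\<Sum>j<length Xs. \<Sum>i<j. (-1) ^ (i + j) *
            \<omega> p (lie_bracket M (Xs ! i) (Xs ! j) p # map (\<lambda>X. X p) (nths Xs (- {i, j}))))"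
      unfolding Xs ext_deriv_at_formula
      by (rule ext_deriv_at_cong[OF 1[OF assms(1)] 1[OF assms(2)] 1[OF assms(3)] 2[OF A(1)] 2[OF A(2)] 2[OF A(3)] pW eq])
  qed
next
  fix r
  assume "\<forall>W' Xs. p \<in> W' \<longrightarrow> (\<forall>X\<in>set Xs. vector_field_on M W' X) \<longrightarrow> map (\<lambda>X. X p) Xs = [X p, Y p, Z p] \<longrightarrow>
     r = (\<Sum>i<length Xs. (-1) ^ i *
            (Xs ! i) p (\<lambda>q. \<omega> q (map (\<lambda>X. X q) (nths Xs (- {i}))))) +
         (\<Sum>j<length Xs. \<Sum>i<j. (-1) ^ (i + j) *
            \<omega> p (lie_bracket M (Xs ! i) (Xs ! j) p # map (\<lambda>X. X p) (nths Xs (- {i, j}))))"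
  from this[THEN spec, THEN spec, THEN mp, THEN mp, THEN mp, OF p, of "[X, Y, Z]", unfolded ext_deriv_at_formula]
  show "r = ext_deriv_at X Y Z p" using assms by simp
qed

end

section \<open>The map \<open>\<Lambda>\<^sup>#\<close> and Hamiltonian vector fields\<close>

context
  fixes M :: "('a, 'e::euclidean_space) manifold" and \<Lambda>
  assumes M: "smooth_manifold M" and \<Lambda>: "kvector_field M 2 \<Lambda>"
begin

lemma kvector_field_alternating: "p \<in> pts M \<Longrightarrow> alternating_on 2 (cotangent M p) (\<Lambda> p)"
  using \<Lambda> by (simp add: kvector_field_def)

text \<open>The vector sends \<open>f\<close> to
  \<open>\<Lambda> p [\<alpha>, differential M p f]\<close>. It is a derivation because \<Lambda> is
  linear in its second argument and the differential obeys the Leibniz rule, and it is unique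
  because differentials separate tangent vectors.\<close>

lemma
  assumes p: "p \<in> pts M" and \<alpha>: "\<alpha> \<in> cotangent M p"
  shows sharp_tangent: "sharp M \<Lambda> p \<alpha> \<in> tangent M p"
    and sharp_pairing: "\<beta> \<in> cotangent M p \<Longrightarrow> \<beta> (sharp M \<Lambda> p \<alpha>) = \<Lambda> p [\<alpha>, \<beta>]"
    and sharp_apply: "smooth_near M p f \<Longrightarrow> sharp M \<Lambda> p \<alpha> f = \<Lambda> p [\<alpha>, differential M p f]"
proof -
  define v where "v f = (if smooth_near M p f then \<Lambda> p [\<alpha>, differential M p f] else 0)" for f
  have lin: "\<Lambda> p [\<alpha>, \<lambda>u. a * \<beta> u + b * \<gamma> u] = a * \<Lambda> p [\<alpha>, \<beta>] + b * \<Lambda> p [\<alpha>, \<gamma>]"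
    if "\<beta> \<in> cotangent M p" "\<gamma> \<in> cotangent M p" for a b \<beta> \<gamma>
    by (rule alternating2_lincomb2[OF cotangent_subspace[of _ M p] kvector_field_alternating[OF p] that \<alpha>])
  have v: "v \<in> tangent M p"
  proof (rule tangentI)
    fix f g assume fg: "smooth_near M p f" "smooth_near M p g"
    note dc = differential_cotangent[OF fg(1)] differential_cotangent[OF fg(2)]
    show "v (\<lambda>x. a * f x + b * g x) = a * v f + b * v g" for a b
      using lin[OF dc] fg by (simp add: v_def differential_lincomb smooth_near_add[OF M] smooth_near_cmult[OF M])
    show "v (\<lambda>x. f x * g x) = v f * g p + f p * v g"
    proof -
      have "differential M p (\<lambda>x. f x * g x) = (\<lambda>u. g p * differential M p f u + f p * differential M p g u)"
        by (rule ext) (simp add: differential_def tangent_mult[OF _ fg])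
      then show ?thesis
        using lin[OF dc] fg by (simp add: v_def smooth_near_mult[OF M])
    qed
    assume "\<forall>\<^sub>F q in nhdsin (topo M) p. f q = g q"
    then show "v f = v g" using differential_cong[OF fg] fg by (simp add: v_def)
  qed (simp add: v_def)
  have pair: "\<beta> v = \<Lambda> p [\<alpha>, \<beta>]" if \<beta>: "\<beta> \<in> cotangent M p" for \<beta>
  proof -
    obtain f where f: "smooth_near M p f" "\<beta> = differential M p f" using cotangent_eq_differential[OF M p \<beta>] .
    have "\<beta> v = v f" unfolding f(2) by (rule differential_apply[OF v])
    then show ?thesis using f by (simp add: v_def)
  qed
  have eq: "sharp M \<Lambda> p \<alpha> = v"
    unfolding sharp_def
  proof (rule the_equality)
    fix u assume u: "u \<in> tangent M p \<and> (\<forall>\<beta>\<in>cotangent M p. \<beta> u = \<Lambda> p [\<alpha>, \<beta>])"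
    show "u = v"
    proof
      fix f show "u f = v f"
      proof (cases "smooth_near M p f")
        case True
        have "u f = differential M p f u" using u by (simp add: differential_apply)
        also have "\<dots> = v f" using u differential_cotangent[OF True] True by (simp add: v_def)
        finally show ?thesis .
      next
        case False
        then show ?thesis using u tangent_not_smooth[of u M p f] by (simp add: v_def)
      qed
    qed
  qed (use v pair in blast)
  show "sharp M \<Lambda> p \<alpha> \<in> tangent M p" using v eq by simp
  show "\<beta> (sharp M \<Lambda> p \<alpha>) = \<Lambda> p [\<alpha>, \<beta>]" if "\<beta> \<in> cotangent M p" using pair[OF that] eq by simp
  show "sharp M \<Lambda> p \<alpha> f = \<Lambda> p [\<alpha>, differential M p f]" if "smooth_near M p f" using that eq by (simp add: v_def)
qed

text \<open>These fields extend the values of \<open>\<Lambda>\<^sup>#\<close> at a point to a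
  neighbourhood. They are the extensions through which the exterior derivative in the structure
  equations is evaluated.\<close>

lemma hamiltonian_vector_field:
  assumes W: "openin (topo M) W" and f: "\<And>q. q \<in> W \<Longrightarrow> smooth_near M q f"
  shows "vector_field_on M W (\<lambda>q. sharp M \<Lambda> q (differential M q f))"
  unfolding vector_field_on_iff[OF M]
proof (intro conjI ballI allI impI W)
  fix p assume p: "p \<in> W"
  then have pM: "p \<in> pts M" using openin_subset[OF W] by blast
  show "sharp M \<Lambda> p (differential M p f) \<in> tangent M p"
    by (rule sharp_tangent[OF pM differential_cotangent[OF f[OF p]]])
  fix g assume g: "smooth_near M p g"
  have "\<forall>\<^sub>F q in nhdsin (topo M) p. \<Lambda> q [differential M q f, differential M q g] = sharp M \<Lambda> q (differential M q f) g"
    using eventually_smooth_near[OF M f[OF p]] eventually_smooth_near[OF M g]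
    by eventually_elim (simp add: sharp_apply[OF smooth_near_imp_pts differential_cotangent])
  from smooth_near_cong[OF M kvector_field_smooth[OF M \<Lambda> f[OF p] g] this]
  show "smooth_near M p (\<lambda>q. sharp M \<Lambda> q (differential M q f) g)" .
qed

end

section \<open>Immersed submanifolds\<close>

lemma eventually_eventually_nhdsin:
  "eventually P (nhdsin X p) \<Longrightarrow> \<forall>\<^sub>F q in nhdsin X p. eventually P (nhdsin X q)"
  unfolding eventually_nhdsin by blast

locale immersed =
  fixes M S :: "('a, 'e::euclidean_space) manifold"
  assumes M: "smooth_manifold M" and imm: "immersed_submanifold M S"
begin

lemma S: "smooth_manifold S"
  and pts_sub: "p \<in> pts S \<Longrightarrow> p \<in> pts M"
  and smooth_map_id: "smooth_map S M id"
  and tangent_map_inj_on: "p \<in> pts S \<Longrightarrow> inj_on (tangent_map M id p) (tangent S p)"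
  using imm by (auto simp: immersed_submanifold_def)

lemma restrict_openin: "openin (topo M) W \<Longrightarrow> openin (topo S) (W \<inter> pts S)"
proof -
  assume W: "openin (topo M) W"
  have "continuous_map (topo S) (topo M) id" using smooth_map_id by (simp add: smooth_map_def)
  from openin_continuous_map_preimage[OF this W] show ?thesis by (simp add: Int_def conj_commute)
qed

lemma eventually_restrict:
  assumes "p \<in> pts S" "eventually P (nhdsin (topo M) p)"
  shows "eventually P (nhdsin (topo S) p)"
proof -
  obtain W where W: "openin (topo M) W" "p \<in> W" "\<And>q. q \<in> W \<Longrightarrow> P q"
    using assms pts_sub by (auto simp: eventually_nhdsin)
  then show ?thesis using restrict_openin[OF W(1)] assms(1) by (auto simp: eventually_nhdsin)
qed

lemma inclusion_smooth_in:
  assumes "(V, \<psi>) \<in> atlas S" "(U, \<phi>) \<in> atlas M"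
  shows "smooth_in (model S) (\<psi> ` (V \<inter> U)) (\<phi> \<circ> inv_into V \<psi>)"
proof -
  have "{x \<in> V. x \<in> U} = V \<inter> U" by auto
  then show ?thesis using smooth_map_id assms unfolding smooth_map_def by fastforce
qed

lemma smooth_near_restrict:
  assumes p: "p \<in> pts S" and f: "smooth_near M p f"
  shows "smooth_near S p f"
proof -
  obtain U \<phi> where c: "(U, \<phi>) \<in> atlas M" "p \<in> U" using ex_chart[OF M pts_sub[OF p]] .
  obtain V \<psi> where c': "(V, \<psi>) \<in> atlas S" "p \<in> V" using ex_chart[OF S p] .
  obtain W where W: "openin (topo M) W" "p \<in> W" "W \<subseteq> U" "smooth_in (model M) (\<phi> ` W) (f \<circ> inv_into U \<phi>)"
    using smooth_near_chartE[OF M c f] .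
  define N where "N = V \<inter> (W \<inter> pts S)"
  have N: "openin (topo S) N" "p \<in> N" "N \<subseteq> V"
    using chart_openin[OF S c'(1)] restrict_openin[OF W(1)] c' W p by (auto simp: N_def)
  have o: "openin (top_of_set (model S)) (\<psi> ` N)" by (rule chart_open_image[OF S c'(1) N(1,3)])
  note V = model_subspace[OF S] and inj = chart_inj_on[OF S c'(1)]
  have "smooth_in (model S) (\<psi> ` N) (\<phi> \<circ> inv_into V \<psi>)"
    by (rule smooth_in_subset[OF V inclusion_smooth_in[OF c'(1) c(1)] _ o]) (use W(3) in \<open>auto simp: N_def\<close>)
  then have "smooth_in (model S) (\<psi> ` N) ((f \<circ> inv_into U \<phi>) \<circ> (\<phi> \<circ> inv_into V \<psi>))"
    by (rule smooth_in_compose[OF V model_subspace[OF M] _ W(4)]) (use inj in \<open>auto simp: N_def\<close>)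
  then have "smooth_in (model S) (\<psi> ` N) (f \<circ> inv_into V \<psi>)"
    by (rule smooth_in_cong[OF V]) (use inj chart_inj_on[OF M c(1)] W(3) in \<open>auto simp: N_def subset_iff\<close>)
  then show ?thesis by (rule smooth_near_chartI[OF S c'(1) N])
qed

text \<open>The differential of the inclusion. Points of \<open>S\<close> and \<open>M\<close> have
  the same type, so it merely restricts a derivation on \<open>S\<close> to the functions that are
  smooth on \<open>M\<close> near \<open>p\<close>, with value 0 on all others.\<close>

abbreviation push :: "'a \<Rightarrow> 'a tvec \<Rightarrow> 'a tvec" where
  "push \<equiv> tangent_map M id"

lemma push_apply: "smooth_near M p f \<Longrightarrow> push p v f = v f"
  by (simp add: tangent_map_def)

lemma push_tangent:
  assumes p: "p \<in> pts S" and v: "v \<in> tangent S p"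
  shows "push p v \<in> tangent M p"
proof (rule tangentI)
  fix f g assume fg: "smooth_near M p f" "smooth_near M p g"
  note fg' = smooth_near_restrict[OF p fg(1)] smooth_near_restrict[OF p fg(2)]
  show "push p v (\<lambda>x. a * f x + b * g x) = a * push p v f + b * push p v g" for a b
    using fg by (simp add: push_apply smooth_near_add[OF M] smooth_near_cmult[OF M] tangent_lincomb[OF v fg'])
  show "push p v (\<lambda>x. f x * g x) = push p v f * g p + f p * push p v g"
    using fg by (simp add: push_apply smooth_near_mult[OF M] tangent_mult[OF v fg'])
  assume "\<forall>\<^sub>F q in nhdsin (topo M) p. f q = g q"
  from tangent_cong[OF v fg' eventually_restrict[OF p this]]
  show "push p v f = push p v g" using fg by (simp add: push_apply)
qed (simp add: tangent_map_def)

lemma push_lincomb: "push p (\<lambda>f. a * u f + b * v f) = (\<lambda>f. a * push p u f + b * push p v f)"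
  by (rule ext) (simp add: tangent_map_def)

text \<open>Near a point of \<open>S\<close>, the inclusion is \<open>F : T \<rightarrow> model M\<close> with injective derivative \<open>f'\<close>.  For a linear left inverse
  \<open>L\<close> of \<open>f'\<close> on the model space of \<open>S\<close>, the map \<open>G x = L (F (P x)) + x - L (f' x)\<close> has the identity as derivative and
  coincides with \<open>L \<circ> F\<close> on \<open>T\<close>; its local inverse \<open>g\<close> gives the smooth retraction \<open>P \<circ> g \<circ> L\<close>.\<close>

lemma smooth_extension:
  assumes p: "p \<in> pts S" and u: "smooth_near S p u"
  obtains f where "smooth_near M p f" "\<forall>\<^sub>F q in nhdsin (topo S) p. f q = u q"
proof -
  obtain U \<phi> where c: "(U, \<phi>) \<in> atlas M" "p \<in> U" using ex_chart[OF M pts_sub[OF p]] .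
  obtain V \<psi> where c': "(V, \<psi>) \<in> atlas S" "p \<in> V" using ex_chart[OF S p] .
  note VM = model_subspace[OF M] and VS = model_subspace[OF S] and inj = chart_inj_on[OF S c'(1)]
  obtain Wu where Wu: "openin (topo S) Wu" "p \<in> Wu" "Wu \<subseteq> V" "smooth_in (model S) (\<psi> ` Wu) (u \<circ> inv_into V \<psi>)"
    using smooth_near_chartE[OF S c' u] .
  define N where "N = Wu \<inter> (U \<inter> pts S)"
  have N: "openin (topo S) N" "p \<in> N" "N \<subseteq> V" "N \<subseteq> U"
    using restrict_openin[OF chart_openin[OF M c(1)]] Wu c p by (auto simp: N_def)
  define T where "T = \<psi> ` N"
  have oT: "openin (top_of_set (model S)) T" unfolding T_def by (rule chart_open_image[OF S c'(1) N(1,3)])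
  have TS: "T \<subseteq> model S" using openin_imp_subset[OF oT] .
  define F where "F = \<phi> \<circ> inv_into V \<psi>"
  have F\<psi>: "F (\<psi> q) = \<phi> q" if "q \<in> V" for q using inj that by (simp add: F_def)
  have F: "smooth_in (model S) T F" unfolding F_def
    by (rule smooth_in_subset[OF VS inclusion_smooth_in[OF c'(1) c(1)] _ oT]) (use N in \<open>auto simp: T_def\<close>)
  have uT: "smooth_in (model S) T (u \<circ> inv_into V \<psi>)"
    by (rule smooth_in_subset[OF VS Wu(4) _ oT]) (auto simp: T_def N_def)
  define x0 where "x0 = \<psi> p"
  have x0: "x0 \<in> T" using N(2) by (simp add: x0_def T_def)
  define P where "P = subspace_proj (model S)"
  note P = subspace_proj[OF VS, folded P_def]
  obtain f' where f': "linear f'" "\<And>v. v \<in> model S \<Longrightarrow> iter_dderiv [v] F x0 = f' v" "((F \<circ> P) has_derivative f') (at x0)"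
    using smooth_in_has_derivative[OF VS F x0] unfolding P_def by blast
  \<comment> \<open>A kernel vector \<open>v\<close> defines a tangent vector \<open>w\<close> of
    \<open>S\<close> that annihilates every coordinate of \<open>M\<close>. By the expansion of
    tangent vectors its image in \<open>M\<close> is zero, so \<open>w\<close> is zero by
    immersivity, and the coordinates of \<open>w\<close> in the chart of \<open>S\<close> are those
    of \<open>v\<close>.\<close>
  have ker: "v = 0" if v: "v \<in> model S" and fv: "f' v = 0" for v
  proof -
    define w where "w = chart_vec S V \<psi> v p"
    have w: "w \<in> tangent S p" unfolding w_def by (rule chart_vec_tangent[OF S c' v])
    have w0: "push p w (\<lambda>q. \<phi> q \<bullet> b) = 0" for b
    proof -
      have s: "smooth_near M p (\<lambda>q. \<phi> q \<bullet> b)" by (rule smooth_near_coord[OF M c])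
      have "((\<lambda>t. F (x0 + t *\<^sub>R v)) has_vector_derivative 0) (at 0)"
        using smooth_in_has_vector_derivative[OF F x0 v] f'(2)[OF v] fv by simp
      from bounded_linear.has_vector_derivative[OF bounded_linear_inner_left this, of b]
      have d: "((\<lambda>t. \<phi> (inv_into V \<psi> (\<psi> p + t *\<^sub>R v)) \<bullet> b) has_vector_derivative 0) (at 0)"
        by (simp add: F_def x0_def)
      show ?thesis
        unfolding push_apply[OF s] w_def
        by (rule chart_vec_eqI[OF S c' v smooth_near_restrict[OF p s] d])
    qed
    have "push p w = push p (\<lambda>f. 0)"
    proof
      fix f
      show "push p w f = push p (\<lambda>f. 0) f"
        unfolding tangent_expansion[OF M c push_tangent[OF p w], of f] w0 by (simp add: tangent_map_def)
    qed
    then have "w = (\<lambda>f. 0)"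
      using inj_onD[OF tangent_map_inj_on[OF p] _ w zero_in_tangent] by blast
    then have "v \<bullet> b = 0" for b
      using chart_vec_coord[OF S c' v, of b] by (simp add: w_def)
    then show "v = 0" by (metis inner_eq_zero_iff)
  qed
  have "inj_on f' (model S)"
  proof (rule inj_onI)
    fix a b assume a: "a \<in> model S" and b: "b \<in> model S" and eq: "f' a = f' b"
    have "f' (a - b) = 0" using linear_diff[OF f'(1), of a b] eq by simp
    then have "a - b = 0" by (rule ker[OF subspace_diff[OF VS a b]])
    then show "a = b" by simp
  qed
  then obtain L where L: "linear L" "\<And>v. v \<in> model S \<Longrightarrow> L (f' v) = v"
    using linear_exists_left_inverse_on[OF f'(1) VS] by blast
  define D where "D = P -` T"
  have D: "open D" "x0 \<in> D"
    using open_vimage_subspace_proj[OF VS oT] x0 TS P(3) by (auto simp: D_def P_def)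
  define G where "G x = L ((F \<circ> P) x) + (x - L (f' x))" for x
  have FP: "Cinf_on D (F \<circ> P)" using F unfolding smooth_in_iff_Cinf_on[OF VS] D_def P_def by blast
  have Lb: "bounded_linear L" and fb: "bounded_linear f'"
    using L(1)[unfolded linear_conv_bounded_linear] f'(1)[unfolded linear_conv_bounded_linear] by simp_all
  have lin: "linear (\<lambda>x. x - L (f' x))"
    using linear_compose_sub[OF linear_ident linear_compose[OF f'(1) L(1)]] by (simp add: o_def)
  have GC: "Cinf_on D G"
    unfolding G_def by (rule allI, rule Ck_on_add[OF Ck_on_bounded_linear[OF Lb FP[rule_format]] Ck_on_linear[OF lin]])
  have "(G has_derivative (\<lambda>v. L (f' v) + (v - L (f' v)))) (at x0)"
    unfolding G_def
    by (intro has_derivative_add has_derivative_diff has_derivative_ident bounded_linear.has_derivative[OF Lb] f'(3)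
        bounded_linear.has_derivative[OF fb])
  from frechet_derivative_at[OF this] have dG: "frechet_derivative G (at x0) v = v" for v
    by (auto dest: fun_cong[of _ _ v])
  obtain U' V' g where U': "open U'" "U' \<subseteq> D" "x0 \<in> U'" and V': "open V'" "G x0 \<in> V'"
    and hom: "homeomorphism U' V' G g" and gC: "Cinf_on V' g"
    by (rule smooth_inverse_function[OF D GC linear_ident]) (use dG in blast)+
  have gG: "g (G x) = x" "G x \<in> V'" if "x \<in> U'" for x using hom that by (auto simp: homeomorphism_def)
  have GT: "G x = L (F x)" if "x \<in> T" for x
    using that TS P(3) L(2) by (auto simp: G_def)
  define A where "A = model M \<inter> L -` V'"
  have LA: "openin (top_of_set (model M)) A"
  proof -
    have "open (L -` V')"
      by (rule open_vimage[OF V'(1) linear_continuous_on[OF Lb]])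
    then show ?thesis by (auto simp: A_def openin_open)
  qed
  have r: "smooth_in (model M) A (P \<circ> (g \<circ> L))"
  proof (rule smooth_in_compose[OF VM subspace_UNIV])
    show "smooth_in (model M) A (g \<circ> L)"
      by (rule smooth_in_compose[OF VM subspace_UNIV smooth_in_linear[OF VM L(1) LA], of V'])
         (use gC V' in \<open>auto simp: smooth_in_UNIV_iff A_def\<close>)
    show "smooth_in UNIV UNIV P" by (rule smooth_in_linear[OF subspace_UNIV P(1)]) simp
  qed simp
  \<comment> \<open>Restricting to points that \<open>g \<circ> L\<close> sends into
    \<open>D\<close> makes the retraction take values in \<open>T\<close>, where the chart
    expression of \<open>u\<close> is smooth.\<close>
  define A' where "A' = A \<inter> (g \<circ> L) -` D"
  have oA': "openin (top_of_set (model M)) A'"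
  proof -
    have "continuous_on A (\<lambda>y. g (L y))"
      by (rule continuous_on_compose2[OF Ck_on_imp_continuous_on[OF gC[rule_format]] linear_continuous_on[OF Lb]])
         (auto simp: A_def)
    then have "continuous_on A (g \<circ> L)" by (simp add: o_def)
    from continuous_openin_preimage_gen[OF this D(1)] show ?thesis
      unfolding A'_def using LA openin_trans by blast
  qed
  define h where "h = (u \<circ> inv_into V \<psi>) \<circ> (P \<circ> (g \<circ> L))"
  have h: "smooth_in (model M) A' h" unfolding h_def
  proof (rule smooth_in_compose[OF VM VS _ uT])
    show "smooth_in (model M) A' (P \<circ> (g \<circ> L))"
      by (rule smooth_in_subset[OF VM r _ oA']) (simp add: A'_def)
  qed (auto simp: A'_def D_def)
  have G0: "L (\<phi> p) = G x0" using GT[OF x0] F\<psi>[OF c'(2)] by (simp add: x0_def)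
  have "\<phi> p \<in> A'"
    using chart_image_subset[OF M c(1)] c(2) V'(2) gG(1)[OF U'(3)] D(2) G0 by (auto simp: A'_def A_def)
  from smooth_near_chart_compose[OF M c h this]
  have 1: "smooth_near M p (\<lambda>q. h (\<phi> q))" .
  have 2: "\<forall>\<^sub>F q in nhdsin (topo S) p. h (\<phi> q) = u q"
    unfolding eventually_nhdsin
  proof (intro disjI2 exI[of _ "{q \<in> V. \<psi> q \<in> T \<inter> (model S \<inter> U')}"] conjI ballI)
    show "openin (topo S) {q \<in> V. \<psi> q \<in> T \<inter> (model S \<inter> U')}"
      using oT openin_open_Int[OF U'(1), of "model S"] by (intro chart_open_preimage[OF S c'(1)]) blast
    show "p \<in> {q \<in> V. \<psi> q \<in> T \<inter> (model S \<inter> U')}" using c'(2) x0 TS U'(3) by (auto simp: x0_def)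
    fix q assume q: "q \<in> {q \<in> V. \<psi> q \<in> T \<inter> (model S \<inter> U')}"
    then have "L (\<phi> q) = G (\<psi> q)" using GT[of "\<psi> q"] F\<psi>[of q] by simp
    then have "P (g (L (\<phi> q))) = \<psi> q" using gG(1)[of "\<psi> q"] P(3)[of "\<psi> q"] q by simp
    then show "h (\<phi> q) = u q" using q inj by (simp add: h_def)
  qed
  show ?thesis using that[OF 1 2] .
qed

end

section \<open>The induced structure on a leaf\<close>

lemma alternating_on_2I:
  assumes "\<And>x y z a b. x \<in> T \<Longrightarrow> y \<in> T \<Longrightarrow> z \<in> T \<Longrightarrow> \<eta> [\<lambda>t. a * x t + b * y t, z] = a * \<eta> [x, z] + b * \<eta> [y, z]"
    and "\<And>x y z a b. x \<in> T \<Longrightarrow> y \<in> T \<Longrightarrow> z \<in> T \<Longrightarrow> \<eta> [z, \<lambda>t. a * x t + b * y t] = a * \<eta> [z, x] + b * \<eta> [z, y]"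
    and "\<And>x. x \<in> T \<Longrightarrow> \<eta> [x, x] = 0"
  shows "alternating_on 2 T \<eta>"
  unfolding alternating_on_def
proof (intro allI impI conjI ballI)
  fix xs assume l: "length xs = 2" and T: "set xs \<subseteq> T"
  define u v where "u = xs ! 0" and "v = xs ! 1"
  have xs: "xs = [u, v]" using list_length_2[OF l] by (simp add: u_def v_def)
  have uv: "u \<in> T" "v \<in> T" using T xs by auto
  {
    fix i y z a b assume i: "i < (2::nat)" and yz: "y \<in> T" "z \<in> T"
    from i consider "i = 0" | "i = 1" by linarith
    then show "\<eta> (xs[i := \<lambda>t. a * y t + b * z t]) = a * \<eta> (xs[i := y]) + b * \<eta> (xs[i := z])"
    proof cases
      case 1
      show ?thesis unfolding xs 1 using assms(1)[OF yz uv(2), of a b] by simp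
    next
      case 2
      show ?thesis unfolding xs 2 using assms(2)[OF yz uv(1), of a b] by simp
    qed
  next
    fix i j assume ij: "i < (2::nat)" "j < (2::nat)" "i \<noteq> j" "xs ! i = xs ! j"
    then have "i = 0 \<and> j = 1 \<or> i = 1 \<and> j = 0" by linarith
    then have "u = v" using ij(4) by (auto simp: u_def v_def)
    then show "\<eta> xs = 0" unfolding xs using assms(3)[OF uv(1)] by simp
  }
qed

lemma permutes_lessThan: "\<pi> permutes {..<n::nat} \<Longrightarrow> i < n \<Longrightarrow> \<pi> i < n"
  using permutes_in_image[of \<pi> "{..<n}" i] by simp

lemma map_nth_permutes:
  assumes "\<pi> permutes {..<n}" "b \<le> n" "length fs = n"
  shows "map (\<lambda>i. map c fs ! \<pi> i) [a..<b] = map c (map (\<lambda>i. fs ! \<pi> i) [a..<b])"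
    and "set (map (\<lambda>i. fs ! \<pi> i) [a..<b]) \<subseteq> set fs"
  using permutes_lessThan[OF assms(1)] assms(2,3) by auto

text \<open>Used with \<open>d\<close> and \<open>d'\<close> the differentials on \<open>S\<close>
  and on \<open>M\<close> of the same functions. Covectors of \<open>S\<close> have no canonical
  extension to \<open>M\<close>, so functions rather than covectors are the common
  arguments.\<close>

lemma wedge_map_cong:
  fixes d :: "'x \<Rightarrow> 'a covec" and d' :: "'x \<Rightarrow> 'b covec"
  assumes P: "\<And>gs. length gs = k \<Longrightarrow> set gs \<subseteq> set fs \<Longrightarrow> P (map d gs) = P' (map d' gs)"
    and Q: "\<And>gs. length gs = l \<Longrightarrow> set gs \<subseteq> set fs \<Longrightarrow> Q (map d gs) = Q' (map d' gs)"
    and len: "length fs = k + l"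
  shows "wedge k l P Q (map d fs) = wedge k l P' Q' (map d' fs)"
  unfolding wedge_def
proof (intro arg_cong2[where f = "(*)"] refl sum.cong)
  fix \<pi> assume "\<pi> \<in> {\<pi>. \<pi> permutes {..<k + l}}"
  then have \<pi>: "\<pi> permutes {..<k + l}" by simp
  note m = map_nth_permutes(1)[OF \<pi> _ len] and s = map_nth_permutes(2)[OF \<pi> _ len]
  show "P (map (\<lambda>i. map d fs ! \<pi> i) [0..<k]) = P' (map (\<lambda>i. map d' fs ! \<pi> i) [0..<k])"
    unfolding m[OF le_add1] by (rule P[OF _ s[OF le_add1]]) simp
  show "Q (map (\<lambda>i. map d fs ! \<pi> i) [k..<k + l]) = Q' (map (\<lambda>i. map d' fs ! \<pi> i) [k..<k + l])"
    unfolding m[OF order_refl] by (rule Q[OF _ s[OF order_refl]]) simp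
qed

locale jacobi_leaf = immersed M S for M S :: "('a, 'e::euclidean_space) manifold" +
  fixes \<Lambda> :: "'a \<Rightarrow> 'a kvec" and E :: "'a \<Rightarrow> 'a tvec" and \<omega> :: "'a \<Rightarrow> 'a kform"
  assumes twisted: "twisted_jacobi M \<Lambda> E \<omega>"
    and leaf: "integral_manifold M \<Lambda> E S"
begin

lemma \<Lambda>: "kvector_field M 2 \<Lambda>" and E: "vector_field_on M (pts M) E" and \<omega>: "kform_field M 2 \<omega>"
  using twisted by (auto simp: twisted_jacobi_def)

lemma push_image: "p \<in> pts S \<Longrightarrow> push p ` tangent S p = char_distribution M \<Lambda> E p"
  using leaf by (simp add: integral_manifold_def)

lemma E_tangent: "p \<in> pts S \<Longrightarrow> E p \<in> tangent M p"
  by (rule vector_field_on_tangent[OF M E pts_sub])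

lemma sharp_eq_push:
  assumes p: "p \<in> pts S" and \<alpha>: "\<alpha> \<in> cotangent M p"
  obtains v where "v \<in> tangent S p" "push p v = sharp M \<Lambda> p \<alpha>"
proof -
  have "(\<lambda>f. sharp M \<Lambda> p \<alpha> f + 0 * E p f) \<in> char_distribution M \<Lambda> E p"
    unfolding char_distribution_def using \<alpha> by blast
  then have "sharp M \<Lambda> p \<alpha> \<in> push p ` tangent S p" by (simp add: push_image[OF p])
  then show ?thesis using that by auto
qed

lemma zero_cotangent: "(\<lambda>v. 0) \<in> cotangent M p"
  by (simp add: cotangent_def)

lemma E_eq_push:
  assumes p: "p \<in> pts S"
  obtains v where "v \<in> tangent S p" "push p v = E p"
proof -
  \<comment> \<open>\<open>E p\<close> is to be presented as \<open>\<Lambda>\<^sup>#\<close> of the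
    zero covector plus \<open>1 * E p\<close>, which requires the first summand to vanish on every
    function, including those not smooth near \<open>p\<close>.\<close>
  have "sharp M \<Lambda> p (\<lambda>v. 0) f = 0" for f
  proof (cases "smooth_near M p f")
    case True
    have "\<Lambda> p [\<lambda>v. 0 * (\<lambda>v. 0) v + 0 * (\<lambda>v. 0) v, differential M p f] = 0 * \<Lambda> p [\<lambda>v. 0, differential M p f] + 0 * \<Lambda> p [\<lambda>v. 0, differential M p f]"
      by (rule alternating2_lincomb1[OF cotangent_subspace[of _ M p] kvector_field_alternating[OF M \<Lambda> pts_sub[OF p]]
          zero_cotangent zero_cotangent differential_cotangent[OF True]])
    then show ?thesis using sharp_apply[OF M \<Lambda> pts_sub[OF p] zero_cotangent True] by simp
  next
    case False
    then show ?thesis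
      by (rule tangent_not_smooth[OF sharp_tangent[OF M \<Lambda> pts_sub[OF p] zero_cotangent]])
  qed
  then have "E p = (\<lambda>f. sharp M \<Lambda> p (\<lambda>v. 0) f + 1 * E p f)" by simp
  then have "E p \<in> char_distribution M \<Lambda> E p"
    unfolding char_distribution_def using zero_cotangent by blast
  then have "E p \<in> push p ` tangent S p" by (simp add: push_image[OF p])
  then show ?thesis using that by auto
qed

lemma \<Lambda>_swap:
  assumes "p \<in> pts S" "\<alpha> \<in> cotangent M p" "\<beta> \<in> cotangent M p"
  shows "\<Lambda> p [\<alpha>, \<beta>] = - \<Lambda> p [\<beta>, \<alpha>]"
  by (rule alternating2_swap[OF cotangent_subspace[of _ M p] kvector_field_alternating[OF M \<Lambda> pts_sub[OF assms(1)]] assms(3,2)])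

text \<open>The reason is that \<open>\<Lambda>\<^sup>#\<close> takes values in the tangent spaces of the leaf.\<close>

lemma \<Lambda>_cong1:
  assumes p: "p \<in> pts S" and \<alpha>: "\<alpha> \<in> cotangent M p" "\<alpha>' \<in> cotangent M p" and \<beta>: "\<beta> \<in> cotangent M p"
    and eq: "\<And>v. v \<in> tangent S p \<Longrightarrow> \<alpha> (push p v) = \<alpha>' (push p v)"
  shows "\<Lambda> p [\<alpha>, \<beta>] = \<Lambda> p [\<alpha>', \<beta>]"
proof -
  obtain v where v: "v \<in> tangent S p" "push p v = sharp M \<Lambda> p \<beta>" using sharp_eq_push[OF p \<beta>] .
  have "\<Lambda> p [\<beta>, \<alpha>] = \<Lambda> p [\<beta>, \<alpha>']"
    using eq[OF v(1)] sharp_pairing[OF M \<Lambda> pts_sub[OF p] \<beta> \<alpha>(1)] sharp_pairing[OF M \<Lambda> pts_sub[OF p] \<beta> \<alpha>(2)] v(2) by simp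
  then show ?thesis using \<Lambda>_swap[OF p \<alpha>(1) \<beta>] \<Lambda>_swap[OF p \<alpha>(2) \<beta>] by simp
qed

lemma \<Lambda>_cong:
  assumes p: "p \<in> pts S" and \<alpha>: "\<alpha> \<in> cotangent M p" "\<alpha>' \<in> cotangent M p" and \<beta>: "\<beta> \<in> cotangent M p" "\<beta>' \<in> cotangent M p"
    and eq: "\<And>v. v \<in> tangent S p \<Longrightarrow> \<alpha> (push p v) = \<alpha>' (push p v)" "\<And>v. v \<in> tangent S p \<Longrightarrow> \<beta> (push p v) = \<beta>' (push p v)"
  shows "\<Lambda> p [\<alpha>, \<beta>] = \<Lambda> p [\<alpha>', \<beta>']"
proof -
  have "\<Lambda> p [\<alpha>, \<beta>] = \<Lambda> p [\<alpha>', \<beta>]" by (rule \<Lambda>_cong1[OF p \<alpha> \<beta>(1) eq(1)])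
  also have "\<dots> = - \<Lambda> p [\<beta>, \<alpha>']" by (rule \<Lambda>_swap[OF p \<alpha>(2) \<beta>(1)])
  also have "\<Lambda> p [\<beta>, \<alpha>'] = \<Lambda> p [\<beta>', \<alpha>']" by (rule \<Lambda>_cong1[OF p \<beta> \<alpha>(2) eq(2)])
  also have "- \<dots> = \<Lambda> p [\<alpha>', \<beta>']" by (rule \<Lambda>_swap[OF p \<alpha>(2) \<beta>(2), symmetric])
  finally show ?thesis .
qed

section \<open>Bivector field, vector field and 2-form on the leaf\<close>

text \<open>An arbitrary choice. Two choices agree on vectors tangent to the leaf, so \<Lambda> does
  not distinguish them.\<close>

definition covec_extension :: "'a \<Rightarrow> 'a covec \<Rightarrow> 'a covec" where
  "covec_extension p \<alpha> = differential M p (SOME f. smooth_near M p f \<and> differential S p f = \<alpha>)"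

definition \<Lambda>\<^sub>S :: "'a \<Rightarrow> 'a kvec" where
  "\<Lambda>\<^sub>S p \<alpha>s = \<Lambda> p (map (covec_extension p) \<alpha>s)"

text \<open>As \<open>push\<close> is injective on the tangent space of the leaf, there is only one
  such vector.\<close>

definition E\<^sub>S :: "'a \<Rightarrow> 'a tvec" where
  "E\<^sub>S p = (SOME v. v \<in> tangent S p \<and> push p v = E p)"

definition \<omega>\<^sub>S :: "'a \<Rightarrow> 'a kform" where
  "\<omega>\<^sub>S p vs = \<omega> p (map (push p) vs)"

lemma E\<^sub>S:
  assumes "p \<in> pts S"
  shows E\<^sub>S_tangent: "E\<^sub>S p \<in> tangent S p" and push_E\<^sub>S: "push p (E\<^sub>S p) = E p"
proof -
  have "\<exists>v. v \<in> tangent S p \<and> push p v = E p" using E_eq_push[OF assms] by blast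
  then have "E\<^sub>S p \<in> tangent S p \<and> push p (E\<^sub>S p) = E p" unfolding E\<^sub>S_def by (rule someI_ex)
  then show "E\<^sub>S p \<in> tangent S p" "push p (E\<^sub>S p) = E p" by auto
qed

lemma E\<^sub>S_apply: "p \<in> pts S \<Longrightarrow> smooth_near M p f \<Longrightarrow> E\<^sub>S p f = E p f"
  using push_E\<^sub>S push_apply by metis

text \<open>The function chosen in \<open>covec_extension\<close> has the same differential along
  \<open>S\<close> as \<open>f\<close>, so its differential in \<open>M\<close> agrees with that of
  \<open>f\<close> on vectors tangent to the leaf, and \<open>\<Lambda>_cong\<close> applies. From
  here on the choice never has to be opened again.\<close>

lemma \<Lambda>\<^sub>S_differential:
  assumes p: "p \<in> pts S" and f: "smooth_near M p f" and g: "smooth_near M p g"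
  shows "\<Lambda>\<^sub>S p [differential S p f, differential S p g] = \<Lambda> p [differential M p f, differential M p g]"
proof -
  have *: "covec_extension p (differential S p f) \<in> cotangent M p \<and>
      (\<forall>v\<in>tangent S p. covec_extension p (differential S p f) (push p v) = differential M p f (push p v))"
    if f: "smooth_near M p f" for f
  proof -
    define f0 where "f0 = (SOME h. smooth_near M p h \<and> differential S p h = differential S p f)"
    have "\<exists>h. smooth_near M p h \<and> differential S p h = differential S p f" using f by blast
    then have "smooth_near M p f0 \<and> differential S p f0 = differential S p f" unfolding f0_def by (rule someI_ex)
    then have f0: "smooth_near M p f0" "differential S p f0 = differential S p f" by auto
    have e: "covec_extension p (differential S p f) = differential M p f0"
      by (simp add: covec_extension_def f0_def)
    have "differential M p f0 (push p v) = differential M p f (push p v)" if v: "v \<in> tangent S p" for v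
    proof -
      have "differential M p f0 (push p v) = v f0"
        using push_tangent[OF p v] by (simp add: differential_apply push_apply[OF f0(1)])
      also have "\<dots> = v f" using fun_cong[OF f0(2), of v] v by (simp add: differential_apply)
      also have "\<dots> = differential M p f (push p v)"
        using push_tangent[OF p v] by (simp add: differential_apply push_apply[OF f])
      finally show ?thesis .
    qed
    then show ?thesis unfolding e using differential_cotangent[OF f0(1)] by blast
  qed
  show ?thesis
    unfolding \<Lambda>\<^sub>S_def list.map
    by (rule \<Lambda>_cong[OF p]) (use *[OF f] *[OF g] differential_cotangent[OF f] differential_cotangent[OF g] in simp_all)
qed

text \<open>A covector of \<open>S\<close> is the differential of a germ on \<open>S\<close>, and
  that germ extends to \<open>M\<close>. Hence identities on \<open>S\<close> can be tested with
  functions that are smooth on \<open>M\<close>.\<close>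

lemma cotangent_S_eq_differential:
  assumes p: "p \<in> pts S" and \<alpha>: "\<alpha> \<in> cotangent S p"
  obtains f where "smooth_near M p f" "\<alpha> = differential S p f"
proof -
  obtain u where u: "smooth_near S p u" "\<alpha> = differential S p u" using cotangent_eq_differential[OF S p \<alpha>] .
  obtain f where f: "smooth_near M p f" "\<forall>\<^sub>F q in nhdsin (topo S) p. f q = u q" using smooth_extension[OF p u(1)] .
  show ?thesis
    using that[OF f(1)] u(2) differential_cong[OF smooth_near_restrict[OF p f(1)] u(1) f(2)] by simp
qed

lemma eventually_in_S: "p \<in> pts S \<Longrightarrow> \<forall>\<^sub>F q in nhdsin (topo S) p. q \<in> pts S"
  using openin_topspace[of "topo S"] by (auto simp: eventually_nhdsin simp del: openin_topspace)

lemma eventually_\<Lambda>\<^sub>S_differential: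
  assumes p: "p \<in> pts S" and f: "smooth_near M p f" and g: "smooth_near M p g"
  shows "\<forall>\<^sub>F q in nhdsin (topo S) p.
    \<Lambda> q [differential M q f, differential M q g] = \<Lambda>\<^sub>S q [differential S q f, differential S q g]"
  using eventually_in_S[OF p] eventually_restrict[OF p eventually_smooth_near[OF M f]]
    eventually_restrict[OF p eventually_smooth_near[OF M g]]
  by eventually_elim (rule \<Lambda>\<^sub>S_differential[symmetric])

lemma kvector_field_\<Lambda>\<^sub>S: "kvector_field S 2 \<Lambda>\<^sub>S"
  unfolding kvector_field_def
proof (intro conjI ballI allI impI)
  fix p assume p: "p \<in> pts S"
  note cl = cotangent_subspace[of _ M p] and alt = kvector_field_alternating[OF M \<Lambda> pts_sub[OF p]]
  show "alternating_on 2 (cotangent S p) (\<Lambda>\<^sub>S p)"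
  proof (rule alternating_on_2I)
    fix \<alpha> \<beta> \<gamma> a b
    assume "\<alpha> \<in> cotangent S p" "\<beta> \<in> cotangent S p" "\<gamma> \<in> cotangent S p"
    then obtain f g h where f: "smooth_near M p f" "\<alpha> = differential S p f"
      and g: "smooth_near M p g" "\<beta> = differential S p g" and h: "smooth_near M p h" "\<gamma> = differential S p h"
      using cotangent_S_eq_differential[OF p] by metis
    have fg: "smooth_near M p (\<lambda>x. a * f x + b * g x)"
      by (rule smooth_near_add[OF M smooth_near_cmult[OF M f(1)] smooth_near_cmult[OF M g(1)]])
    have dS: "(\<lambda>t. a * differential S p f t + b * differential S p g t) = differential S p (\<lambda>x. a * f x + b * g x)"
      by (rule differential_lincomb[OF smooth_near_restrict[OF p f(1)] smooth_near_restrict[OF p g(1)], symmetric])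
    note dM = differential_lincomb[OF f(1) g(1), of a b]
    show "\<Lambda>\<^sub>S p [\<lambda>t. a * \<alpha> t + b * \<beta> t, \<gamma>] = a * \<Lambda>\<^sub>S p [\<alpha>, \<gamma>] + b * \<Lambda>\<^sub>S p [\<beta>, \<gamma>]"
      unfolding f(2) g(2) h(2)
      unfolding dS \<Lambda>\<^sub>S_differential[OF p fg h(1)] \<Lambda>\<^sub>S_differential[OF p f(1) h(1)]
        \<Lambda>\<^sub>S_differential[OF p g(1) h(1)] dM
      by (rule alternating2_lincomb1[OF cl alt differential_cotangent[OF f(1)] differential_cotangent[OF g(1)] differential_cotangent[OF h(1)]])
    show "\<Lambda>\<^sub>S p [\<gamma>, \<lambda>t. a * \<alpha> t + b * \<beta> t] = a * \<Lambda>\<^sub>S p [\<gamma>, \<alpha>] + b * \<Lambda>\<^sub>S p [\<gamma>, \<beta>]"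
      unfolding f(2) g(2) h(2)
      unfolding dS \<Lambda>\<^sub>S_differential[OF p h(1) fg] \<Lambda>\<^sub>S_differential[OF p h(1) f(1)]
        \<Lambda>\<^sub>S_differential[OF p h(1) g(1)] dM
      by (rule alternating2_lincomb2[OF cl alt differential_cotangent[OF f(1)] differential_cotangent[OF g(1)] differential_cotangent[OF h(1)]])
  next
    fix \<alpha> assume "\<alpha> \<in> cotangent S p"
    then obtain f where f: "smooth_near M p f" "\<alpha> = differential S p f" using cotangent_S_eq_differential[OF p] by metis
    show "\<Lambda>\<^sub>S p [\<alpha>, \<alpha>] = 0"
      unfolding f(2) \<Lambda>\<^sub>S_differential[OF p f(1) f(1)]
      by (rule alternating2_same[OF cl alt differential_cotangent[OF f(1)]])
  qed
next
  fix U fs assume l: "length (fs :: ('a \<Rightarrow> real) list) = 2" and U: "openin (topo S) U" and s: "\<forall>f\<in>set fs. smooth_fun_on S U f"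
  define u w where "u = fs ! 0" and "w = fs ! 1"
  have fs: "fs = [u, w]" using list_length_2[OF l] by (simp add: u_def w_def)
  have uw: "smooth_near S p u" "smooth_near S p w" if "p \<in> U" for p
    using s fs that smooth_fun_on_iff_near[OF S] by auto
  show "smooth_fun_on S U (\<lambda>p. \<Lambda>\<^sub>S p (map (differential S p) fs))"
    unfolding smooth_fun_on_iff_near[OF S] fs list.map
  proof (intro conjI U ballI)
    fix p assume pU: "p \<in> U"
    have p: "p \<in> pts S" using openin_subset[OF U] pU by blast
    obtain f where f: "smooth_near M p f" "\<forall>\<^sub>F q in nhdsin (topo S) p. f q = u q" using smooth_extension[OF p uw(1)[OF pU]] .
    obtain g where g: "smooth_near M p g" "\<forall>\<^sub>F q in nhdsin (topo S) p. g q = w q" using smooth_extension[OF p uw(2)[OF pU]] .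
    have 1: "smooth_near S p (\<lambda>q. \<Lambda> q [differential M q f, differential M q g])"
      by (rule smooth_near_restrict[OF p kvector_field_smooth[OF M \<Lambda> f(1) g(1)]])
    \<comment> \<open>The differentials are compared at all nearby points, not only at
      \<open>p\<close>. Functions that coincide near \<open>p\<close> also coincide near each point
      close to \<open>p\<close>.\<close>
    have ev: "\<forall>\<^sub>F q in nhdsin (topo S) p. differential S q h = differential S q k"
      if "\<forall>\<^sub>F q in nhdsin (topo S) p. h q = k q" "smooth_near S p h" "smooth_near S p k" for h k
      using eventually_eventually_nhdsin[OF that(1)] eventually_smooth_near[OF S that(2)] eventually_smooth_near[OF S that(3)]
      by eventually_elim (rule differential_cong)
    have "\<forall>\<^sub>F q in nhdsin (topo S) p. \<Lambda> q [differential M q f, differential M q g] = \<Lambda>\<^sub>S q [differential S q u, differential S q w]"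
      using eventually_\<Lambda>\<^sub>S_differential[OF p f(1) g(1)] ev[OF f(2) smooth_near_restrict[OF p f(1)] uw(1)[OF pU]]
        ev[OF g(2) smooth_near_restrict[OF p g(1)] uw(2)[OF pU]]
      by eventually_elim simp
    then show "smooth_near S p (\<lambda>p. \<Lambda>\<^sub>S p [differential S p u, differential S p w])"
      by (rule smooth_near_cong[OF S 1])
  qed
qed

lemma vector_field_E\<^sub>S: "vector_field_on S (pts S) E\<^sub>S"
  unfolding vector_field_on_iff[OF S]
proof (intro conjI ballI allI impI)
  fix p assume p: "p \<in> pts S"
  show "E\<^sub>S p \<in> tangent S p" by (rule E\<^sub>S_tangent[OF p])
  fix u assume u: "smooth_near S p u"
  obtain f where f: "smooth_near M p f" "\<forall>\<^sub>F q in nhdsin (topo S) p. f q = u q" using smooth_extension[OF p u] .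
  note fS = smooth_near_restrict[OF p f(1)]
  have "\<forall>\<^sub>F q in nhdsin (topo S) p. E q f = E\<^sub>S q u"
    using eventually_in_S[OF p] eventually_restrict[OF p eventually_smooth_near[OF M f(1)]]
      eventually_eventually_nhdsin[OF f(2)] eventually_smooth_near[OF S u] eventually_smooth_near[OF S fS]
  proof eventually_elim
    case (elim q)
    show ?case using E\<^sub>S_apply[OF elim(1,2)] tangent_cong[OF E\<^sub>S_tangent[OF elim(1)] elim(5,4,3)] by simp
  qed
  then show "smooth_near S p (\<lambda>q. E\<^sub>S q u)"
    by (rule smooth_near_cong[OF S smooth_near_restrict[OF p vector_field_on_smooth[OF M E pts_sub[OF p] f(1)]]])
qed simp

text \<open>For smoothness, the fields on \<open>S\<close> are not extended to \<open>M\<close>.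
  Their images are expanded in a coordinate frame of \<open>M\<close>: the coefficients
  \<open>X q (x b)\<close> are smooth on \<open>S\<close>, and the components of \<omega> in the
  frame are smooth on \<open>M\<close> and restrict to \<open>S\<close>.\<close>

lemma kform_field_\<omega>\<^sub>S: "kform_field S 2 \<omega>\<^sub>S"
  unfolding kform_field_def
proof (intro conjI ballI allI impI)
  fix p assume p: "p \<in> pts S"
  note cl = tangent_subspace[of _ M p] and alt = kform_field_alternating[OF M \<omega> pts_sub[OF p]] and t = push_tangent[OF p]
  show "alternating_on 2 (tangent S p) (\<omega>\<^sub>S p)"
  proof (rule alternating_on_2I)
    fix u v w a b assume uvw: "u \<in> tangent S p" "v \<in> tangent S p" "w \<in> tangent S p"
    show "\<omega>\<^sub>S p [\<lambda>f. a * u f + b * v f, w] = a * \<omega>\<^sub>S p [u, w] + b * \<omega>\<^sub>S p [v, w]"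
      unfolding \<omega>\<^sub>S_def list.map push_lincomb by (rule alternating2_lincomb1[OF cl alt t[OF uvw(1)] t[OF uvw(2)] t[OF uvw(3)]])
    show "\<omega>\<^sub>S p [w, \<lambda>f. a * u f + b * v f] = a * \<omega>\<^sub>S p [w, u] + b * \<omega>\<^sub>S p [w, v]"
      unfolding \<omega>\<^sub>S_def list.map push_lincomb by (rule alternating2_lincomb2[OF cl alt t[OF uvw(1)] t[OF uvw(2)] t[OF uvw(3)]])
  next
    fix u assume u: "u \<in> tangent S p"
    show "\<omega>\<^sub>S p [u, u] = 0" unfolding \<omega>\<^sub>S_def list.map by (rule alternating2_same[OF cl alt t[OF u]])
  qed
next
  fix U Xs assume l: "length (Xs :: ('a \<Rightarrow> 'a tvec) list) = 2" and U: "openin (topo S) U" and s: "\<forall>X\<in>set Xs. vector_field_on S U X"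
  define X Y where "X = Xs ! 0" and "Y = Xs ! 1"
  have Xs: "Xs = [X, Y]" using list_length_2[OF l] by (simp add: X_def Y_def)
  have X: "vector_field_on S U X" and Y: "vector_field_on S U Y" using s Xs by auto
  show "smooth_fun_on S U (\<lambda>p. \<omega>\<^sub>S p (map (\<lambda>X. X p) Xs))"
    unfolding smooth_fun_on_iff_near[OF S] Xs list.map
  proof (intro conjI U ballI)
    fix p assume pU: "p \<in> U"
    have p: "p \<in> pts S" using openin_subset[OF U] pU by blast
    obtain A \<phi> where c: "(A, \<phi>) \<in> atlas M" "p \<in> A" using ex_chart[OF M pts_sub[OF p]] .
    define F where "F b = chart_frame M A \<phi> b" for b
    have F: "vector_field_on M A (F b)" for b unfolding F_def by (rule chart_frame_vector_field[OF M c(1)])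
    define x where "x b q = \<phi> q \<bullet> b" for b q
    have xs: "smooth_near M q (x b)" if "q \<in> A" for q b
      using smooth_near_coord[OF M c(1) that] by (simp add: x_def[abs_def])
    have xS: "smooth_near S p (x b)" for b by (rule smooth_near_restrict[OF p xs[OF c(2)]])
    have "\<forall>\<^sub>F q in nhdsin (topo M) p. q \<in> A" by (rule vector_field_on_eventually[OF M F c(2)])
    then have evA: "\<forall>\<^sub>F q in nhdsin (topo S) p. q \<in> A" by (rule eventually_restrict[OF p])
    have ev: "\<forall>\<^sub>F q in nhdsin (topo S) p.
        (\<Sum>b\<in>Basis. X q (x b) * (\<Sum>c\<in>Basis. Y q (x c) * \<omega> q [F b q, F c q])) = \<omega>\<^sub>S q [X q, Y q]"
      using evA vector_field_on_eventually[OF S X pU] eventually_in_S[OF p]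
    proof eventually_elim
      case (elim q)
      note cl = tangent_subspace[of _ M q] and alt = kform_field_alternating[OF M \<omega> pts_sub[OF elim(3)]]
        and tF = vector_field_on_tangent[OF M F elim(1)]
      have e: "push q v = (\<lambda>f. \<Sum>b\<in>Basis. v (x b) * F b q f)" if "v \<in> tangent S q" for v
      proof
        fix f
        have "push q v (\<lambda>q. \<phi> q \<bullet> b) = v (x b)" for b
          using push_apply[OF xs[OF elim(1), of b]] by (simp add: x_def[abs_def])
        then show "push q v f = (\<Sum>b\<in>Basis. v (x b) * F b q f)"
          using tangent_expansion[OF M c(1) elim(1) push_tangent[OF elim(3) that], of f] by (simp add: F_def)
      qed
      note tX = vector_field_on_tangent[OF S X elim(2)] and tY = vector_field_on_tangent[OF S Y elim(2)]
      have "\<omega>\<^sub>S q [X q, Y q] = \<omega> q [\<lambda>f. \<Sum>b\<in>Basis. X q (x b) * F b q f, push q (Y q)]"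
        unfolding \<omega>\<^sub>S_def list.map e[OF tX] ..
      also have "\<dots> = (\<Sum>b\<in>Basis. X q (x b) * \<omega> q [F b q, push q (Y q)])"
        by (rule conjunct2[OF alternating2_sum1[OF cl alt push_tangent[OF elim(3) tY] tF]])
      also have "\<dots> = (\<Sum>b\<in>Basis. X q (x b) * (\<Sum>c\<in>Basis. Y q (x c) * \<omega> q [F b q, F c q]))"
      proof (intro sum.cong refl arg_cong2[where f = "(*)"])
        fix b :: 'e
        show "\<omega> q [F b q, push q (Y q)] = (\<Sum>c\<in>Basis. Y q (x c) * \<omega> q [F b q, F c q])"
          unfolding e[OF tY] by (rule alternating2_sum2[OF cl alt tF tF])
      qed
      finally show ?case by (rule sym)
    qed
    have "smooth_near S p (\<lambda>q. \<Sum>b\<in>Basis. X q (x b) * (\<Sum>c\<in>Basis. Y q (x c) * \<omega> q [F b q, F c q]))"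
      by (intro smooth_near_sum[OF S p] smooth_near_mult[OF S] vector_field_on_smooth[OF S X pU xS]
          vector_field_on_smooth[OF S Y pU xS] smooth_near_restrict[OF p kform_field_smooth[OF M \<omega> F F c(2)]])
    from smooth_near_cong[OF S this ev] show "smooth_near S p (\<lambda>p. \<omega>\<^sub>S p [X p, Y p])" .
  qed
qed

text \<open>Applied to a function \<open>g\<close> smooth on \<open>M\<close> near \<open>p\<close>,
  both sides are \<open>\<Lambda> p [differential M p f, differential M p g]\<close>; on all other
  functions both vanish.\<close>

lemma push_sharp:
  assumes p: "p \<in> pts S" and f: "smooth_near M p f"
  shows "push p (sharp S \<Lambda>\<^sub>S p (differential S p f)) = sharp M \<Lambda> p (differential M p f)"
proof
  fix g
  note dM = differential_cotangent[OF f] and dS = differential_cotangent[OF smooth_near_restrict[OF p f]]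
  show "push p (sharp S \<Lambda>\<^sub>S p (differential S p f)) g = sharp M \<Lambda> p (differential M p f) g"
  proof (cases "smooth_near M p g")
    case True
    have "push p (sharp S \<Lambda>\<^sub>S p (differential S p f)) g = sharp S \<Lambda>\<^sub>S p (differential S p f) g" by (rule push_apply[OF True])
    also have "\<dots> = \<Lambda>\<^sub>S p [differential S p f, differential S p g]"
      by (rule sharp_apply[OF S kvector_field_\<Lambda>\<^sub>S p dS smooth_near_restrict[OF p True]])
    also have "\<dots> = \<Lambda> p [differential M p f, differential M p g]" by (rule \<Lambda>\<^sub>S_differential[OF p f True])
    also have "\<dots> = sharp M \<Lambda> p (differential M p f) g"
      by (rule sharp_apply[OF M \<Lambda> pts_sub[OF p] dM True, symmetric])
    finally show ?thesis .
  next
    case False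
    have "sharp M \<Lambda> p (differential M p f) g = 0"
      by (rule tangent_not_smooth[OF sharp_tangent[OF M \<Lambda> pts_sub[OF p] dM] False])
    then show ?thesis using False by (simp add: tangent_map_def)
  qed
qed

section \<open>Iterated brackets and Schouten brackets restricted to the leaf\<close>

lemma kvec_bracket_cong1:
  assumes "differential N p f = differential N p f'"
  shows "kvec_bracket N Q f g p = kvec_bracket N Q f' g p" "kvec_bracket N Q g f p = kvec_bracket N Q g f' p"
  using assms by (simp_all add: kvec_bracket_def)

lemma smooth_kvec_bracket: "smooth_near M p f \<Longrightarrow> smooth_near M p g \<Longrightarrow> smooth_near M p (kvec_bracket M \<Lambda> f g)"
  using kvector_field_smooth[OF M \<Lambda>] by (simp add: kvec_bracket_def[abs_def])

lemma smooth_E: "p \<in> pts S \<Longrightarrow> smooth_near M p f \<Longrightarrow> smooth_near M p (\<lambda>q. E q f)"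
  by (rule vector_field_on_smooth[OF M E pts_sub])

lemma kvec_bracket_S:
  "p \<in> pts S \<Longrightarrow> smooth_near M p f \<Longrightarrow> smooth_near M p g \<Longrightarrow> kvec_bracket S \<Lambda>\<^sub>S f g p = kvec_bracket M \<Lambda> f g p"
  by (simp add: kvec_bracket_def \<Lambda>\<^sub>S_differential)

context
  fixes p assumes p: "p \<in> pts S"
begin

lemma eventually_kvec_bracket_S:
  assumes "smooth_near M p f" "smooth_near M p g"
  shows "\<forall>\<^sub>F q in nhdsin (topo S) p. kvec_bracket M \<Lambda> f g q = kvec_bracket S \<Lambda>\<^sub>S f g q"
  using eventually_\<Lambda>\<^sub>S_differential[OF p assms] by (simp add: kvec_bracket_def)

lemma eventually_E\<^sub>S:
  assumes "smooth_near M p f"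
  shows "\<forall>\<^sub>F q in nhdsin (topo S) p. E q f = E\<^sub>S q f"
  using eventually_in_S[OF p] eventually_restrict[OF p eventually_smooth_near[OF M assms]]
  by eventually_elim (rule E\<^sub>S_apply[symmetric])

lemma differential_eventually_eq:
  assumes "smooth_near M p u" "\<forall>\<^sub>F q in nhdsin (topo S) p. u q = w q"
  shows "differential S p w = differential S p u"
  by (rule differential_cong[symmetric, OF smooth_near_restrict[OF p assms(1)]
        smooth_near_cong[OF S smooth_near_restrict[OF p assms(1)] assms(2)] assms(2)])

text \<open>The inner brackets coincide on a neighbourhood of \<open>p\<close> in the leaf, hence
  have the same differential there, and the outer bracket depends only on that differential.\<close>

lemma kvec_bracket_S_nested:
  assumes s: "smooth_near M p f" "smooth_near M p g" "smooth_near M p h"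
  shows "kvec_bracket S \<Lambda>\<^sub>S (kvec_bracket S \<Lambda>\<^sub>S f g) h p = kvec_bracket M \<Lambda> (kvec_bracket M \<Lambda> f g) h p"
proof -
  note sb = smooth_kvec_bracket[OF s(1,2)]
  have "kvec_bracket S \<Lambda>\<^sub>S (kvec_bracket S \<Lambda>\<^sub>S f g) h p = kvec_bracket S \<Lambda>\<^sub>S (kvec_bracket M \<Lambda> f g) h p"
    by (rule kvec_bracket_cong1(1)[OF differential_eventually_eq[OF sb eventually_kvec_bracket_S[OF s(1,2)]]])
  also have "\<dots> = kvec_bracket M \<Lambda> (kvec_bracket M \<Lambda> f g) h p" by (rule kvec_bracket_S[OF p sb s(3)])
  finally show ?thesis .
qed

lemma schouten_\<Lambda>\<^sub>S_\<Lambda>\<^sub>S: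
  assumes s: "smooth_near M p f" "smooth_near M p g" "smooth_near M p h"
  shows "schouten S 2 2 \<Lambda>\<^sub>S \<Lambda>\<^sub>S p [differential S p f, differential S p g, differential S p h] =
    schouten M 2 2 \<Lambda> \<Lambda> p [differential M p f, differential M p g, differential M p h]"
  unfolding schouten_2_2[OF M \<Lambda> \<Lambda> s]
    schouten_2_2[OF S kvector_field_\<Lambda>\<^sub>S kvector_field_\<Lambda>\<^sub>S
      smooth_near_restrict[OF p s(1)] smooth_near_restrict[OF p s(2)] smooth_near_restrict[OF p s(3)]]
    kvec_bracket_S_nested[OF s] kvec_bracket_S_nested[OF s(2,3,1)] kvec_bracket_S_nested[OF s(3,1,2)] ..

lemma schouten_E\<^sub>S_\<Lambda>\<^sub>S:
  assumes s: "smooth_near M p f" "smooth_near M p g"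
  shows "schouten S 1 2 (\<lambda>q. vec_to_kvec (E\<^sub>S q)) \<Lambda>\<^sub>S p [differential S p f, differential S p g] =
    schouten M 1 2 (\<lambda>q. vec_to_kvec (E q)) \<Lambda> p [differential M p f, differential M p g]"
proof -
  note sb = smooth_kvec_bracket[OF s]
  have 1: "E\<^sub>S p (kvec_bracket S \<Lambda>\<^sub>S f g) = E p (kvec_bracket M \<Lambda> f g)"
    using tangent_cong'[OF S E\<^sub>S_tangent[OF p] smooth_near_restrict[OF p sb] eventually_kvec_bracket_S[OF s]]
      E\<^sub>S_apply[OF p sb] by simp
  have 2: "kvec_bracket S \<Lambda>\<^sub>S (\<lambda>q. E\<^sub>S q f) g p = kvec_bracket M \<Lambda> (\<lambda>q. E q f) g p"
    using kvec_bracket_cong1(1)[OF differential_eventually_eq[OF smooth_E[OF p s(1)] eventually_E\<^sub>S[OF s(1)]]]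
      kvec_bracket_S[OF p smooth_E[OF p s(1)] s(2)] by simp
  have 3: "kvec_bracket S \<Lambda>\<^sub>S f (\<lambda>q. E\<^sub>S q g) p = kvec_bracket M \<Lambda> f (\<lambda>q. E q g) p"
    using kvec_bracket_cong1(2)[OF differential_eventually_eq[OF smooth_E[OF p s(2)] eventually_E\<^sub>S[OF s(2)]]]
      kvec_bracket_S[OF p s(1) smooth_E[OF p s(2)]] by simp
  show ?thesis
    unfolding schouten_1_2[OF M E \<Lambda> s]
      schouten_1_2[OF S vector_field_E\<^sub>S kvector_field_\<Lambda>\<^sub>S smooth_near_restrict[OF p s(1)] smooth_near_restrict[OF p s(2)]]
      1 2 3 ..
qed

end

section \<open>Exterior derivative of the pullback, and the structure equations on the leaf\<close>

text \<open>Naturality of the exterior derivative under the inclusion. Fields on \<open>S\<close>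
  and \<open>M\<close> that correspond on a neighbourhood in \<open>S\<close> have corresponding Lie
  brackets, so the invariant formula agrees term by term.\<close>

lemma ext_deriv_push:
  assumes X: "vector_field_on M W X" "vector_field_on S W' X'" "\<forall>q\<in>W'. push q (X' q) = X q"
    and Y: "vector_field_on M W Y" "vector_field_on S W' Y'" "\<forall>q\<in>W'. push q (Y' q) = Y q"
    and Z: "vector_field_on M W Z" "vector_field_on S W' Z'" "\<forall>q\<in>W'. push q (Z' q) = Z q"
    and W': "W' \<subseteq> W" and p: "p \<in> W'"
  shows "ext_deriv S \<omega>\<^sub>S p [X' p, Y' p, Z' p] = ext_deriv M \<omega> p [X p, Y p, Z p]"
proof -
  have pW: "p \<in> W" using p W' by blast
  have oW': "openin (topo S) W'" by (rule vector_field_on_openin[OF S X(2)])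
  have WS: "q \<in> pts S" if "q \<in> W'" for q using openin_subset[OF oW'] that by blast
  note pS = WS[OF p]
  have evW': "\<forall>\<^sub>F q in nhdsin (topo S) p. q \<in> W'" by (rule vector_field_on_eventually[OF S X(2) p])
  have d: "C' p (\<lambda>q. \<omega>\<^sub>S q [A' q, B' q]) = C p (\<lambda>q. \<omega> q [A q, B q])"
    if A: "vector_field_on M W A" "vector_field_on S W' A'" "\<forall>q\<in>W'. push q (A' q) = A q"
    and B: "vector_field_on M W B" "vector_field_on S W' B'" "\<forall>q\<in>W'. push q (B' q) = B q"
    and C: "vector_field_on M W C" "vector_field_on S W' C'" "\<forall>q\<in>W'. push q (C' q) = C q"
    for A A' B B' C C'
  proof -
    have ev: "\<forall>\<^sub>F q in nhdsin (topo S) p. \<omega> q [A q, B q] = \<omega>\<^sub>S q [A' q, B' q]"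
      using evW' by eventually_elim (simp add: \<omega>\<^sub>S_def A(3) B(3))
    have s: "smooth_near M p (\<lambda>q. \<omega> q [A q, B q])" by (rule kform_field_smooth[OF M \<omega> A(1) B(1) pW])
    have "C' p (\<lambda>q. \<omega>\<^sub>S q [A' q, B' q]) = C' p (\<lambda>q. \<omega> q [A q, B q])"
      by (rule tangent_cong'[OF S vector_field_on_tangent[OF S C(2) p] smooth_near_restrict[OF pS s] ev, symmetric])
    also have "\<dots> = push p (C' p) (\<lambda>q. \<omega> q [A q, B q])" by (rule push_apply[OF s, symmetric])
    finally show ?thesis unfolding C(3)[rule_format, OF p] .
  qed
  have l: "\<omega>\<^sub>S p [lie_bracket S A' B' p, C' p] = \<omega> p [lie_bracket M A B p, C p]"
    if A: "vector_field_on M W A" "vector_field_on S W' A'" "\<forall>q\<in>W'. push q (A' q) = A q"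
    and B: "vector_field_on M W B" "vector_field_on S W' B'" "\<forall>q\<in>W'. push q (B' q) = B q"
    and C: "vector_field_on M W C" "vector_field_on S W' C'" "\<forall>q\<in>W'. push q (C' q) = C q"
    for A A' B B' C C'
  proof -
    have t: "u' p (\<lambda>q. w' q f) = u p (\<lambda>q. w q f)"
      if u: "vector_field_on M W u" "vector_field_on S W' u'" "\<forall>q\<in>W'. push q (u' q) = u q"
      and w: "vector_field_on M W w" "vector_field_on S W' w'" "\<forall>q\<in>W'. push q (w' q) = w q"
      and f: "smooth_near M p f" for u u' w w' f
    proof -
      have ev: "\<forall>\<^sub>F q in nhdsin (topo S) p. w q f = w' q f"
        using evW' eventually_restrict[OF pS eventually_smooth_near[OF M f]]
      proof eventually_elim
        case (elim q)
        show ?case using push_apply[OF elim(2), of "w' q"] w(3)[rule_format, OF elim(1)] by simp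
      qed
      have s: "smooth_near M p (\<lambda>q. w q f)" by (rule vector_field_on_smooth[OF M w(1) pW f])
      have "u' p (\<lambda>q. w' q f) = u' p (\<lambda>q. w q f)"
        by (rule tangent_cong'[OF S vector_field_on_tangent[OF S u(2) p] smooth_near_restrict[OF pS s] ev, symmetric])
      also have "\<dots> = push p (u' p) (\<lambda>q. w q f)" by (rule push_apply[OF s, symmetric])
      finally show ?thesis unfolding u(3)[rule_format, OF p] .
    qed
    have "push p (lie_bracket S A' B' p) = lie_bracket M A B p"
    proof
      fix f
      show "push p (lie_bracket S A' B' p) f = lie_bracket M A B p f"
      proof (cases "smooth_near M p f")
        case True
        show ?thesis
          unfolding push_apply[OF True] lie_bracket_apply[OF True] lie_bracket_apply[OF smooth_near_restrict[OF pS True]]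
            t[OF A B True] t[OF B A True] ..
      qed (simp add: tangent_map_def lie_bracket_def)
    qed
    then show ?thesis by (simp add: \<omega>\<^sub>S_def C(3)[rule_format, OF p])
  qed
  show ?thesis
    unfolding ext_deriv_eq[OF M \<omega> X(1) Y(1) Z(1) pW] ext_deriv_eq[OF S kform_field_\<omega>\<^sub>S X(2) Y(2) Z(2) p]
      ext_deriv_at_def[OF M \<omega>] ext_deriv_at_def[OF S kform_field_\<omega>\<^sub>S]
      d[OF Y Z X] d[OF X Z Y] d[OF X Y Z] l[OF X Y Z] l[OF X Z Y] l[OF Y Z X] ..
qed

text \<open>Every covector of \<open>S\<close> at \<open>p\<close> is the differential of a function
  smooth on \<open>M\<close>. On such arguments each term of the equations for \<open>S\<close>
  equals the term of the equations for \<open>M\<close> at the differentials of the same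
  functions.\<close>

lemma twisted_jacobi_S: "twisted_jacobi S \<Lambda>\<^sub>S E\<^sub>S \<omega>\<^sub>S"
proof -
  have tM: "\<forall>p\<in>pts M. \<forall>\<alpha>s. length \<alpha>s = 3 \<longrightarrow> set \<alpha>s \<subseteq> cotangent M p \<longrightarrow>
        schouten M 2 2 \<Lambda> \<Lambda> p \<alpha>s + 2 * wedge 1 2 (vec_to_kvec (E p)) (\<Lambda> p) \<alpha>s =
        2 * sharp_form M \<Lambda> (ext_deriv M \<omega>) p \<alpha>s +
        2 * wedge 2 1 (sharp_form M \<Lambda> \<omega> p) (vec_to_kvec (E p)) \<alpha>s"
    and tM': "\<forall>p\<in>pts M. \<forall>\<alpha>s. length \<alpha>s = 2 \<longrightarrow> set \<alpha>s \<subseteq> cotangent M p \<longrightarrow>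
        schouten M 1 2 (\<lambda>q. vec_to_kvec (E q)) \<Lambda> p \<alpha>s =
        sharp_form_one M \<Lambda> (ext_deriv M \<omega>) E p \<alpha>s -
        wedge 1 1 (sharp_form_one M \<Lambda> \<omega> E p) (vec_to_kvec (E p)) \<alpha>s"
    using twisted unfolding twisted_jacobi_def by blast+
  have vE: "vec_to_kvec (E\<^sub>S p) (map (differential S p) gs) = vec_to_kvec (E p) (map (differential M p) gs)"
    if p: "p \<in> pts S" and gs: "length gs = 1" "\<forall>g\<in>set gs. smooth_near M p g" for p gs
  proof -
    obtain g where g: "gs = [g]" using list_length_1[OF gs(1)] by blast
    then have s: "smooth_near M p g" using gs(2) by simp
    show ?thesis unfolding g
      using differential_apply[OF E\<^sub>S_tangent[OF p], of g] differential_apply[OF E_tangent[OF p], of g] E\<^sub>S_apply[OF p s]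
      by (simp add: vec_to_kvec_def)
  qed
  have v\<Lambda>: "\<Lambda>\<^sub>S p (map (differential S p) gs) = \<Lambda> p (map (differential M p) gs)"
    if p: "p \<in> pts S" and gs: "length gs = 2" "\<forall>g\<in>set gs. smooth_near M p g" for p gs
  proof -
    obtain g h where g: "gs = [g, h]" using list_length_2[OF gs(1)] by blast
    then have s: "smooth_near M p g" "smooth_near M p h" using gs(2) by simp_all
    show ?thesis unfolding g list.map by (rule \<Lambda>\<^sub>S_differential[OF p s])
  qed
  have sh: "map (push p) (map (sharp S \<Lambda>\<^sub>S p) (map (differential S p) gs)) = map (sharp M \<Lambda> p) (map (differential M p) gs)"
    if p: "p \<in> pts S" and gs: "\<forall>g\<in>set gs. smooth_near M p g" for p gs
    using push_sharp[OF p] gs by simp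
  have v\<omega>: "sharp_form S \<Lambda>\<^sub>S \<omega>\<^sub>S p (map (differential S p) gs) = sharp_form M \<Lambda> \<omega> p (map (differential M p) gs)"
    if p: "p \<in> pts S" and gs: "\<forall>g\<in>set gs. smooth_near M p g" for p gs
    unfolding sharp_form_def \<omega>\<^sub>S_def sh[OF p gs] by simp
  have v\<omega>E: "sharp_form_one S \<Lambda>\<^sub>S \<omega>\<^sub>S E\<^sub>S p (map (differential S p) gs) = sharp_form_one M \<Lambda> \<omega> E p (map (differential M p) gs)"
    if p: "p \<in> pts S" and gs: "\<forall>g\<in>set gs. smooth_near M p g" for p gs
    unfolding sharp_form_one_def \<omega>\<^sub>S_def map_append sh[OF p gs] by (simp add: push_E\<^sub>S[OF p])
  have field: "vector_field_on M W (\<lambda>q. sharp M \<Lambda> q (differential M q f))"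
      "vector_field_on S (W \<inter> pts S) (\<lambda>q. sharp S \<Lambda>\<^sub>S q (differential S q f))"
      "\<forall>q\<in>W \<inter> pts S. push q (sharp S \<Lambda>\<^sub>S q (differential S q f)) = sharp M \<Lambda> q (differential M q f)"
    if W: "openin (topo M) W" and f: "\<forall>q\<in>W. smooth_near M q f" for W f
  proof -
    show "vector_field_on M W (\<lambda>q. sharp M \<Lambda> q (differential M q f))"
      by (rule hamiltonian_vector_field[OF M \<Lambda> W]) (use f in blast)
    show "vector_field_on S (W \<inter> pts S) (\<lambda>q. sharp S \<Lambda>\<^sub>S q (differential S q f))"
      by (rule hamiltonian_vector_field[OF S kvector_field_\<Lambda>\<^sub>S restrict_openin[OF W]])
         (use smooth_near_restrict f in blast)
    show "\<forall>q\<in>W \<inter> pts S. push q (sharp S \<Lambda>\<^sub>S q (differential S q f)) = sharp M \<Lambda> q (differential M q f)"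
      using push_sharp f by blast
  qed
  \<comment> \<open>On a common neighbourhood in \<open>M\<close> where the chosen functions are
    smooth, their Hamiltonian fields are vector fields, and the traces of these neighbourhoods on
    the leaf serve for the fields on \<open>S\<close>.\<close>
  have nbhd: "\<exists>W. openin (topo M) W \<and> p \<in> W \<and> (\<forall>q\<in>W. \<forall>f\<in>set fs. smooth_near M q f)"
    if p: "p \<in> pts S" and s: "\<And>f. f \<in> set fs \<Longrightarrow> smooth_near M p f" for p fs
  proof -
    have "\<forall>\<^sub>F q in nhdsin (topo M) p. \<forall>f\<in>set fs. smooth_near M q f"
      by (rule eventually_ball_finite) (use eventually_smooth_near[OF M s] in auto)
    then show ?thesis using pts_sub[OF p] by (auto simp: eventually_nhdsin)
  qed
  show ?thesis
    unfolding twisted_jacobi_def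
  proof (intro conjI S kvector_field_\<Lambda>\<^sub>S vector_field_E\<^sub>S kform_field_\<omega>\<^sub>S ballI allI impI)
    fix p \<alpha>s assume p: "p \<in> pts S" and l: "length (\<alpha>s :: 'a covec list) = 3" and c: "set \<alpha>s \<subseteq> cotangent S p"
    from l obtain \<alpha> \<beta> \<gamma> where \<alpha>s: "\<alpha>s = [\<alpha>, \<beta>, \<gamma>]"
      by (auto simp: numeral_3_eq_3 length_Suc_conv)
    then have "\<alpha> \<in> cotangent S p" "\<beta> \<in> cotangent S p" "\<gamma> \<in> cotangent S p" using c by auto
    then obtain f g h where s: "smooth_near M p f" "smooth_near M p g" "smooth_near M p h"
      and d: "\<alpha> = differential S p f" "\<beta> = differential S p g" "\<gamma> = differential S p h"
      using cotangent_S_eq_differential[OF p] by metis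
    define fs where "fs = [f, g, h]"
    have fs: "f \<in> set fs \<Longrightarrow> smooth_near M p f" for f using s by (auto simp: fs_def)
    have sub: "\<forall>g\<in>set gs. smooth_near M p g" if "set gs \<subseteq> set fs" for gs using that fs by blast
    have dS: "\<alpha>s = map (differential S p) fs" by (simp add: \<alpha>s d fs_def)
    obtain W where W: "openin (topo M) W" "p \<in> W" "\<forall>q\<in>W. \<forall>f\<in>set fs. smooth_near M q f" using nbhd[OF p fs] by blast
    have sW: "\<forall>q\<in>W. smooth_near M q f" "\<forall>q\<in>W. smooth_near M q g" "\<forall>q\<in>W. smooth_near M q h"
      using W(3) by (auto simp: fs_def)
    have pW: "p \<in> W \<inter> pts S" using W(2) p by blast
    have 1: "schouten S 2 2 \<Lambda>\<^sub>S \<Lambda>\<^sub>S p (map (differential S p) fs) = schouten M 2 2 \<Lambda> \<Lambda> p (map (differential M p) fs)"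
      unfolding fs_def list.map by (rule schouten_\<Lambda>\<^sub>S_\<Lambda>\<^sub>S[OF p s])
    have 2: "wedge 1 2 (vec_to_kvec (E\<^sub>S p)) (\<Lambda>\<^sub>S p) (map (differential S p) fs) =
        wedge 1 2 (vec_to_kvec (E p)) (\<Lambda> p) (map (differential M p) fs)"
      by (rule wedge_map_cong; (rule vE[OF p _ sub] v\<Lambda>[OF p _ sub])?) (simp_all add: fs_def)
    have 3: "wedge 2 1 (sharp_form S \<Lambda>\<^sub>S \<omega>\<^sub>S p) (vec_to_kvec (E\<^sub>S p)) (map (differential S p) fs) =
        wedge 2 1 (sharp_form M \<Lambda> \<omega> p) (vec_to_kvec (E p)) (map (differential M p) fs)"
      by (rule wedge_map_cong; (rule v\<omega>[OF p sub] vE[OF p _ sub])?) (simp_all add: fs_def)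
    have "ext_deriv S \<omega>\<^sub>S p [sharp S \<Lambda>\<^sub>S p (differential S p f), sharp S \<Lambda>\<^sub>S p (differential S p g), sharp S \<Lambda>\<^sub>S p (differential S p h)] =
        ext_deriv M \<omega> p [sharp M \<Lambda> p (differential M p f), sharp M \<Lambda> p (differential M p g), sharp M \<Lambda> p (differential M p h)]"
      by (rule ext_deriv_push[OF field[OF W(1) sW(1)] field[OF W(1) sW(2)] field[OF W(1) sW(3)] Int_lower1 pW])
    then have 4: "sharp_form S \<Lambda>\<^sub>S (ext_deriv S \<omega>\<^sub>S) p (map (differential S p) fs) =
        sharp_form M \<Lambda> (ext_deriv M \<omega>) p (map (differential M p) fs)"
      by (simp add: sharp_form_def fs_def)
    have cM: "set (map (differential M p) fs) \<subseteq> cotangent M p"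
      using differential_cotangent[OF fs] by auto
    show "schouten S 2 2 \<Lambda>\<^sub>S \<Lambda>\<^sub>S p \<alpha>s + 2 * wedge 1 2 (vec_to_kvec (E\<^sub>S p)) (\<Lambda>\<^sub>S p) \<alpha>s =
        2 * sharp_form S \<Lambda>\<^sub>S (ext_deriv S \<omega>\<^sub>S) p \<alpha>s +
        2 * wedge 2 1 (sharp_form S \<Lambda>\<^sub>S \<omega>\<^sub>S p) (vec_to_kvec (E\<^sub>S p)) \<alpha>s"
      unfolding dS 1 2 3 4
      by (rule tM[THEN bspec[OF _ pts_sub[OF p]], THEN spec, THEN mp, THEN mp, OF _ cM]) (simp add: fs_def)
  next
    fix p \<alpha>s assume p: "p \<in> pts S" and l: "length (\<alpha>s :: 'a covec list) = 2" and c: "set \<alpha>s \<subseteq> cotangent S p"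
    from l obtain \<alpha> \<beta> where \<alpha>s: "\<alpha>s = [\<alpha>, \<beta>]" using list_length_2 by blast
    then have "\<alpha> \<in> cotangent S p" "\<beta> \<in> cotangent S p" using c by auto
    then obtain f g where s: "smooth_near M p f" "smooth_near M p g"
      and d: "\<alpha> = differential S p f" "\<beta> = differential S p g"
      using cotangent_S_eq_differential[OF p] by metis
    define fs where "fs = [f, g]"
    have fs: "f \<in> set fs \<Longrightarrow> smooth_near M p f" for f using s by (auto simp: fs_def)
    have sub: "\<forall>g\<in>set gs. smooth_near M p g" if "set gs \<subseteq> set fs" for gs using that fs by blast
    have dS: "\<alpha>s = map (differential S p) fs" by (simp add: \<alpha>s d fs_def)
    obtain W where W: "openin (topo M) W" "p \<in> W" "\<forall>q\<in>W. \<forall>f\<in>set fs. smooth_near M q f" using nbhd[OF p fs] by blast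
    have sW: "\<forall>q\<in>W. smooth_near M q f" "\<forall>q\<in>W. smooth_near M q g"
      using W(3) by (auto simp: fs_def)
    have pW: "p \<in> W \<inter> pts S" using W(2) p by blast
    have 1: "schouten S 1 2 (\<lambda>q. vec_to_kvec (E\<^sub>S q)) \<Lambda>\<^sub>S p (map (differential S p) fs) =
        schouten M 1 2 (\<lambda>q. vec_to_kvec (E q)) \<Lambda> p (map (differential M p) fs)"
      unfolding fs_def list.map by (rule schouten_E\<^sub>S_\<Lambda>\<^sub>S[OF p s])
    have 2: "wedge 1 1 (sharp_form_one S \<Lambda>\<^sub>S \<omega>\<^sub>S E\<^sub>S p) (vec_to_kvec (E\<^sub>S p)) (map (differential S p) fs) =
        wedge 1 1 (sharp_form_one M \<Lambda> \<omega> E p) (vec_to_kvec (E p)) (map (differential M p) fs)"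
      by (rule wedge_map_cong; (rule v\<omega>E[OF p sub] vE[OF p _ sub])?) (simp_all add: fs_def)
    have EW: "vector_field_on M W E" by (rule vector_field_on_subset[OF M E W(1) openin_subset[OF W(1)]])
    have EWS: "vector_field_on S (W \<inter> pts S) E\<^sub>S"
      by (rule vector_field_on_subset[OF S vector_field_E\<^sub>S restrict_openin[OF W(1)]]) simp
    have "ext_deriv S \<omega>\<^sub>S p [sharp S \<Lambda>\<^sub>S p (differential S p f), sharp S \<Lambda>\<^sub>S p (differential S p g), E\<^sub>S p] =
        ext_deriv M \<omega> p [sharp M \<Lambda> p (differential M p f), sharp M \<Lambda> p (differential M p g), E p]"
      by (rule ext_deriv_push[OF field[OF W(1) sW(1)] field[OF W(1) sW(2)] EW EWS _ Int_lower1 pW])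
         (simp add: push_E\<^sub>S)
    then have 4: "sharp_form_one S \<Lambda>\<^sub>S (ext_deriv S \<omega>\<^sub>S) E\<^sub>S p (map (differential S p) fs) =
        sharp_form_one M \<Lambda> (ext_deriv M \<omega>) E p (map (differential M p) fs)"
      by (simp add: sharp_form_one_def fs_def)
    have cM: "set (map (differential M p) fs) \<subseteq> cotangent M p"
      using differential_cotangent[OF fs] by auto
    show "schouten S 1 2 (\<lambda>q. vec_to_kvec (E\<^sub>S q)) \<Lambda>\<^sub>S p \<alpha>s =
        sharp_form_one S \<Lambda>\<^sub>S (ext_deriv S \<omega>\<^sub>S) E\<^sub>S p \<alpha>s -
        wedge 1 1 (sharp_form_one S \<Lambda>\<^sub>S \<omega>\<^sub>S E\<^sub>S p) (vec_to_kvec (E\<^sub>S p)) \<alpha>s"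
      unfolding dS 1 2 4
      by (rule tM'[THEN bspec[OF _ pts_sub[OF p]], THEN spec, THEN mp, THEN mp, OF _ cM]) (simp add: fs_def)
  qed
qed

section \<open>Transitivity\<close>

text \<open>Holds as an equality of HOL functions because tangent vectors are normalised to vanish
  on functions that are not smooth near the point.\<close>

lemma tangent_map_id_S: "v \<in> tangent S p \<Longrightarrow> tangent_map S id p v = v"
  by (rule ext) (simp add: tangent_map_def tangent_not_smooth)

text \<open>For the inclusion from right to left, the image of a tangent vector of \<open>S\<close>
  in \<open>M\<close> has the form \<open>\<Lambda>\<^sup>#(df) + t E\<close>. The same combination
  of the structures on \<open>S\<close> has the same image, so injectivity of \<open>push\<close>
  identifies the two vectors.\<close>

lemma char_distribution_S:
  assumes p: "p \<in> pts S"
  shows "char_distribution S \<Lambda>\<^sub>S E\<^sub>S p = tangent S p"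
proof
  show "char_distribution S \<Lambda>\<^sub>S E\<^sub>S p \<subseteq> tangent S p"
  proof
    fix v assume "v \<in> char_distribution S \<Lambda>\<^sub>S E\<^sub>S p"
    then obtain \<alpha> t where v: "v = (\<lambda>f. sharp S \<Lambda>\<^sub>S p \<alpha> f + t * E\<^sub>S p f)" and \<alpha>: "\<alpha> \<in> cotangent S p"
      unfolding char_distribution_def by blast
    show "v \<in> tangent S p"
      using tangent_subspace[OF sharp_tangent[OF S kvector_field_\<Lambda>\<^sub>S p \<alpha>] E\<^sub>S_tangent[OF p], of 1 t] by (simp add: v)
  qed
  show "tangent S p \<subseteq> char_distribution S \<Lambda>\<^sub>S E\<^sub>S p"
  proof
    fix u assume u: "u \<in> tangent S p"
    then have "push p u \<in> char_distribution M \<Lambda> E p" using push_image[OF p] by blast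
    then obtain \<alpha> t where pu: "push p u = (\<lambda>f. sharp M \<Lambda> p \<alpha> f + t * E p f)" and \<alpha>: "\<alpha> \<in> cotangent M p"
      unfolding char_distribution_def by blast
    obtain f where f: "smooth_near M p f" "\<alpha> = differential M p f"
      using cotangent_eq_differential[OF M pts_sub[OF p] \<alpha>] .
    note dS = differential_cotangent[OF smooth_near_restrict[OF p f(1)]]
    define w where "w = (\<lambda>g. 1 * sharp S \<Lambda>\<^sub>S p (differential S p f) g + t * E\<^sub>S p g)"
    have w: "w \<in> tangent S p" unfolding w_def
      by (rule tangent_subspace[OF sharp_tangent[OF S kvector_field_\<Lambda>\<^sub>S p dS] E\<^sub>S_tangent[OF p]])
    have "push p w = push p u"
      unfolding w_def push_lincomb push_sharp[OF p f(1)] push_E\<^sub>S[OF p] pu f(2) by simp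
    then have "u = w" using inj_onD[OF tangent_map_inj_on[OF p] _ u w] by simp
    then show "u \<in> char_distribution S \<Lambda>\<^sub>S E\<^sub>S p" unfolding char_distribution_def w_def using dS by auto
  qed
qed

lemma transitive_jacobi_S: "transitive_jacobi S \<Lambda>\<^sub>S E\<^sub>S"
proof -
  have "smooth_in (model S) (\<phi> ` {x \<in> U. id x \<in> U'}) (\<psi> \<circ> id \<circ> inv_into U \<phi>)"
    if "(U, \<phi>) \<in> atlas S" "(U', \<psi>) \<in> atlas S" for U \<phi> U' \<psi>
    using chart_transition[OF S that] by (simp add: Int_def)
  then have "smooth_map S S id" unfolding smooth_map_def by auto
  then have "immersed_submanifold S S"
    unfolding immersed_submanifold_def using S by (auto intro!: inj_onI simp: tangent_map_id_S)
  moreover have "tangent_map S id p ` tangent S p = char_distribution S \<Lambda>\<^sub>S E\<^sub>S p" if "p \<in> pts S" for p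
    unfolding char_distribution_S[OF that] by (simp add: tangent_map_id_S cong: image_cong)
  ultimately have "integral_manifold S \<Lambda>\<^sub>S E\<^sub>S S"
    using leaf unfolding integral_manifold_def by blast
  \<comment> \<open>Maximality is automatic: an integral manifold for the structure on
    \<open>S\<close> is immersed in \<open>S\<close> and so has no points outside it.\<close>
  moreover have "pts N = pts S" if "integral_manifold S \<Lambda>\<^sub>S E\<^sub>S N" "pts S \<subseteq> pts N" for N
    using that unfolding integral_manifold_def immersed_submanifold_def by blast
  ultimately have "characteristic_leaf S \<Lambda>\<^sub>S E\<^sub>S S" unfolding characteristic_leaf_def by blast
  then show ?thesis unfolding transitive_jacobi_def by blast
qed

section \<open>The bracket of functions on the leaf\<close>

text \<open>The terms with derivatives agree because \<open>f\<close> and \<open>g\<close> have the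
  same differentials along \<open>S\<close> as \<open>f'\<close> and \<open>g'\<close>; the
  undifferentiated factors agree because \<open>x\<close> itself lies in the neighbourhood where the
  functions coincide.\<close>

lemma jacobi_bracket_S:
  assumes x: "x \<in> pts S" and u: "smooth_near S x f'" "smooth_near S x g'"
    and f: "local_extension M S x f' f" and g: "local_extension M S x g' g"
  shows "jacobi_bracket M \<Lambda> E f g x = jacobi_bracket S \<Lambda>\<^sub>S E\<^sub>S f' g' x"
proof -
  have s: "smooth_near M x f" "smooth_near M x g" using f g by (auto simp: local_extension_def)
  have ev: "\<forall>\<^sub>F y in nhdsin (topo S) x. f y = f' y" "\<forall>\<^sub>F y in nhdsin (topo S) x. g y = g' y"
    using f g by (auto simp: local_extension_def eventually_nhdsin)
  have d: "differential S x f = differential S x f'" "differential S x g = differential S x g'"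
    by (rule differential_cong[OF smooth_near_restrict[OF x s(1)] u(1) ev(1)],
        rule differential_cong[OF smooth_near_restrict[OF x s(2)] u(2) ev(2)])
  have e: "f x = f' x" "g x = g' x" using eventually_nhdsin_self[OF _ x] ev by auto
  have E: "differential M x h (E x) = differential S x h (E\<^sub>S x)" if "smooth_near M x h" for h
    using differential_apply[OF E\<^sub>S_tangent[OF x], of h] differential_apply[OF E_tangent[OF x], of h] E\<^sub>S_apply[OF x that] by simp
  show ?thesis
    unfolding jacobi_bracket_def \<Lambda>\<^sub>S_differential[OF x s, symmetric] E[OF s(1)] E[OF s(2)] d e ..
qed

lemma ex_local_extension:
  assumes x: "x \<in> pts S" and u: "smooth_near S x f'"
  shows "\<exists>f. local_extension M S x f' f"
proof -
  obtain f where "smooth_near M x f" "\<forall>\<^sub>F q in nhdsin (topo S) x. f q = f' q" using smooth_extension[OF x u] .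
  then show ?thesis unfolding local_extension_def using x by (auto simp: eventually_nhdsin)
qed

text \<open>Existence of local extensions makes the bracket of the induced structure a value. It is
  the only one, since it does not mention the extensions.\<close>

lemma leaf_bracket_value_iff:
  assumes x: "x \<in> pts S" and u: "smooth_near S x f'" "smooth_near S x g'"
  shows "leaf_bracket_value M \<Lambda> E S f' g' x r \<longleftrightarrow> r = jacobi_bracket S \<Lambda>\<^sub>S E\<^sub>S f' g' x"
  unfolding leaf_bracket_value_def
  using jacobi_bracket_S[OF x u] ex_local_extension[OF x u(1)] ex_local_extension[OF x u(2)] by metis

lemma leaf_bracket_eq:
  assumes "x \<in> pts S" "smooth_near S x f'" "smooth_near S x g'"
  shows "leaf_bracket M \<Lambda> E S f' g' x = jacobi_bracket S \<Lambda>\<^sub>S E\<^sub>S f' g' x"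
  unfolding leaf_bracket_def leaf_bracket_value_iff[OF assms] by simp

lemma smooth_jacobi_bracket_S:
  assumes x: "x \<in> pts S" and u: "smooth_near S x f" "smooth_near S x g"
  shows "smooth_near S x (jacobi_bracket S \<Lambda>\<^sub>S E\<^sub>S f g)"
proof -
  note sE = vector_field_on_smooth[OF S vector_field_E\<^sub>S x]
  have 1: "smooth_near S x (\<lambda>q. \<Lambda>\<^sub>S q [differential S q f, differential S q g] + (f q * E\<^sub>S q g - g q * E\<^sub>S q f))"
    by (intro smooth_near_add[OF S] smooth_near_diff[OF S] smooth_near_mult[OF S] u sE
        kvector_field_smooth[OF S kvector_field_\<Lambda>\<^sub>S])
  have "\<forall>\<^sub>F q in nhdsin (topo S) x. \<Lambda>\<^sub>S q [differential S q f, differential S q g] + (f q * E\<^sub>S q g - g q * E\<^sub>S q f) =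
      jacobi_bracket S \<Lambda>\<^sub>S E\<^sub>S f g q"
    using eventually_in_S[OF x]
    by eventually_elim (simp add: jacobi_bracket_def differential_apply[OF E\<^sub>S_tangent])
  then show ?thesis by (rule smooth_near_cong[OF S 1])
qed

lemma smooth_funs_near: "f \<in> smooth_funs S \<Longrightarrow> x \<in> pts S \<Longrightarrow> smooth_near S x f"
  by (simp add: smooth_funs_def smooth_fun_on_iff_near[OF S])

lemma leaf_bracket_smooth:
  assumes "f \<in> smooth_funs S" "g \<in> smooth_funs S"
  shows "leaf_bracket M \<Lambda> E S f g \<in> smooth_funs S"
  unfolding smooth_funs_def smooth_fun_on_iff_near[OF S]
proof (intro CollectI conjI ballI)
  fix x assume x: "x \<in> pts S"
  have "\<forall>\<^sub>F q in nhdsin (topo S) x. jacobi_bracket S \<Lambda>\<^sub>S E\<^sub>S f g q = leaf_bracket M \<Lambda> E S f g q"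
    using eventually_in_S[OF x]
    by eventually_elim (rule leaf_bracket_eq[OF _ smooth_funs_near[OF assms(1)] smooth_funs_near[OF assms(2)], symmetric])
  then show "smooth_near S x (leaf_bracket M \<Lambda> E S f g)"
    by (rule smooth_near_cong[OF S smooth_jacobi_bracket_S[OF x smooth_funs_near[OF assms(1) x] smooth_funs_near[OF assms(2) x]]])
qed simp

end

theorem theorem3p2:
  fixes M S :: "('a, 'e::euclidean_space) manifold"
    and \<Lambda> :: "'a \<Rightarrow> 'a kvec" and E :: "'a \<Rightarrow> 'a tvec" and \<omega> :: "'a \<Rightarrow> 'a kform"
  assumes "twisted_jacobi M \<Lambda> E \<omega>"
    and "characteristic_leaf M \<Lambda> E S"
  shows "(\<forall>f'\<in>smooth_funs S. \<forall>g'\<in>smooth_funs S.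
            (\<forall>x\<in>pts S. \<exists>!r. leaf_bracket_value M \<Lambda> E S f' g' x r) \<and>
            leaf_bracket M \<Lambda> E S f' g' \<in> smooth_funs S) \<and>
         (\<exists>\<Lambda>\<^sub>S E\<^sub>S \<omega>\<^sub>S. twisted_jacobi S \<Lambda>\<^sub>S E\<^sub>S \<omega>\<^sub>S \<and> transitive_jacobi S \<Lambda>\<^sub>S E\<^sub>S \<and>
            (\<forall>f'\<in>smooth_funs S. \<forall>g'\<in>smooth_funs S. \<forall>x\<in>pts S.
               leaf_bracket M \<Lambda> E S f' g' x = jacobi_bracket S \<Lambda>\<^sub>S E\<^sub>S f' g' x))"
proof -
  interpret L: jacobi_leaf M S \<Lambda> E \<omega>
    by unfold_locales
       (use assms in \<open>auto simp: twisted_jacobi_def characteristic_leaf_def integral_manifold_def\<close>)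
  show ?thesis
  proof (intro conjI ballI exI)
    fix f g x assume f: "f \<in> smooth_funs S" and g: "g \<in> smooth_funs S" and x: "x \<in> pts S"
    note s = L.smooth_funs_near[OF f x] L.smooth_funs_near[OF g x]
    show "\<exists>!r. leaf_bracket_value M \<Lambda> E S f g x r"
      unfolding L.leaf_bracket_value_iff[OF x s] by simp
    show "leaf_bracket M \<Lambda> E S f g x = jacobi_bracket S L.\<Lambda>\<^sub>S L.E\<^sub>S f g x" by (rule L.leaf_bracket_eq[OF x s])
  qed (rule L.leaf_bracket_smooth L.twisted_jacobi_S L.transitive_jacobi_S; assumption?)+
qed

end
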